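(* Fix a parity for framed 4-graphs with one unicursal component (for example, the Gaussian parity). Let $\Gamma$ be an irreducibly odd framed 4-graph with one unicursal component, and let $K_\Gamma$ be the free knot generated by $\Gamma$. Then any representative $\Gamma'$ of $K_\Gamma$ has a smoothing $\tilde\Gamma$ having the same number of vertices as $\Gamma$. In particular, $\Gamma$ is a minimal representative of the free knot $K_\Gamma$ with respect to the number of vertices.
   Context: A framed 4-graph is a finite 4-valent graph (loops and multiple edges allowed, as well as components homeomorphic to a circle without vertices) in which at each vertex the four emanating half-edges are split into two pairs, called pairs of (formally) opposite half-edges. Isomorphisms respect the framing. Passing at each vertex from a half-edge to the opposite one decomposes the graph into unicursal components. Reidemeister moves. (1) Addition/removal of a vertex carrying a loop whose two half-edges are non-opposite at that vertex (on removal the other two half-edges are merged into one edge). (2) Addition/removal of a bigon: two vertices $u,v$ joined by two edges that are non-opposite both at $u$ and at $v$; on removal $u,v$ disappear and, for each of the two bigon edges $e$, the half-edge opposite to $e$ at $u$ is joined with the half-edge opposite to $e$ at $v$. The removal is the decreasing second move. (3) Three vertices pairwise joined by the edges of a triangle, the two triangle edges being non-opposite at each of the three vertices; the move pulls one strand through the crossing of the other two, i.e. each of the three strands passes its two crossings in the opposite order. A free link is an equivalence class of framed 4-graphs modulo these moves; a free knot is a free link with one unicursal component. A framed 4-graph with one unicursal component is encoded by its chord (Gauss) diagram: a circle traversing the unicursal component, with one chord per vertex joining the two preimages of the vertex. Two chords are linked if the ends of one lie in different components of the circle minus the ends of the other. A parity is a rule declaring every vertex of every framed 4-graph with one unicursal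 component even or odd (invariantly under framed isomorphisms) such that: the vertex added/removed by a first Reidemeister move is even; the two vertices added/removed by a second move have the same parity; among the three vertices participating in a third move the number of odd ones is even, and each of these three vertices has the same parity before and after the move; vertices not participating in a move keep their parity. The Gaussian parity declares a vertex even if its chord is linked with an even number of other chords, and odd otherwise. A framed 4-graph with one unicursal component is irreducibly odd if all its vertices are odd and no decreasing second Reidemeister move can be applied to it. Smoothing at a vertex $v$ with half-edges $a,b,c,d$, where $a$ is opposite to $c$ and $b$ is opposite to $d$: remove $v$ and reconnect either $a$ with $b$ and $c$ with $d$, or $a$ with $d$ and $b$ with $c$; the rest of the graph with its framing is unchanged. A smoothing of a graph is the result of smoothing at several (possibly zero) vertices. *)

theory Defs
  imports Main
begin

(* A framed 4-graph is given by its half-edges: opp sends a half-edge to the opposite one at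
   the same vertex, mate to the other half of its edge, and circles counts the components
   without vertices.  The graphs are finite, so labels in nat cover all of them up to
   isomorphism.  The values of vert, opp and mate outside hedges are irrelevant. *)

record fgraph =
  verts :: "nat set"
  hedges :: "nat set"
  vert :: "nat \<Rightarrow> nat"
  opp :: "nat \<Rightarrow> nat"
  mate :: "nat \<Rightarrow> nat"
  circles :: nat

definition framed4 :: "fgraph \<Rightarrow> bool" where
  "framed4 G \<longleftrightarrow>
     finite (verts G) \<and>
     (\<forall>h\<in>hedges G. vert G h \<in> verts G) \<and>
     (\<forall>v\<in>verts G. card {h \<in> hedges G. vert G h = v} = 4) \<and>
     (\<forall>h\<in>hedges G. opp G h \<in> hedges G \<and> opp G h \<noteq> h \<and> opp G (opp G h) = h \<and>
        vert G (opp G h) = vert G h) \<and>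
     (\<forall>h\<in>hedges G. mate G h \<in> hedges G \<and> mate G h \<noteq> h \<and> mate G (mate G h) = h)"

definition isomorphism :: "(nat \<Rightarrow> nat) \<Rightarrow> (nat \<Rightarrow> nat) \<Rightarrow> fgraph \<Rightarrow> fgraph \<Rightarrow> bool" where
  "isomorphism \<phi> \<psi> G G' \<longleftrightarrow>
     bij_betw \<phi> (verts G) (verts G') \<and>
     bij_betw \<psi> (hedges G) (hedges G') \<and>
     (\<forall>h\<in>hedges G. vert G' (\<psi> h) = \<phi> (vert G h) \<and>
        opp G' (\<psi> h) = \<psi> (opp G h) \<and> mate G' (\<psi> h) = \<psi> (mate G h)) \<and>
     circles G' = circles G"

definition isomorphic :: "fgraph \<Rightarrow> fgraph \<Rightarrow> bool" where
  "isomorphic G G' \<longleftrightarrow> framed4 G \<and> framed4 G' \<and> (\<exists>\<phi> \<psi>. isomorphism \<phi> \<psi> G G')"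

definition unicursal_components :: "fgraph \<Rightarrow> nat" where
  "unicursal_components G =
     circles G + card (hedges G // {(x, y). x \<in> hedges G \<and> (y = mate G x \<or> y = opp G x)}\<^sup>*)"

definition unicursal :: "fgraph \<Rightarrow> bool" where
  "unicursal G \<longleftrightarrow> framed4 G \<and> unicursal_components G = 1"

definition hedges_at :: "fgraph \<Rightarrow> nat set \<Rightarrow> nat set" where
  "hedges_at G X = {h \<in> hedges G. vert G h \<in> X}"

(* splice G X j removes the vertices in X and glues each half-edge h formerly ending in X to
   j h, where j is a fixed-point-free involution of hedges_at G X.  The old edges then form
   chains (the classes of joined): a chain between two surviving half-edges becomes one edge,
   and a chain consisting of removed half-edges only becomes a circle without vertices. *)

definition joined :: "fgraph \<Rightarrow> nat set \<Rightarrow> (nat \<Rightarrow> nat) \<Rightarrow> (nat \<times> nat) set" where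
  "joined G X j =
     {(x, y). (x \<in> hedges G \<and> y = mate G x) \<or> (x \<in> hedges_at G X \<and> y = j x)}\<^sup>*"

definition splice :: "fgraph \<Rightarrow> nat set \<Rightarrow> (nat \<Rightarrow> nat) \<Rightarrow> fgraph" where
  "splice G X j = G
     \<lparr>verts := verts G - X,
      hedges := hedges G - hedges_at G X,
      mate := (\<lambda>h. THE h'. h' \<in> hedges G - hedges_at G X \<and> h' \<noteq> h \<and> (h, h') \<in> joined G X j),
      circles := circles G + card {C \<in> hedges G // joined G X j. C \<subseteq> hedges_at G X}\<rparr>"

definition loop_at :: "fgraph \<Rightarrow> nat \<Rightarrow> bool" where
  "loop_at G v \<longleftrightarrow>
     (\<exists>a\<in>hedges G. vert G a = v \<and> vert G (mate G a) = v \<and> mate G a \<noteq> opp G a)"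

definition bigon :: "fgraph \<Rightarrow> nat \<Rightarrow> nat \<Rightarrow> bool" where
  "bigon G u v \<longleftrightarrow> u \<noteq> v \<and>
     (\<exists>a\<in>hedges G. \<exists>b\<in>hedges G. a \<noteq> b \<and>
        vert G a = u \<and> vert G b = u \<and> vert G (mate G a) = v \<and> vert G (mate G b) = v \<and>
        b \<noteq> opp G a \<and> mate G b \<noteq> opp G (mate G a))"

(* Vertex removal in the first and second moves.  For an edge {a, mate a} of the removed loop or
   bigon, gluing along opp produces the chain opp a, a, mate a, opp (mate a): the half-edges
   opposite to the two ends of a removed edge become joined. *)

definition remove_verts :: "fgraph \<Rightarrow> nat set \<Rightarrow> fgraph" where
  "remove_verts G X = splice G X (opp G)"

(* Triangle with edges {a, mate a}, {b, mate b}, {c, mate c} and vertices vert a, vert b, vert c. *)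

definition triangle :: "fgraph \<Rightarrow> nat \<Rightarrow> nat \<Rightarrow> nat \<Rightarrow> bool" where
  "triangle G a b c \<longleftrightarrow>
     {a, b, c} \<subseteq> hedges G \<and> distinct [vert G a, vert G b, vert G c] \<and>
     vert G (mate G a) = vert G b \<and> vert G (mate G b) = vert G c \<and> vert G (mate G c) = vert G a \<and>
     b \<noteq> opp G (mate G a) \<and> c \<noteq> opp G (mate G b) \<and> a \<noteq> opp G (mate G c)"

(* Before the third move the strand along the triangle edge {p, q} (q = mate p) runs
   opp p, p, q, opp q; afterwards the outer ends formerly attached to opp p and opp q are attached
   to q and p, and opp q is joined to opp p, so the two vertices are met in the opposite order.
   This amounts to exchanging the places opp p and q, and opp q and p, in all edges.  Vertices
   keep their labels: each of them remains the crossing of the same two strands. *)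

definition third_swap :: "fgraph \<Rightarrow> nat \<Rightarrow> nat \<Rightarrow> nat \<Rightarrow> nat \<Rightarrow> nat" where
  "third_swap G a b c h =
     (let T = {a, mate G a, b, mate G b, c, mate G c} in
      if h \<in> T then opp G (mate G h)
      else if opp G h \<in> T then mate G (opp G h)
      else h)"

definition third_move :: "fgraph \<Rightarrow> nat \<Rightarrow> nat \<Rightarrow> nat \<Rightarrow> fgraph" where
  "third_move G a b c = G
     \<lparr>mate := (\<lambda>h. third_swap G a b c (mate G (third_swap G a b c h)))\<rparr>"

inductive move :: "fgraph \<Rightarrow> fgraph \<Rightarrow> bool" where
  first: "framed4 G \<Longrightarrow> loop_at G v \<Longrightarrow> move G (remove_verts G {v})"
| second: "framed4 G \<Longrightarrow> bigon G u v \<Longrightarrow> move G (remove_verts G {u, v})"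
| third: "framed4 G \<Longrightarrow> triangle G a b c \<Longrightarrow> move G (third_move G a b c)"

definition free_link :: "fgraph \<Rightarrow> fgraph set" where
  "free_link G = {G'. framed4 G' \<and> equivclp (\<lambda>H H'. isomorphic H H' \<or> move H H') G G'}"

(* P G v means that the vertex v of G is odd. *)

definition is_parity :: "(fgraph \<Rightarrow> nat \<Rightarrow> bool) \<Rightarrow> bool" where
  "is_parity P \<longleftrightarrow>
     (\<forall>G G' \<phi> \<psi>. unicursal G \<and> unicursal G' \<and> isomorphism \<phi> \<psi> G G' \<longrightarrow>
        (\<forall>w\<in>verts G. P G' (\<phi> w) = P G w)) \<and>
     (\<forall>G v. unicursal G \<and> loop_at G v \<longrightarrow>
        \<not> P G v \<and> (\<forall>w\<in>verts G - {v}. P (remove_verts G {v}) w = P G w)) \<and>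
     (\<forall>G u v. unicursal G \<and> bigon G u v \<longrightarrow>
        P G u = P G v \<and> (\<forall>w\<in>verts G - {u, v}. P (remove_verts G {u, v}) w = P G w)) \<and>
     (\<forall>G a b c. unicursal G \<and> triangle G a b c \<longrightarrow>
        even (card {w \<in> {vert G a, vert G b, vert G c}. P G w}) \<and>
        (\<forall>w\<in>verts G. P (third_move G a b c) w = P G w))"

definition irreducibly_odd :: "(fgraph \<Rightarrow> nat \<Rightarrow> bool) \<Rightarrow> fgraph \<Rightarrow> bool" where
  "irreducibly_odd P G \<longleftrightarrow>
     unicursal G \<and> (\<forall>v\<in>verts G. P G v) \<and> (\<nexists>u v. bigon G u v)"

(* Exchanging b and opp b gives the other smoothing at v. *)

definition smooth_at :: "fgraph \<Rightarrow> nat \<Rightarrow> fgraph \<Rightarrow> bool" where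
  "smooth_at G v G' \<longleftrightarrow>
     (\<exists>a\<in>hedges G. \<exists>b\<in>hedges G. vert G a = v \<and> vert G b = v \<and> a \<noteq> b \<and> b \<noteq> opp G a \<and>
        G' = splice G {v} (id(a := b, b := a, opp G a := opp G b, opp G b := opp G a)))"

definition is_smoothing :: "fgraph \<Rightarrow> fgraph \<Rightarrow> bool" where
  "is_smoothing G G' \<longleftrightarrow> (\<lambda>H H'. \<exists>v\<in>verts H. smooth_at H v H')\<^sup>*\<^sup>* G G'"

end

theory Submission
  imports Defs "HOL-Combinatorics.Transposition" "HOL-Library.Multiset"
begin

text \<open>Since smoothing always removes exactly one vertex, only \<open>card (verts \<Gamma>) \<le> card (verts \<Gamma>')\<close>
  is at stake. It follows from Manturov's parity bracket: smooth all even vertices of \<open>\<Gamma>'\<close> in all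
  possible ways and count, modulo 2, the results that decreasing second moves reduce to \<open>\<Gamma>\<close>.
  A result with a vertex-free circle never reduces to \<open>\<Gamma>\<close>. Hence a first move does not change the
  count, and neither does a second move between even vertices: one of its four states has a circle
  and two others coincide. Second moves between odd vertices are harmless because the reduction is
  confluent. A third move involves an even vertex; one smoothing of it produces bigons
  whose removal gives the same graph before and after the move, and the other produces isomorphic
  graphs. The count is 1 for \<open>\<Gamma>\<close> itself, so some state of \<open>\<Gamma>'\<close> reduces to \<open>\<Gamma>\<close>.\<close>

section \<open>Cutting half-edges out of a graph\<close>

text \<open>Parities exist only for graphs with one unicursal component, while states produced by
  smoothing may have several. The even vertices are therefore read off once, from the
  representative, and carried along as a list; no state is ever asked for a parity. Of the bracket
  only one coefficient is kept, that of \<open>\<Gamma>\<close>. This avoids formal sums over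
  isomorphism classes, at the price of proving confluence and independence of the order of
  smoothing. Circles act as an obstruction because smoothings and reductions never destroy one,
  while \<open>\<Gamma>\<close> has none as soon as it has a vertex: its only unicursal component is
  then the strand through that vertex. \<open>splice\<close> describes its result by chains of
  arbitrary length, which is awkward for comparing the two sides of a move. Everything is instead
  built by gluing one pair of half-edges at a time. Since surviving half-edges keep their labels,
  such gluings commute up to equality and not just isomorphism, and local identities become
  comparisons of sets of glued pairs. Chains return only where the two descriptions are
  matched.\<close>

text \<open>Fixing the junk values of \<open>mate\<close> turns the identities between graphs below into equations
  of records.\<close>

definition tidy :: "fgraph \<Rightarrow> bool" where
  "tidy G \<longleftrightarrow> (\<forall>h. mate G (mate G h) = h) \<and> (\<forall>h. h \<in> hedges G \<longleftrightarrow> mate G h \<noteq> h)"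

text \<open>The elementary gluing: \<open>h\<close> is glued to \<open>k\<close>, so the far ends of
  their edges become one edge. If \<open>h\<close> and \<open>k\<close> are the two ends of one
  edge, it closes up to a circle. A single \<open>cut\<close> in general destroys 4-valence, so
  intermediate graphs are only known to be tidy.\<close>

definition cut :: "nat \<Rightarrow> nat \<Rightarrow> fgraph \<Rightarrow> fgraph" where
  "cut h k G = G
     \<lparr>hedges := hedges G - {h, k},
      mate := (\<lambda>x. if x = h \<or> x = k then x else if x = mate G h then mate G k
                   else if x = mate G k then mate G h else mate G x),
      circles := circles G + (if mate G h = k then 1 else 0)\<rparr>"

definition del :: "nat \<Rightarrow> nat \<Rightarrow> fgraph \<Rightarrow> fgraph" where
  "del h k G = G\<lparr>hedges := hedges G - {h, k}, mate := (mate G)(h := h, k := k)\<rparr>"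

text \<open>Conjugation of \<open>mate\<close> by \<open>p\<close>, which is an involution in every
  use. As \<open>vert\<close> and \<open>opp\<close> stay put, edge ends move to other places at the
  vertices; the result need not be isomorphic to \<open>G\<close> as a framed graph.\<close>

definition ren :: "(nat \<Rightarrow> nat) \<Rightarrow> fgraph \<Rightarrow> fgraph" where
  "ren p G = G\<lparr>hedges := p ` hedges G, mate := (\<lambda>x. p (mate G (p x)))\<rparr>"

definition drop_vert :: "nat \<Rightarrow> fgraph \<Rightarrow> fgraph" where
  "drop_vert v G = G\<lparr>verts := verts G - {v}\<rparr>"

lemma fgraph_eqI:
  fixes G H :: fgraph
  assumes "verts G = verts H" "hedges G = hedges H" "vert G = vert H" "opp G = opp H"
    "\<And>x. mate G x = mate H x" "circles G = circles H"
  shows "G = H"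
  using assms by (intro fgraph.equality) auto

lemma tidyD:
  assumes "tidy G"
  shows "mate G (mate G h) = h" and "h \<in> hedges G \<longleftrightarrow> mate G h \<noteq> h" and
    "mate G h = mate G k \<longleftrightarrow> h = k"
  using assms unfolding tidy_def by metis+

lemma tidy_swap: "tidy G \<Longrightarrow> mate G h = k \<Longrightarrow> mate G k = h"
  using tidyD(1) by blast

lemma cut_simps [simp]:
  "verts (cut h k G) = verts G" "hedges (cut h k G) = hedges G - {h, k}"
  "vert (cut h k G) = vert G" "opp (cut h k G) = opp G"
  "circles (cut h k G) = circles G + (if mate G h = k then 1 else 0)"
  by (simp_all add: cut_def)

lemma del_simps [simp]:
  "verts (del h k G) = verts G" "hedges (del h k G) = hedges G - {h, k}"
  "vert (del h k G) = vert G" "opp (del h k G) = opp G"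
  "circles (del h k G) = circles G" "mate (del h k G) = (mate G)(h := h, k := k)"
  by (simp_all add: del_def)

lemma ren_simps [simp]:
  "verts (ren p G) = verts G" "hedges (ren p G) = p ` hedges G"
  "vert (ren p G) = vert G" "opp (ren p G) = opp G"
  "circles (ren p G) = circles G" "mate (ren p G) x = p (mate G (p x))"
  by (simp_all add: ren_def)

lemma drop_vert_simps [simp]:
  "verts (drop_vert v G) = verts G - {v}" "hedges (drop_vert v G) = hedges G"
  "vert (drop_vert v G) = vert G" "opp (drop_vert v G) = opp G"
  "circles (drop_vert v G) = circles G" "mate (drop_vert v G) = mate G"
  "cut h k (drop_vert v G) = drop_vert v (cut h k G)"
  by (auto simp: drop_vert_def cut_def cong: if_cong intro!: fgraph.equality)

lemma mate_cut:
  "mate (cut h k G) x = (if x = h \<or> x = k then x else if x = mate G h then mate G k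
     else if x = mate G k then mate G h else mate G x)"
  by (simp add: cut_def)

lemma mate_cut_other:
  assumes "tidy G" "x \<notin> {h, k}" "mate G x \<notin> {h, k}"
  shows "mate (cut h k G) x = mate G x"
  using assms tidyD(1)[OF assms(1)] by (auto simp: mate_cut)

lemma tidy_drop [simp]: "tidy (drop_vert v G) = tidy G"
  by (simp add: tidy_def)

lemma tidy_cut:
  assumes "tidy G" "h \<noteq> k" "h \<in> hedges G" "k \<in> hedges G"
  shows "tidy (cut h k G)"
  using assms unfolding tidy_def mate_cut cut_simps by (smt (verit) Diff_iff empty_iff insert_iff)

lemma tidy_del:
  assumes "tidy G" "mate G h = k"
  shows "tidy (del h k G)"
  using tidyD[OF assms(1)] assms(2) unfolding tidy_def by auto

lemma cut_sym: "tidy G \<Longrightarrow> cut h k G = cut k h G"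
  by (rule fgraph_eqI) (auto simp: mate_cut tidyD)

lemma mate_cut':
  assumes "tidy G"
  shows "mate (cut h k G) x = (if x = h \<or> x = k then x else if mate G x = h then mate G k
     else if mate G x = k then mate G h else mate G x)"
proof -
  have "x = mate G y \<longleftrightarrow> mate G x = y" for y using tidyD(1)[OF assms] by metis
  then show ?thesis unfolding mate_cut by simp
qed

text \<open>Gluings at disjoint places are independent. The delicate case is an edge between the two
  pairs: the first cut redirects it, and a circle made of two such edges is counted by whichever cut
  comes second.\<close>

lemma cut_commute:
  assumes "tidy G" "distinct [h, k, h', k']" "{h, k, h', k'} \<subseteq> hedges G"
  shows "cut h k (cut h' k' G) = cut h' k' (cut h k G)"
proof -
  note t = tidyD(1,3)[OF assms(1)]
  define m where "m = mate G"
  have t: "m (m x) = x" "m x = m y \<longleftrightarrow> x = y" for x y using t by (simp_all add: m_def)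
  have r: "m x = y \<longleftrightarrow> m y = x" for x y using t by metis
  have d: "h \<noteq> k" "h \<noteq> h'" "h \<noteq> k'" "k \<noteq> h'" "k \<noteq> k'" "h' \<noteq> k'"
    "k \<noteq> h" "h' \<noteq> h" "k' \<noteq> h" "h' \<noteq> k" "k' \<noteq> k" "k' \<noteq> h'"
    using assms(2) by auto
  have n: "m h \<noteq> h" "m k \<noteq> k" "m h' \<noteq> h'" "m k' \<noteq> k'"
    using assms(3) tidyD(2)[OF assms(1)] by (auto simp: m_def)
  have td: "tidy (cut h k G)" "tidy (cut h' k' G)"
    using assms by (auto intro!: tidy_cut)
  have s: "m k = h \<longleftrightarrow> m h = k" "m h' = h \<longleftrightarrow> m h = h'" "m k' = h \<longleftrightarrow> m h = k'"
    "m h' = k \<longleftrightarrow> m k = h'" "m k' = k \<longleftrightarrow> m k = k'" "m k' = h' \<longleftrightarrow> m h' = k'"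
    using r by blast+
  show ?thesis
  proof (rule fgraph_eqI)
    fix x
    consider "x \<in> {h, k, h', k'}" | "x = m h" | "x = m k" | "x = m h'" | "x = m k'" 
      | "x \<notin> {h, k, h', k'}" "m x \<noteq> h" "m x \<noteq> k" "m x \<noteq> h'" "m x \<noteq> k'"
      using t by (cases "m x \<in> {h, k, h', k'}") auto
    then show "mate (cut h k (cut h' k' G)) x = mate (cut h' k' (cut h k G)) x"
      by cases (use d n s in \<open>auto simp: mate_cut'[OF td(1)] mate_cut'[OF td(2)] mate_cut'[OF assms(1)] t simp flip: m_def\<close>)
    show "circles (cut h k (cut h' k' G)) = circles (cut h' k' (cut h k G))"
      using d n s by (auto simp: mate_cut'[OF assms(1)] t simp flip: m_def)
  qed auto
qed

lemma cut_ren: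
  assumes "\<And>x. p (p x) = x"
  shows "cut (p h) (p k) (ren p G) = ren p (cut h k G)"
proof -
  have i: "p x = p y \<longleftrightarrow> x = y" for x y using assms by metis
  have j: "x = p y \<longleftrightarrow> p x = y" for x y using assms by metis
  have "p ` hedges G - {p h, p k} = p ` (hedges G - {h, k})"
    by (auto simp: i)
  then show ?thesis
    by (intro fgraph_eqI) (auto simp: mate_cut assms i j)
qed

lemma ren_ident:
  assumes "tidy G" "\<And>x. x \<in> hedges G \<Longrightarrow> p x = x" "\<And>x. p (p x) = x"
  shows "ren p G = G"
proof (rule fgraph_eqI)
  fix x
  show "mate (ren p G) x = mate G x"
  proof (cases "x \<in> hedges G")
    case True
    then have "mate G x \<in> hedges G" using tidyD[OF assms(1)] by metis
    with True assms show ?thesis by simp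
  next
    case False
    then have "p x \<notin> hedges G" using assms(2,3) by metis
    with False have "mate G (p x) = p x" "mate G x = x" using tidyD[OF assms(1)] by metis+
    then show ?thesis using assms by simp
  qed
qed (use assms in auto)

text \<open>Cutting off one end of an edge at \<open>y\<close> slides \<open>y\<close> along that edge to its other end.\<close>

lemma cut_slide:
  assumes "tidy G" "mate G a = a'" "a \<noteq> a'" "y \<in> hedges G" "y \<notin> {a, a'}"
  shows "cut a y G = ren (transpose a' y) (del a a' G)"
proof (rule fgraph_eqI)
  note t = tidyD[OF assms(1)]
  have "mate G a' = a" using tidy_swap assms(1,2) by blast
  moreover have "mate G y \<noteq> y" using t(2) assms(4) by blast
  moreover have "mate G y \<noteq> a" "mate G y \<noteq> a'"
    using tidy_swap[OF assms(1), of y a] tidy_swap[OF assms(1), of y a'] assms(2,5) calculation(1)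
    by auto
  ultimately have e: "mate G y \<noteq> y" "mate G y \<noteq> a" "mate G y \<noteq> a'" "mate G a' = a"
    by auto
  have "a' \<in> hedges G" using t(2) e assms by metis
  then show "hedges (cut a y G) = hedges (ren (transpose a' y) (del a a' G))"
    using assms by (auto simp: transpose_def image_iff)
  show "mate (cut a y G) x = mate (ren (transpose a' y) (del a a' G)) x" for x
    using assms e t(1,3) by (auto simp: mate_cut'[OF assms(1)] transpose_def)
  show "circles (cut a y G) = circles (ren (transpose a' y) (del a a' G))"
    using assms by simp
qed auto

text \<open>The edge from \<open>a\<close> to \<open>c\<close> becomes interior to a chain and
  vanishes. Sliding along it puts \<open>x\<close> in the role of \<open>c\<close>, and the
  relabelling this costs is invisible once both labels are removed.\<close>

lemma cut_chain:
  assumes "tidy G" "mate G a = c" "x \<in> hedges G" "y \<in> hedges G" "distinct [x, a, c, y]"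
  shows "cut x a (cut c y G) = cut x y (del a c G)"
proof -
  let ?p = "transpose c x"
  have td: "tidy (del a c G)" using tidy_del assms by blast
  have mc: "mate G c = a" using assms tidyD by metis
  have "c \<in> hedges G" using assms mc tidyD(2)[of G] by auto
  have "a \<in> hedges G" using assms mc tidyD(2)[of G] by auto
  have "cut x a (cut c y G) = cut c y (cut x a G)"
    using assms \<open>a \<in> _\<close> \<open>c \<in> _\<close> by (intro cut_commute) auto
  also have "cut x a G = cut a x G" using assms(1) by (rule cut_sym)
  also have "\<dots> = ren ?p (del a c G)"
    using assms by (intro cut_slide) auto
  also have "cut c y \<dots> = cut (?p x) (?p y) (ren ?p (del a c G))"
    using assms by (simp add: transpose_def)
  also have "\<dots> = ren ?p (cut x y (del a c G))"
    by (rule cut_ren) simp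
  also have "\<dots> = cut x y (del a c G)"
    using td assms by (intro ren_ident tidy_cut) (auto simp: transpose_def)
  finally show ?thesis .
qed

lemma cut_del:
  assumes "tidy G" "mate G a = c" "distinct [a, c, x, y]"
  shows "cut x y (del a c G) = del a c (cut x y G)"
proof -
  have c: "mate G c = a" using tidy_swap assms by blast
  have td: "tidy (del a c G)" using tidy_del assms by blast
  show ?thesis
    by (rule fgraph_eqI)
      (use assms c tidy_swap[OF assms(1), of _ a] tidy_swap[OF assms(1), of _ c] in
        \<open>auto simp: mate_cut'[OF td] mate_cut'[OF assms(1)] simp del: mate_cut\<close>)
qed

section \<open>Smoothing and removing a vertex\<close>

definition regular :: "fgraph \<Rightarrow> bool" where
  "regular G \<longleftrightarrow> framed4 G \<and> tidy G"

lemma regularD: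
  assumes "regular G"
  shows "tidy G" "framed4 G" "finite (verts G)"
    and "h \<in> hedges G \<Longrightarrow> vert G h \<in> verts G"
    and "h \<in> hedges G \<Longrightarrow> opp G h \<in> hedges G"
    and "h \<in> hedges G \<Longrightarrow> opp G h \<noteq> h"
    and "h \<in> hedges G \<Longrightarrow> opp G (opp G h) = h"
    and "h \<in> hedges G \<Longrightarrow> vert G (opp G h) = vert G h"
    and "h \<in> hedges G \<Longrightarrow> mate G h \<in> hedges G"
    and "h \<in> hedges G \<Longrightarrow> mate G h \<noteq> h"
  using assms unfolding regular_def framed4_def by auto

text \<open>Coordinates at \<open>v\<close>: its four half-edges are \<open>a\<close>,
  \<open>b\<close> and their opposites. The constructions at a vertex are written in such
  coordinates and later shown not to depend on the choice.\<close>

definition frame :: "fgraph \<Rightarrow> nat \<Rightarrow> nat \<Rightarrow> nat \<Rightarrow> bool" where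
  "frame G v a b \<longleftrightarrow> a \<in> hedges G \<and> b \<in> hedges G \<and> vert G a = v \<and> vert G b = v \<and>
     a \<noteq> b \<and> b \<noteq> opp G a"

lemma frame_sym:
  assumes "regular G" "frame G v a b"
  shows "frame G v b a" "frame G v a (opp G b)" "frame G v (opp G a) b"
    "frame G v (opp G a) (opp G b)"
  using assms regularD[OF assms(1)] unfolding frame_def by metis+

lemma frame_distinct:
  assumes "regular G" "frame G v a b"
  shows "distinct [a, b, opp G a, opp G b]" "{a, b, opp G a, opp G b} \<subseteq> hedges G"
    "opp G (opp G a) = a" "opp G (opp G b) = b"
    "vert G a = v" "vert G b = v" "vert G (opp G a) = v" "vert G (opp G b) = v" "v \<in> verts G"
proof -
  have h: "a \<in> hedges G" "b \<in> hedges G" "vert G a = v" "vert G b = v" "a \<noteq> b" "b \<noteq> opp G a"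
    using assms(2) unfolding frame_def by auto
  note r = regularD(4-8)[OF assms(1)]
  note o = r(2-5)[OF h(1)] r(2-5)[OF h(2)]
  have "a \<noteq> opp G b" "opp G a \<noteq> opp G b" using h(5,6) o(3,7) by metis+
  with h o show "distinct [a, b, opp G a, opp G b]" "{a, b, opp G a, opp G b} \<subseteq> hedges G"
    "opp G (opp G a) = a" "opp G (opp G b) = b"
    "vert G a = v" "vert G b = v" "vert G (opp G a) = v" "vert G (opp G b) = v" "v \<in> verts G"
    using r(1)[OF h(1)] by auto
qed

lemma frame_hedges:
  assumes "regular G" "frame G v a b"
  shows "{h \<in> hedges G. vert G h = v} = {a, b, opp G a, opp G b}"
proof -
  note d = frame_distinct[OF assms]
  have "card {h \<in> hedges G. vert G h = v} = 4"
    using d(9) regularD(2)[OF assms(1)] by (auto simp: framed4_def)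
  moreover have "card {a, b, opp G a, opp G b} = 4" using d(1) by simp
  moreover have "{a, b, opp G a, opp G b} \<subseteq> {h \<in> hedges G. vert G h = v}" using d by auto
  ultimately show ?thesis
    by (metis card_subset_eq card.infinite zero_neq_numeral)
qed

lemma frame_exists:
  assumes "regular G" "v \<in> verts G"
  shows "\<exists>a b. frame G v a b"
proof -
  let ?H = "{h \<in> hedges G. vert G h = v}"
  have c: "card ?H = 4" using assms regularD(2)[OF assms(1)] by (auto simp: framed4_def)
  then obtain a where a: "a \<in> ?H" by (metis card.empty equals0I zero_neq_numeral)
  have "card {a, opp G a} \<le> 2" by (simp add: card_insert_if)
  then have "\<not> ?H \<subseteq> {a, opp G a}" using c card_mono[of "{a, opp G a}" ?H] by auto
  then obtain b where "b \<in> ?H" "b \<noteq> a" "b \<noteq> opp G a" by auto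
  with a show ?thesis unfolding frame_def by blast
qed

definition res :: "nat \<Rightarrow> nat \<Rightarrow> nat \<Rightarrow> nat \<Rightarrow> nat \<Rightarrow> fgraph \<Rightarrow> fgraph" where
  "res v a b c d G = drop_vert v (cut a b (cut c d G))"

lemma res_simps [simp]:
  "verts (res v a b c d G) = verts G - {v}"
  "hedges (res v a b c d G) = hedges G - {a, b, c, d}"
  "vert (res v a b c d G) = vert G" "opp (res v a b c d G) = opp G"
  "circles G \<le> circles (res v a b c d G)"
  by (auto simp: res_def)

lemma tidy_res:
  assumes "tidy G" "distinct [a, b, c, d]" "{a, b, c, d} \<subseteq> hedges G"
  shows "tidy (res v a b c d G)"
  using assms by (auto simp: res_def intro!: tidy_cut)

text \<open>The two gluings together use up all half-edges at \<open>v\<close>, so dropping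
  \<open>v\<close> restores the 4-valence that a single one breaks.\<close>

lemma regular_res:
  assumes "regular G" "distinct [a, b, c, d]"
    "{h \<in> hedges G. vert G h = v} = {a, b, c, d}"
  shows "regular (res v a b c d G)"
proof -
  let ?R = "res v a b c d G"
  have t: "tidy ?R" using assms regularD(1) by (intro tidy_res) auto
  have f: "framed4 G" by (rule regularD(2)[OF assms(1)])
  have h: "h \<in> hedges ?R \<longleftrightarrow> h \<in> hedges G \<and> vert G h \<noteq> v" for h
    using assms(3) by auto
  have c: "card {h \<in> hedges ?R. vert ?R h = w} = 4" if "w \<in> verts ?R" for w
  proof -
    have "{h \<in> hedges ?R. vert ?R h = w} = {h \<in> hedges G. vert G h = w}"
      using that h by auto
    then show ?thesis using that f unfolding framed4_def by auto
  qed
  have m: "mate ?R h \<in> hedges ?R \<and> mate ?R h \<noteq> h \<and> mate ?R (mate ?R h) = h"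
    if "h \<in> hedges ?R" for h
    using that tidyD(1,2)[OF t] by metis
  have o: "opp G h \<in> hedges ?R" "vert G h \<in> verts ?R" if "h \<in> hedges ?R" for h
    using that f unfolding h framed4_def by auto
  have "framed4 ?R"
    unfolding framed4_def
  proof (intro conjI)
    show "finite (verts ?R)" using f by (simp add: framed4_def)
    show "\<forall>x\<in>hedges ?R. vert ?R x \<in> verts ?R" using o by simp
    show "\<forall>w\<in>verts ?R. card {h \<in> hedges ?R. vert ?R h = w} = 4" using c by blast
    show "\<forall>x\<in>hedges ?R. opp ?R x \<in> hedges ?R \<and> opp ?R x \<noteq> x \<and> opp ?R (opp ?R x) = x \<and>
        vert ?R (opp ?R x) = vert ?R x"
    proof
      fix x assume x: "x \<in> hedges ?R"
      then have "x \<in> hedges G" by simp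
      then show "opp ?R x \<in> hedges ?R \<and> opp ?R x \<noteq> x \<and> opp ?R (opp ?R x) = x \<and>
          vert ?R (opp ?R x) = vert ?R x"
        using o(1)[OF x] regularD(6-8)[OF assms(1)] by simp
    qed
  qed (use m in blast)
  with t show ?thesis by (simp add: regular_def)
qed

lemma res_sym:
  assumes "tidy G" "distinct [a, b, c, d]" "{a, b, c, d} \<subseteq> hedges G"
  shows "res v a b c d G = res v c d a b G" "res v a b c d G = res v b a c d G"
    "res v a b c d G = res v a b d c G"
  using assms cut_commute[of G a b c d] cut_sym[of G c d] cut_sym[of "cut c d G" a b]
  by (auto simp: res_def tidy_cut)

lemma drop_vert_commute: "drop_vert v (drop_vert w G) = drop_vert w (drop_vert v G)"
  by (intro fgraph_eqI) auto

lemma res_commute: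
  assumes "tidy G" "distinct [a, b, c, d, x, y, z, w]" "{a, b, c, d, x, y, z, w} \<subseteq> hedges G"
  shows "res u a b c d (res v x y z w G) = res v x y z w (res u a b c d G)"
proof -
  let ?W = "cut z w G"
  have t: "tidy ?W" "tidy (cut c d G)" "tidy (cut x y ?W)" using assms by (auto intro!: tidy_cut)
  have "cut a b (cut c d (cut x y ?W)) = cut a b (cut x y (cut c d ?W))"
    using assms t by (subst cut_commute[of ?W c d]) auto
  also have "\<dots> = cut a b (cut x y (cut z w (cut c d G)))"
    using assms t by (subst cut_commute[of G c d]) auto
  also have "\<dots> = cut x y (cut a b (cut z w (cut c d G)))"
    using assms t by (subst cut_commute[of "cut z w (cut c d G)"]) (auto intro!: tidy_cut)
  also have "\<dots> = cut x y (cut z w (cut a b (cut c d G)))"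
    using assms t by (subst cut_commute[of "cut c d G" a b]) (auto intro!: tidy_cut)
  finally show ?thesis unfolding res_def by (simp add: drop_vert_commute)
qed

definition smooth :: "nat \<Rightarrow> nat \<Rightarrow> fgraph \<Rightarrow> fgraph" where
  "smooth a b G = res (vert G a) a b (opp G a) (opp G b) G"

text \<open>Gluing along the framing forgets a crossing and keeps both strands through it. At a loop
  this is the first move, at both vertices of a bigon the second; at an arbitrary vertex it is only
  an auxiliary operation.\<close>

definition unvert :: "nat \<Rightarrow> nat \<Rightarrow> fgraph \<Rightarrow> fgraph" where
  "unvert a b G = res (vert G a) a (opp G a) b (opp G b) G"

lemma smooth_simps [simp]:
  "verts (smooth a b G) = verts G - {vert G a}"
  "hedges (smooth a b G) = hedges G - {a, b, opp G a, opp G b}"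
  "vert (smooth a b G) = vert G" "opp (smooth a b G) = opp G"
  "circles G \<le> circles (smooth a b G)"
  by (auto simp: smooth_def)

lemma unvert_simps [simp]:
  "verts (unvert a b G) = verts G - {vert G a}"
  "hedges (unvert a b G) = hedges G - {a, b, opp G a, opp G b}"
  "vert (unvert a b G) = vert G" "opp (unvert a b G) = opp G"
  "circles G \<le> circles (unvert a b G)"
  by (auto simp: unvert_def)

lemma regular_smooth:
  assumes "regular G" "frame G v a b"
  shows "regular (smooth a b G)"
  using frame_distinct[OF assms] frame_hedges[OF assms]
  unfolding smooth_def by (intro regular_res assms(1)) auto

lemma regular_unvert:
  assumes "regular G" "frame G v a b"
  shows "regular (unvert a b G)"
  using frame_distinct[OF assms] frame_hedges[OF assms]
  unfolding unvert_def by (intro regular_res assms(1)) auto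

lemma smooth_sym:
  assumes "regular G" "frame G v a b"
  shows "smooth b a G = smooth a b G" "smooth (opp G a) (opp G b) G = smooth a b G"
  using frame_distinct[OF assms] regularD(1)[OF assms(1)]
    res_sym(1)[of G a b "opp G a" "opp G b" v] res_sym(2)[of G a b "opp G a" "opp G b" v]
    res_sym(3)[of G b a "opp G a" "opp G b" v]
  by (auto simp: smooth_def)

lemma frame_cases:
  assumes "regular G" "frame G v a b" "frame G v c d"
  shows "c \<in> {a, opp G a} \<and> d \<in> {b, opp G b} \<or> c \<in> {b, opp G b} \<and> d \<in> {a, opp G a}"
proof -
  have "c \<in> {a, b, opp G a, opp G b}" "d \<in> {a, b, opp G a, opp G b}" "d \<noteq> c" "d \<noteq> opp G c"
    using frame_hedges[OF assms(1,2)] assms(3) unfolding frame_def by auto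
  then show ?thesis using frame_distinct(3,4)[OF assms(1,2)] by auto
qed

text \<open>A change of frame exchanges \<open>a\<close> with \<open>b\<close> or passes to
  opposites, which either preserves or exchanges the two smoothings. Only the unordered pair is
  intrinsic.\<close>

lemma smooth_pair_unique:
  assumes "regular G" "frame G v a b" "frame G v c d"
  shows "smooth c d G = smooth a b G \<and> smooth c (opp G d) G = smooth a (opp G b) G \<or>
    smooth c d G = smooth a (opp G b) G \<and> smooth c (opp G d) G = smooth a b G"
proof -
  note f = frame_sym[OF assms(1,2)]
  note s = smooth_sym[OF assms(1,2)] smooth_sym[OF assms(1) f(1)] smooth_sym[OF assms(1) f(2)]
    smooth_sym[OF assms(1) f(3)] smooth_sym[OF assms(1) f(4)]
  show ?thesis
    using frame_cases[OF assms] s frame_distinct(3,4)[OF assms(1,2)] by auto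
qed

lemma unvert_unique:
  assumes "regular G" "frame G v a b" "frame G v c d"
  shows "unvert c d G = unvert a b G"
proof -
  let ?A = "opp G a" and ?B = "opp G b"
  note d = frame_distinct[OF assms(1,2)]
  note r = res_sym[OF regularD(1)[OF assms(1)]]
  have 1: "res v a ?A b ?B G = res v b ?B a ?A G"
    "res v a ?A b ?B G = res v ?A a b ?B G" 
    "res v a ?A b ?B G = res v a ?A ?B b G"
    "res v b ?B a ?A G = res v ?B b a ?A G" 
    "res v b ?B a ?A G = res v b ?B ?A a G"
    "res v ?A a b ?B G = res v ?A a ?B b G" 
    "res v ?B b a ?A G = res v ?B b ?A a G" 
    using d by (intro r; auto)+
  show ?thesis
    using frame_cases[OF assms] 1 d frame_distinct(5)[OF assms(1,3)] unfolding unvert_def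
    by auto
qed

lemma smooth_smooth:
  assumes "regular G" "frame G u a b" "frame G v c d" "u \<noteq> v"
  shows "smooth a b (smooth c d G) = smooth c d (smooth a b G)"
    and "unvert a b (smooth c d G) = smooth c d (unvert a b G)"
    and "unvert a b (unvert c d G) = unvert c d (unvert a b G)"
proof -
  note d1 = frame_distinct[OF assms(1,2)] and d2 = frame_distinct[OF assms(1,3)]
  have disj: "{a, b, opp G a, opp G b} \<inter> {c, d, opp G c, opp G d} = {}"
    using d1(5-8) d2(5-8) assms(4) by auto
  have dist: "distinct ([a, b, opp G a, opp G b] @ [c, d, opp G c, opp G d])"
    unfolding distinct_append using d1(1) d2(1) disj by simp
  have sub: "set ([a, b, opp G a, opp G b] @ [c, d, opp G c, opp G d]) \<subseteq> hedges G"
    using d1(2) d2(2) by simp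
  note r = res_commute[OF regularD(1)[OF assms(1)]]
  show "smooth a b (smooth c d G) = smooth c d (smooth a b G)"
    unfolding smooth_def res_simps by (rule r) (use dist sub in auto)
  show "unvert a b (smooth c d G) = smooth c d (unvert a b G)"
    unfolding smooth_def unvert_def res_simps by (rule r) (use dist sub in auto)
  show "unvert a b (unvert c d G) = unvert c d (unvert a b G)"
    unfolding unvert_def res_simps by (rule r) (use dist sub in auto)
qed

lemma frame_smooth:
  assumes "regular G" "frame G v c d" "frame G u a b" "u \<noteq> v"
  shows "frame (smooth c d G) u a b" "frame (unvert c d G) u a b"
proof -
  have "x \<notin> {c, d, opp G c, opp G d}" if "vert G x = u" for x
    using that frame_distinct(5-8)[OF assms(1,2)] assms(4) by auto
  then have "a \<notin> {c, d, opp G c, opp G d}" "b \<notin> {c, d, opp G c, opp G d}"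
    using assms(3) unfolding frame_def by blast+
  then show "frame (smooth c d G) u a b" "frame (unvert c d G) u a b"
    using assms(3) unfolding frame_def by simp_all
qed

lemma mate_res_other:
  assumes "tidy G" "distinct [a, b, c, d]" "{a, b, c, d} \<subseteq> hedges G"
    "x \<notin> {a, b, c, d}" "mate G x \<notin> {a, b, c, d}"
  shows "mate (res v a b c d G) x = mate G x"
proof -
  have "mate (cut c d G) x = mate G x" using assms by (intro mate_cut_other) auto
  moreover have "mate (cut a b (cut c d G)) x = mate (cut c d G) x"
    using assms calculation by (intro mate_cut_other tidy_cut) auto
  ultimately show ?thesis by (simp add: res_def)
qed

lemma mate_smooth_other:
  assumes "regular G" "frame G v a b" "x \<in> hedges G" "vert G x \<noteq> v" "vert G (mate G x) \<noteq> v"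
  shows "mate (smooth a b G) x = mate G x" "mate (unvert a b G) x = mate G x"
proof -
  have "x \<notin> {a, b, opp G a, opp G b}" "mate G x \<notin> {a, b, opp G a, opp G b}"
    using frame_distinct(5-8)[OF assms(1,2)] assms(4,5) by auto
  then show "mate (smooth a b G) x = mate G x" "mate (unvert a b G) x = mate G x"
    unfolding smooth_def unvert_def
    using frame_distinct(1,2)[OF assms(1,2)] regularD(1)[OF assms(1)]
    by (intro mate_res_other; auto)+
qed

section \<open>Bigons and isomorphisms\<close>

text \<open>A bigon is addressed by its two half-edges at one of its vertices, so it has four
  addresses, related by flipping to the other vertex and by swapping the edges.\<close>

definition bigon_at :: "fgraph \<Rightarrow> nat \<Rightarrow> nat \<Rightarrow> bool" where
  "bigon_at G a b \<longleftrightarrow> frame G (vert G a) a b \<and>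
     frame G (vert G (mate G a)) (mate G a) (mate G b) \<and> vert G (mate G a) \<noteq> vert G a"

definition unbigon :: "nat \<Rightarrow> nat \<Rightarrow> fgraph \<Rightarrow> fgraph" where
  "unbigon a b G = unvert (mate G a) (mate G b) (unvert a b G)"

lemma bigon_atD:
  assumes "bigon_at G a b"
  shows "frame G (vert G a) a b" "frame G (vert G (mate G a)) (mate G a) (mate G b)"
    "vert G (mate G a) \<noteq> vert G a" "vert G b = vert G a" "vert G (mate G b) = vert G (mate G a)"
    "a \<in> hedges G" "b \<in> hedges G" "mate G a \<in> hedges G" "mate G b \<in> hedges G"
  using assms unfolding bigon_at_def frame_def by auto

lemma unbigon_simps [simp]:
  "verts (unbigon a b G) = verts G - {vert G a, vert G (mate G a)}"
  "vert (unbigon a b G) = vert G" "opp (unbigon a b G) = opp G"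
  by (auto simp: unbigon_def)

lemma circles_unbigon: "circles G \<le> circles (unbigon a b G)"
  unfolding unbigon_def by (meson order_trans unvert_simps(5))

lemma frame_unvert_bigon:
  assumes "regular G" "bigon_at G a b"
  shows "frame (unvert a b G) (vert G (mate G a)) (mate G a) (mate G b)"
  using frame_smooth(2)[OF assms(1) bigon_atD(1)[OF assms(2)] bigon_atD(2)[OF assms(2)]]
    bigon_atD(3)[OF assms(2)] by blast

lemma regular_unbigon:
  assumes "regular G" "bigon_at G a b"
  shows "regular (unbigon a b G)"
  unfolding unbigon_def
  using regular_unvert frame_unvert_bigon[OF assms] assms(1) bigon_atD(1)[OF assms(2)] by blast

lemma bigon_at_flip:
  assumes "regular G" "bigon_at G a b"
  shows "bigon_at G (mate G a) (mate G b)" "unbigon (mate G a) (mate G b) G = unbigon a b G"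
proof -
  note b = bigon_atD[OF assms(2)] and m = tidyD(1)[OF regularD(1)[OF assms(1)]]
  show "bigon_at G (mate G a) (mate G b)"
    using assms(2) unfolding bigon_at_def m by auto
  show "unbigon (mate G a) (mate G b) G = unbigon a b G"
    unfolding unbigon_def m using smooth_smooth(3)[OF assms(1) b(1,2)] b(3) by simp
qed

lemma bigon_at_swap:
  assumes "regular G" "bigon_at G a b"
  shows "bigon_at G b a" "unbigon b a G = unbigon a b G"
proof -
  note b = bigon_atD[OF assms(2)]
  show "bigon_at G b a"
    using frame_sym(1)[OF assms(1) b(1)] frame_sym(1)[OF assms(1) b(2)] b
    unfolding bigon_at_def by simp
  have "unvert b a G = unvert a b G"
    using unvert_unique[OF assms(1) b(1) frame_sym(1)[OF assms(1) b(1)]] .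
  moreover have "unvert (mate G b) (mate G a) (unvert a b G) = unvert (mate G a) (mate G b) (unvert a b G)"
    using unvert_unique frame_unvert_bigon[OF assms] regular_unvert[OF assms(1) b(1)] frame_sym(1)
    by blast
  ultimately show "unbigon b a G = unbigon a b G" unfolding unbigon_def by simp
qed

text \<open>The bigon edges do not touch \<open>w\<close>, so they survive any change at
  \<open>w\<close>, and the gluings at the three vertices use disjoint half-edges.\<close>

lemma bigon_at_smooth:
  assumes "regular G" "bigon_at G a b" "frame G w x y" "w \<noteq> vert G a" "w \<noteq> vert G (mate G a)"
  shows "bigon_at (smooth x y G) a b" "unbigon a b (smooth x y G) = smooth x y (unbigon a b G)"
    "bigon_at (unvert x y G) a b" "unbigon a b (unvert x y G) = unvert x y (unbigon a b G)"
    "frame (unbigon a b G) w x y"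
proof -
  note b = bigon_atD[OF assms(2)]
  have m: "mate (smooth x y G) a = mate G a" "mate (smooth x y G) b = mate G b"
    "mate (unvert x y G) a = mate G a" "mate (unvert x y G) b = mate G b"
    using mate_smooth_other[OF assms(1,3)] assms(4,5) b by metis+
  show "bigon_at (smooth x y G) a b" "bigon_at (unvert x y G) a b"
    using frame_smooth[OF assms(1,3) b(1)] frame_smooth[OF assms(1,3) b(2)] assms(4,5) b(3)
    unfolding bigon_at_def m by simp_all
  have r: "regular (unvert a b G)" using regular_unvert assms(1) b(1) by blast
  have f: "frame (unvert a b G) w x y"
    using frame_smooth(2)[OF assms(1) b(1) assms(3)] assms(4) by blast
  note c = frame_unvert_bigon[OF assms(1,2)]
  show "unbigon a b (smooth x y G) = smooth x y (unbigon a b G)"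
    unfolding unbigon_def m using smooth_smooth(2)[OF assms(1) b(1) assms(3)]
      smooth_smooth(2)[OF r c f] assms(4,5) by metis
  show "unbigon a b (unvert x y G) = unvert x y (unbigon a b G)"
    unfolding unbigon_def m using smooth_smooth(3)[OF assms(1) b(1) assms(3)]
      smooth_smooth(3)[OF r c f] assms(4,5) by metis
  show "frame (unbigon a b G) w x y"
    unfolding unbigon_def using frame_smooth(2)[OF r c f] assms(5) by blast
qed

lemma bigon_at_disjoint:
  assumes "regular G" "bigon_at G a b" "bigon_at G c d"
    "{vert G a, vert G (mate G a)} \<inter> {vert G c, vert G (mate G c)} = {}"
  shows "bigon_at (unbigon c d G) a b" "unbigon a b (unbigon c d G) = unbigon c d (unbigon a b G)"
proof -
  note b = bigon_atD[OF assms(2)] and c = bigon_atD[OF assms(3)]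
  have r: "regular (unvert c d G)" using regular_unvert assms(1) c(1) by blast
  note f = frame_unvert_bigon[OF assms(1,3)]
  have n: "vert G c \<noteq> vert G a" "vert G c \<noteq> vert G (mate G a)"
    "vert G (mate G c) \<noteq> vert G a" "vert G (mate G c) \<noteq> vert G (mate G a)"
    using assms(4) by auto
  note b1 = bigon_at_smooth(3,4)[OF assms(1,2) c(1) n(1,2)]
  have m: "mate (unvert c d G) a = mate G a"
    using mate_smooth_other(2)[OF assms(1) c(1) b(6)] n by metis
  note b2 = bigon_at_smooth(3,4)[OF r b1(1) f]
  show "bigon_at (unbigon c d G) a b"
    unfolding unbigon_def using b2(1) m n by simp
  note fc = bigon_at_smooth(5)[OF assms(1,2) c(1) n(1,2)]
  have m': "mate (unbigon a b G) c = mate G c" "mate (unbigon a b G) d = mate G d"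
  proof -
    have r': "regular (unvert a b G)" using regular_unvert assms(1) b(1) by blast
    have k: "x \<in> hedges (unvert a b G)" if "x \<in> hedges G" "vert G x \<noteq> vert G a" for x
      using that frame_hedges[OF assms(1) b(1)] by auto
    have "mate (unvert a b G) c = mate G c" "mate (unvert a b G) d = mate G d"
      using mate_smooth_other(2)[OF assms(1) b(1)] c n by metis+
    then show "mate (unbigon a b G) c = mate G c" "mate (unbigon a b G) d = mate G d"
      using mate_smooth_other(2)[OF r' frame_unvert_bigon[OF assms(1,2)], of c]
        mate_smooth_other(2)[OF r' frame_unvert_bigon[OF assms(1,2)], of d] c n k
      by (simp_all add: unbigon_def)
  qed
  show "unbigon a b (unbigon c d G) = unbigon c d (unbigon a b G)"
    using b1(2) b2(2) m m' n by (simp add: unbigon_def)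
qed

text \<open>Isomorphism of edges and circles alone. Single renamings are of this kind but need not
  respect the framing; it is checked only for a composite of several renamings.\<close>

definition mate_iso :: "(nat \<Rightarrow> nat) \<Rightarrow> fgraph \<Rightarrow> fgraph \<Rightarrow> bool" where
  "mate_iso \<psi> G G' \<longleftrightarrow> bij_betw \<psi> (hedges G) (hedges G') \<and>
     (\<forall>h\<in>hedges G. mate G h \<in> hedges G \<and> mate G' (\<psi> h) = \<psi> (mate G h)) \<and> circles G' = circles G"

lemma mate_iso_trans:
  assumes "mate_iso \<psi> G G'" "mate_iso \<chi> G' G''"
  shows "mate_iso (\<chi> \<circ> \<psi>) G G''"
  using assms bij_betw_trans unfolding mate_iso_def by (auto dest: bij_betwE)

lemma mate_iso_ren:
  assumes "tidy G" "\<And>x. p (p x) = x"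
  shows "mate_iso p G (ren p G)" "mate_iso p (ren p G) G"
proof -
  have "bij_betw p A (p ` A)" "bij_betw p (p ` A) A" for A
    using assms(2) by (auto intro!: bij_betw_byWitness[where f' = p] simp: image_image)
  then show "mate_iso p G (ren p G)" "mate_iso p (ren p G) G"
    using tidyD[OF assms(1)] assms(2) unfolding mate_iso_def by auto
qed

section \<open>Isomorphisms acting on cuts, smoothings and bigon removals\<close>

lemma isomorphism_cut:
  assumes "isomorphism \<phi> \<psi> G G'" "tidy G" "tidy G'" "h \<in> hedges G" "k \<in> hedges G"
  shows "isomorphism \<phi> \<psi> (cut h k G) (cut (\<psi> h) (\<psi> k) G')"
proof -
  have b: "bij_betw \<psi> (hedges G) (hedges G')" and m: "\<And>x. x \<in> hedges G \<Longrightarrow> mate G' (\<psi> x) = \<psi> (mate G x)"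
    using assms(1) unfolding isomorphism_def by auto
  have i: "\<psi> x = \<psi> y \<longleftrightarrow> x = y" if "x \<in> hedges G" "y \<in> hedges G" for x y
    using b that unfolding bij_betw_def inj_on_def by blast
  have mh: "mate G x \<in> hedges G" if "x \<in> hedges G" for x
    using that tidyD[OF assms(2)] by metis
  have "bij_betw \<psi> (hedges G - {h, k}) (hedges G' - {\<psi> h, \<psi> k})"
    using b assms(4,5) by (auto simp: bij_betw_def inj_on_def)
  moreover have "mate (cut (\<psi> h) (\<psi> k) G') (\<psi> x) = \<psi> (mate (cut h k G) x)"
    if "x \<in> hedges G - {h, k}" for x
    using that assms(4,5) by (simp add: mate_cut i m mh)
  moreover have "circles (cut (\<psi> h) (\<psi> k) G') = circles (cut h k G)"
    using assms(1,4,5) by (simp add: m i mh isomorphism_def)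
  ultimately show ?thesis
    using assms(1) unfolding isomorphism_def by simp
qed

lemma isomorphism_drop_vert:
  assumes "isomorphism \<phi> \<psi> G G'" "v \<in> verts G"
  shows "isomorphism \<phi> \<psi> (drop_vert v G) (drop_vert (\<phi> v) G')"
  using assms unfolding isomorphism_def by (auto simp: bij_betw_def inj_on_def)

lemma isomorphism_res:
  assumes "isomorphism \<phi> \<psi> G G'" "tidy G" "tidy G'" "v \<in> verts G"
    "distinct [a, b, c, d]" "{a, b, c, d} \<subseteq> hedges G"
  shows "isomorphism \<phi> \<psi> (res v a b c d G) (res (\<phi> v) (\<psi> a) (\<psi> b) (\<psi> c) (\<psi> d) G')"
proof -
  have "inj_on \<psi> (hedges G)" "\<psi> ` hedges G = hedges G'"
    using assms(1) unfolding isomorphism_def bij_betw_def by auto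
  then have "\<psi> c \<in> hedges G'" "\<psi> d \<in> hedges G'" "\<psi> c \<noteq> \<psi> d"
    using assms(5,6) unfolding inj_on_def by auto
  then show ?thesis unfolding res_def using assms
    by (intro isomorphism_drop_vert isomorphism_cut tidy_cut) auto
qed

lemma isomorphism_frame:
  assumes "isomorphism \<phi> \<psi> G G'" "regular G" "frame G v a b" "regular G'"
  shows "frame G' (\<phi> v) (\<psi> a) (\<psi> b)"
    "isomorphism \<phi> \<psi> (smooth a b G) (smooth (\<psi> a) (\<psi> b) G')"
    "isomorphism \<phi> \<psi> (unvert a b G) (unvert (\<psi> a) (\<psi> b) G')"
proof -
  have b: "bij_betw \<psi> (hedges G) (hedges G')" and
    m: "\<And>x. x \<in> hedges G \<Longrightarrow> vert G' (\<psi> x) = \<phi> (vert G x) \<and> opp G' (\<psi> x) = \<psi> (opp G x)"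
    using assms(1) unfolding isomorphism_def by auto
  note d = frame_distinct[OF assms(2,3)]
  have i: "\<psi> x = \<psi> y \<longleftrightarrow> x = y" if "x \<in> hedges G" "y \<in> hedges G" for x y
    using b that unfolding bij_betw_def inj_on_def by blast
  show "frame G' (\<phi> v) (\<psi> a) (\<psi> b)"
    using d b m unfolding frame_def by (auto simp: i dest: bij_betwE)
  have "isomorphism \<phi> \<psi> (res v a b (opp G a) (opp G b) G)
      (res (\<phi> v) (\<psi> a) (\<psi> b) (\<psi> (opp G a)) (\<psi> (opp G b)) G')"
    using d assms(1) regularD(1)[OF assms(2)] regularD(1)[OF assms(4)] by (intro isomorphism_res) auto
  then show "isomorphism \<phi> \<psi> (smooth a b G) (smooth (\<psi> a) (\<psi> b) G')"
    using d m unfolding smooth_def by simp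
  have "isomorphism \<phi> \<psi> (res v a (opp G a) b (opp G b) G)
      (res (\<phi> v) (\<psi> a) (\<psi> (opp G a)) (\<psi> b) (\<psi> (opp G b)) G')"
    using d assms(1) regularD(1)[OF assms(2)] regularD(1)[OF assms(4)] by (intro isomorphism_res) auto
  then show "isomorphism \<phi> \<psi> (unvert a b G) (unvert (\<psi> a) (\<psi> b) G')"
    using d m unfolding unvert_def by simp
qed

lemma isomorphism_mate:
  "isomorphism \<phi> \<psi> G G' \<Longrightarrow> h \<in> hedges G \<Longrightarrow> mate G' (\<psi> h) = \<psi> (mate G h)"
  "isomorphism \<phi> \<psi> G G' \<Longrightarrow> h \<in> hedges G \<Longrightarrow> vert G' (\<psi> h) = \<phi> (vert G h)"
  unfolding isomorphism_def by auto

lemma isomorphism_bigon_at: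
  assumes "isomorphism \<phi> \<psi> G G'" "regular G" "regular G'" "bigon_at G a b"
  shows "bigon_at G' (\<psi> a) (\<psi> b)"
    "isomorphism \<phi> \<psi> (unbigon a b G) (unbigon (\<psi> a) (\<psi> b) G')"
proof -
  note b = bigon_atD[OF assms(4)]
  note f1 = isomorphism_frame[OF assms(1,2) b(1) assms(3)]
  note f2 = isomorphism_frame[OF assms(1,2) b(2) assms(3)]
  have "vert G a \<in> verts G" "vert G (mate G a) \<in> verts G"
    using regularD(4)[OF assms(2)] b(6,8) by auto
  moreover have "inj_on \<phi> (verts G)"
    using assms(1) unfolding isomorphism_def bij_betw_def by blast
  ultimately have "\<phi> (vert G (mate G a)) \<noteq> \<phi> (vert G a)"
    using b(3) by (auto dest: inj_onD)
  then show "bigon_at G' (\<psi> a) (\<psi> b)"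
    using f1(1) f2(1) isomorphism_mate[OF assms(1)] b unfolding bigon_at_def by simp
  have "isomorphism \<phi> \<psi> (unvert (mate G a) (mate G b) (unvert a b G))
      (unvert (\<psi> (mate G a)) (\<psi> (mate G b)) (unvert (\<psi> a) (\<psi> b) G'))"
    using isomorphism_frame(3)[OF f1(3) regular_unvert[OF assms(2) b(1)]
        frame_unvert_bigon[OF assms(2,4)] regular_unvert[OF assms(3) f1(1)]] .
  then show "isomorphism \<phi> \<psi> (unbigon a b G) (unbigon (\<psi> a) (\<psi> b) G')"
    using isomorphism_mate(1)[OF assms(1)] b unfolding unbigon_def by simp
qed

lemma isomorphism_trans:
  assumes "isomorphism \<phi> \<psi> G G'" "isomorphism \<phi>' \<psi>' G' G''"
  shows "isomorphism (\<phi>' \<circ> \<phi>) (\<psi>' \<circ> \<psi>) G G''"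
  using assms bij_betw_trans unfolding isomorphism_def by (auto dest: bij_betwE)

lemma isomorphism_sym:
  assumes "isomorphism \<phi> \<psi> G G'" "framed4 G"
  shows "\<exists>\<phi>' \<psi>'. isomorphism \<phi>' \<psi>' G' G"
proof -
  let ?p = "inv_into (verts G) \<phi>" and ?q = "inv_into (hedges G) \<psi>"
  have v: "bij_betw \<phi> (verts G) (verts G')" and b: "bij_betw \<psi> (hedges G) (hedges G')"
    and m: "\<And>x. x \<in> hedges G \<Longrightarrow> vert G' (\<psi> x) = \<phi> (vert G x) \<and>
      opp G' (\<psi> x) = \<psi> (opp G x) \<and> mate G' (\<psi> x) = \<psi> (mate G x)"
    using assms(1) unfolding isomorphism_def by auto
  have "vert G (?q h) = ?p (vert G' h) \<and> opp G (?q h) = ?q (opp G' h) \<and> mate G (?q h) = ?q (mate G' h)"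
    if "h \<in> hedges G'" for h
  proof -
    have "h \<in> \<psi> ` hedges G" using that bij_betw_imp_surj_on[OF b] by simp
    then obtain x where x: "x \<in> hedges G" "h = \<psi> x" by auto
    have "vert G x \<in> verts G" "opp G x \<in> hedges G" "mate G x \<in> hedges G"
      using assms(2) x(1) unfolding framed4_def by auto
    then show ?thesis
      using x m[OF x(1)] v b by (simp add: bij_betw_inv_into_left)
  qed
  then have "isomorphism ?p ?q G' G"
    using assms(1) v b unfolding isomorphism_def by (auto intro: bij_betw_inv_into)
  then show ?thesis by blast
qed

section \<open>Second-move reductions are confluent\<close>

lemma tidy_ren:
  assumes "tidy G" "\<And>x. p (p x) = x"
  shows "tidy (ren p G)"
proof -
  have "x \<in> p ` hedges G \<longleftrightarrow> p x \<in> hedges G" for x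
    using assms(2) by (metis image_iff)
  moreover have "p y = x \<longleftrightarrow> y = p x" for x y using assms(2) by metis
  ultimately have "x \<in> p ` hedges G \<longleftrightarrow> p (mate G (p x)) \<noteq> x" for x
    using tidyD(2)[OF assms(1)] by simp
  then show ?thesis
    using tidyD(1)[OF assms(1)] assms(2) unfolding tidy_def by simp
qed

lemma isomorphismI:
  assumes "mate_iso \<psi> G G'" "bij_betw \<phi> (verts G) (verts G')"
    "\<And>h. h \<in> hedges G \<Longrightarrow> vert G' (\<psi> h) = \<phi> (vert G h)"
    "\<And>h. h \<in> hedges G \<Longrightarrow> opp G' (\<psi> h) = \<psi> (opp G h)"
  shows "isomorphism \<phi> \<psi> G G'"
  using assms unfolding isomorphism_def mate_iso_def by auto

lemma mate_iso_drop_vert [simp]: "mate_iso \<psi> (drop_vert v G) (drop_vert w G') = mate_iso \<psi> G G'"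
  by (simp add: mate_iso_def)

lemma cut_slide_twice:
  assumes "tidy H" "mate H a = e" "mate H b = f" "distinct [a, b, x, y, e, f]"
    "{a, b, x, y} \<subseteq> hedges H"
  shows "cut a x (cut b y H) = ren (transpose f y) (ren (transpose e x) (del a e (del b f H)))"
proof -
  let ?p = "transpose f y" and ?X = "del b f H"
  have X: "tidy ?X" "mate ?X a = e" "x \<in> hedges ?X"
    using assms tidy_del[OF assms(1,3)] by auto
  have "cut b y H = ren ?p ?X" using assms by (intro cut_slide) auto
  then have "cut a x (cut b y H) = cut (?p a) (?p x) (ren ?p ?X)"
    using assms by (simp add: transpose_def)
  also have "\<dots> = ren ?p (cut a x ?X)" by (rule cut_ren) simp
  also have "cut a x ?X = ren (transpose e x) (del a e ?X)"
    using assms X by (intro cut_slide) auto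
  finally show ?thesis .
qed

lemma bij_betw_transpose_remove:
  assumes "u \<in> V" "w \<in> V"
  shows "bij_betw (transpose u w) (V - {u}) (V - {w})"
  using assms by (intro bij_betw_byWitness[where f' = "transpose u w"]) (auto simp: transpose_def)

text \<open>For two vertices joined by two edges it does not matter which one is removed. Both
  results come from the graph without these edges, where either \<open>e\<close>, \<open>f\<close>
  take the places of \<open>opp H a\<close>, \<open>opp H b\<close>, or \<open>a\<close>,
  \<open>b\<close> those of \<open>opp H e\<close>, \<open>opp H f\<close>. The remaining crossing
  is matched by sending \<open>e\<close> to \<open>opp H a\<close> and \<open>opp H e\<close> to
  \<open>a\<close>, likewise for \<open>f\<close> and \<open>b\<close>.\<close>

lemma unvert_slide:
  assumes "regular H" "frame H u a b" "frame H w e f" "u \<noteq> w" "mate H a = e" "mate H b = f"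
  shows "\<exists>\<phi> \<psi>. isomorphism \<phi> \<psi> (unvert a b H) (unvert e f H)"
proof -
  let ?A = "opp H a" and ?B = "opp H b" and ?E = "opp H e" and ?F = "opp H f"
  let ?p = "transpose f ?B" and ?q = "transpose e ?A" and ?p' = "transpose b ?F" and ?q' = "transpose a ?E"
  let ?K = "del a e (del b f H)"
  note t = regularD(1)[OF assms(1)]
  note d1 = frame_distinct[OF assms(1,2)] and d2 = frame_distinct[OF assms(1,3)]
  have disj: "{a, b, ?A, ?B} \<inter> {e, f, ?E, ?F} = {}"
    using d1(5-8) d2(5-8) assms(4) by auto
  have dist: "distinct ([a, b, ?A, ?B] @ [e, f, ?E, ?F])"
    unfolding distinct_append using d1(1) d2(1) disj by simp
  have sub: "set ([a, b, ?A, ?B] @ [e, f, ?E, ?F]) \<subseteq> hedges H"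
    using d1(2) d2(2) by simp
  have m: "mate H e = a" "mate H f = b" using tidy_swap[OF t] assms(5,6) by auto
  have K: "tidy ?K" using dist by (intro tidy_del t) (auto simp: assms)
  have K': "del e a (del f b H) = ?K" using dist by (intro fgraph_eqI) auto
  have 1: "cut a ?A (cut b ?B H) = ren ?p (ren ?q ?K)"
    using dist sub by (intro cut_slide_twice t assms) auto
  have 2: "cut e ?E (cut f ?F H) = ren ?p' (ren ?q' ?K)"
    unfolding K'[symmetric] using dist sub by (intro cut_slide_twice t m) auto
  define \<psi> where "\<psi> = ?p' \<circ> (?q' \<circ> (?q \<circ> ?p))"
  have "mate_iso (?q \<circ> ?p) (ren ?p (ren ?q ?K)) ?K"
    by (rule mate_iso_trans[OF mate_iso_ren(2) mate_iso_ren(2)]) (simp_all add: K tidy_ren)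
  then have "mate_iso (?q' \<circ> (?q \<circ> ?p)) (ren ?p (ren ?q ?K)) (ren ?q' ?K)"
    by (rule mate_iso_trans[OF _ mate_iso_ren(1)]) (simp_all add: K)
  then have "mate_iso \<psi> (ren ?p (ren ?q ?K)) (ren ?p' (ren ?q' ?K))"
    unfolding \<psi>_def by (rule mate_iso_trans[OF _ mate_iso_ren(1)]) (simp_all add: K tidy_ren)
  then have mi: "mate_iso \<psi> (unvert a b H) (unvert e f H)"
    by (simp add: unvert_def res_def 1 2)
  have ps: "\<psi> e = ?A" "\<psi> ?E = a" "\<psi> f = ?B" "\<psi> ?F = b"
    using dist by (auto simp: \<psi>_def transpose_def)
  have po: "\<psi> h = h" if "h \<notin> {a, b, ?A, ?B}" "h \<notin> {e, f, ?E, ?F}" for h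
    using that by (auto simp: \<psi>_def transpose_def)
  have "vert H (\<psi> h) = transpose u w (vert H h) \<and> opp H (\<psi> h) = \<psi> (opp H h)"
    if h: "h \<in> hedges H" "h \<notin> {a, b, ?A, ?B}" for h
  proof (cases "h \<in> {e, f, ?E, ?F}")
    case True
    then show ?thesis using d1 d2 ps by (auto simp: transpose_def)
  next
    case False
    have hd: "{x \<in> hedges H. vert H x = u} = {a, b, ?A, ?B}" "{x \<in> hedges H. vert H x = w} = {e, f, ?E, ?F}"
      using frame_hedges assms(1-3) by blast+
    then have v: "vert H h \<noteq> u" "vert H h \<noteq> w" using h False by auto
    have "opp H h \<in> hedges H" "vert H (opp H h) = vert H h"
      using regularD(5,8)[OF assms(1) h(1)] by auto
    then have "opp H h \<notin> {a, b, ?A, ?B}" "opp H h \<notin> {e, f, ?E, ?F}"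
      using v unfolding hd[symmetric] by simp_all
    then show ?thesis using po[OF h(2) False] po v by (simp add: transpose_def)
  qed
  moreover have "bij_betw (transpose u w) (verts (unvert a b H)) (verts (unvert e f H))"
    using d1 d2 by (simp add: bij_betw_transpose_remove)
  ultimately have "isomorphism (transpose u w) \<psi> (unvert a b H) (unvert e f H)"
    using mi by (intro isomorphismI) auto
  then show ?thesis by blast
qed

text \<open>The edges of the two bigons are distinct, so at the shared vertex they must be opposite
  to each other: the three vertices lie in a row along two strands. Removing the middle one first
  leaves a bigon between the outer two, and then either of these may go.\<close>

lemma bigon_at_shared:
  assumes "regular G" "bigon_at G a b" "bigon_at G a' b'"
    "vert G (mate G a) = vert G (mate G a')" "vert G a \<noteq> vert G a'"
  shows "\<exists>\<phi> \<psi>. isomorphism \<phi> \<psi> (unbigon a b G) (unbigon a' b' G)"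
proof -
  have main: "\<exists>\<phi> \<psi>. isomorphism \<phi> \<psi> (unbigon a b G) (unbigon x y G)"
    if xy: "bigon_at G x y" "vert G (mate G a) = vert G (mate G x)" "vert G a \<noteq> vert G x"
      "mate G x = opp G (mate G a)" "mate G y = opp G (mate G b)" for x y
  proof -
    let ?c = "mate G a" and ?d = "mate G b"
    let ?H = "unvert ?c ?d G"
    note t = regularD(1)[OF assms(1)]
    note b = bigon_atD[OF assms(2)] and x = bigon_atD[OF xy(1)]
    note d = frame_distinct[OF assms(1) b(2)]
    have H: "regular ?H" using regular_unvert[OF assms(1) b(2)] .
    have f: "frame ?H (vert G a) a b" "frame ?H (vert G x) x y"
      using frame_smooth(2)[OF assms(1) b(2)] b(1,3) x(1,3) xy(2) by metis+
    have u: "unbigon a b G = unvert a b ?H"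
      unfolding unbigon_def using smooth_smooth(3)[OF assms(1) b(2) b(1)] b(3) by blast
    have x2: "frame G (vert G ?c) (mate G x) (mate G y)" using x(2) xy(2) by simp
    have "unvert (mate G x) (mate G y) G = ?H"
      using unvert_unique[OF assms(1) b(2) x2] .
    then have w: "unbigon x y G = unvert x y ?H"
      unfolding unbigon_def using smooth_smooth(3)[OF assms(1) x(2) x(1)] x(3) by metis
    have mo: "mate G (opp G ?c) = x" "mate G (opp G ?d) = y"
      using xy(4,5) tidyD(1)[OF t] by metis+
    let ?H1 = "cut ?d (opp G ?d) G"
    have t1: "tidy ?H1" using d t by (intro tidy_cut) auto
    have va: "a \<notin> {?c, ?d, opp G ?c, opp G ?d}" "b \<notin> {?c, ?d, opp G ?c, opp G ?d}"
      "x \<notin> {?c, ?d, opp G ?c, opp G ?d}" "y \<notin> {?c, ?d, opp G ?c, opp G ?d}"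
      using d(5-8) b(3,4) x(3,4) xy(2) by auto
    have mm: "mate G ?c = a" "mate G ?d = b" using tidyD(1)[OF t] by auto
    have 1: "mate ?H1 z = (if z = ?d \<or> z = opp G ?d then z else if z = b then y
        else if z = y then b else mate G z)" for z
      unfolding mate_cut mm mo ..
    have dy: "?c \<noteq> ?d" "?c \<noteq> opp G ?d" "opp G ?c \<noteq> opp G ?d" "opp G ?c \<noteq> ?d" using d(1) by auto
    have 2: "mate ?H1 ?c = a" "mate ?H1 (opp G ?c) = x" "mate ?H1 b = y"
      using va dy mm mo by (auto simp: 1)
    have ab: "a \<noteq> b" "b \<noteq> x" using b(1,4) xy(3) unfolding frame_def by auto
    have "mate ?H z = (if z = ?c \<or> z = opp G ?c then z else if z = a then x
        else if z = x then a else mate ?H1 z)" for z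
      unfolding unvert_def res_def drop_vert_simps mate_cut[of ?c] 2 ..
    \<comment> \<open>With the shared vertex gone, the two strands run directly from
      \<open>a\<close> to \<open>x\<close> and from \<open>b\<close> to \<open>y\<close>.\<close>
    then have "mate ?H a = x" "mate ?H b = y"
      using va 2(3) ab by auto
    then show ?thesis
      unfolding u w using unvert_slide[OF H f] xy(3) by blast
  qed
  note b = bigon_atD[OF assms(2)] and b' = bigon_atD[OF assms(3)]
  note i = tidyD(3)[OF regularD(1)[OF assms(1)]]
  have f: "frame G (vert G (mate G a)) (mate G a') (mate G b')" using b'(2) assms(4) by simp
  have ne: "a \<noteq> a'" "a \<noteq> b'" "b \<noteq> a'" "b \<noteq> b'" using assms(5) b(4) b'(4) by auto
  consider "mate G a' = opp G (mate G a)" "mate G b' = opp G (mate G b)"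
    | "mate G b' = opp G (mate G a)" "mate G a' = opp G (mate G b)"
    using frame_cases[OF assms(1) b(2) f] ne i by auto
  then show ?thesis
  proof cases
    case 1
    then show ?thesis using main[OF assms(3-5)] by blast
  next
    case 2
    note s = bigon_at_swap[OF assms(1,3)]
    show ?thesis using main[OF s(1) _ _ 2] assms(4,5) b'(4,5) s(2) by auto
  qed
qed

text \<open>Isomorphism enters only at the end of a reduction: bigon removals transport along
  isomorphisms, so none is needed in between.\<close>

inductive reduces_to :: "fgraph \<Rightarrow> fgraph \<Rightarrow> bool" for K where
  isomorphic: "regular G \<Longrightarrow> isomorphism \<phi> \<psi> G K \<Longrightarrow> reduces_to K G"
| unbigon: "regular G \<Longrightarrow> bigon_at G a b \<Longrightarrow> reduces_to K (unbigon a b G) \<Longrightarrow> reduces_to K G"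

lemma reduces_to_isomorphic:
  assumes "reduces_to K G" "regular G'" "isomorphism \<phi> \<psi> G G'"
  shows "reduces_to K G'"
  using assms
proof (induction arbitrary: G' \<phi> \<psi> rule: reduces_to.induct)
  case (isomorphic G \<phi>1 \<psi>1)
  from isomorphism_sym[OF isomorphic(4) regularD(2)[OF isomorphic(1)]]
  obtain \<phi>2 \<psi>2 where "isomorphism \<phi>2 \<psi>2 G' G" by blast
  then show ?case
    using isomorphism_trans isomorphic(2,3) reduces_to.isomorphic by blast
next
  case (unbigon G a b)
  note i = isomorphism_bigon_at[OF unbigon.prems(2) unbigon.hyps(1) unbigon.prems(1) unbigon.hyps(2)]
  show ?case
    using reduces_to.unbigon[OF unbigon.prems(1) i(1)] unbigon.IH[OF _ i(2)]
      regular_unbigon[OF unbigon.prems(1) i(1)] by blast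
qed

lemma card_unbigon:
  assumes "regular G" "bigon_at G a b"
  shows "card (verts (unbigon a b G)) < card (verts G)"
proof -
  have "vert G a \<in> verts G" using regularD(4)[OF assms(1)] bigon_atD[OF assms(2)] by blast
  then show ?thesis using regularD(3)[OF assms(1)] by (auto intro!: psubset_card_mono)
qed

text \<open>Newman's argument: two bigons either are disjoint, or removing the one or the other gives
  isomorphic graphs.\<close>

lemma reduces_to_unbigon:
  assumes K: "regular K" "\<And>x y. \<not> bigon_at K x y"
  assumes "reduces_to K G" "bigon_at G a b"
  shows "reduces_to K (unbigon a b G)"
  using assms(3,4)
proof (induction "card (verts G)" arbitrary: G a b rule: less_induct)
  case less
  have regular: "regular G" using less.prems(1) by (cases) auto
  note r1 = regular_unbigon[OF regular less.prems(2)]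
  from less.prems(1) show ?case
  proof cases
    case (isomorphic \<phi> \<psi>)
    then show ?thesis using isomorphism_bigon_at(1)[OF isomorphic(2) _ K(1) less.prems(2)] K(2) by blast
  next
    case (unbigon c d)
    \<comment> \<open>Bigons with a common vertex, which by flipping may be taken as the far end of
      both. If the near vertices coincide as well, both removals delete the same two vertices and
      agree, since removing a vertex does not depend on the frame.\<close>
    have shared: "reduces_to K (unbigon x y G)"
      if "bigon_at G x y" "bigon_at G z w" "reduces_to K (unbigon z w G)"
        "vert G (mate G z) = vert G (mate G x)" for x y z w
    proof (cases "vert G x = vert G z")
      case True
      note x = bigon_atD[OF that(1)] and z = bigon_atD[OF that(2)]
      have "unvert x y G = unvert z w G"
        using unvert_unique[OF regular z(1)] x(1) True by metis
      moreover have "unvert (mate G x) (mate G y) (unvert x y G)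
          = unvert (mate G z) (mate G w) (unvert x y G)"
        using unvert_unique[OF regular_unvert[OF regular x(1)]]
          frame_unvert_bigon[OF regular that(1)] frame_unvert_bigon[OF regular that(2)]
          calculation that(4) by metis
      ultimately show ?thesis using that(3) by (simp add: unbigon_def)
    next
      case False
      then show ?thesis
        using bigon_at_shared[OF regular that(2,1,4)] that(3) reduces_to_isomorphic
          regular_unbigon[OF regular that(1)] by metis
    qed
    note f1 = bigon_at_flip[OF regular less.prems(2)]
    note f2 = bigon_at_flip[OF regular unbigon(2)]
    note m = tidyD(1)[OF regularD(1)[OF regular]]
    consider "vert G (mate G c) = vert G (mate G a)" | "vert G (mate G c) = vert G a"
      | "vert G c = vert G (mate G a)" | "vert G c = vert G a"
      | "vert G (mate G c) \<noteq> vert G (mate G a)" "vert G (mate G c) \<noteq> vert G a"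
        "vert G c \<noteq> vert G (mate G a)" "vert G c \<noteq> vert G a"
      by blast
    then show ?thesis
    proof cases
      case 1
      then show ?thesis using shared less.prems(2) unbigon(2,3) by blast
    next
      case 2
      then show ?thesis using shared[OF f1(1) unbigon(2,3)] f1(2) m by simp
    next
      case 3
      then show ?thesis using shared[OF less.prems(2) f2(1)] f2(2) unbigon(3) m by simp
    next
      case 4
      then show ?thesis using shared[OF f1(1) f2(1)] f1(2) f2(2) unbigon(3) m by simp
    next
      case 5
      then have dj: "{vert G c, vert G (mate G c)} \<inter> {vert G a, vert G (mate G a)} = {}" by auto
      note c = bigon_at_disjoint[OF regular unbigon(2) less.prems(2) dj]
      have "bigon_at (unbigon c d G) a b"
        using bigon_at_disjoint(1)[OF regular less.prems(2) unbigon(2)] dj by blast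
      then have "reduces_to K (unbigon a b (unbigon c d G))"
        using less.hyps[OF card_unbigon[OF regular unbigon(2)] unbigon(3)] by blast
      then show ?thesis using reduces_to.unbigon[OF r1 c(1)] c(2) by simp
    qed
  qed
qed

lemma reduces_to_unbigon_iff:
  assumes "regular K" "\<And>x y. \<not> bigon_at K x y" "regular G" "bigon_at G a b"
  shows "reduces_to K (unbigon a b G) \<longleftrightarrow> reduces_to K G"
  using reduces_to_unbigon[OF assms(1,2) _ assms(4)] reduces_to.unbigon[OF assms(3,4)] by blast

text \<open>A removal deletes vertices and can only create circles, so both bounds propagate
  backwards along a reduction. The second one excludes every graph with a circle when
  \<open>K\<close> has none.\<close>

lemma reduces_toD:
  assumes "reduces_to K G"
  shows "card (verts K) \<le> card (verts G)" "circles G \<le> circles K"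
  using assms
proof (induction rule: reduces_to.induct)
  case (isomorphic G \<phi> \<psi>)
  then have "card (verts G) = card (verts K)" "circles K = circles G"
    unfolding isomorphism_def by (auto dest: bij_betw_same_card)
  then show "card (verts K) \<le> card (verts G)" "circles G \<le> circles K" by auto
next
  case (unbigon G a b)
  then show "card (verts K) \<le> card (verts G)" "circles G \<le> circles K"
    using card_unbigon[OF unbigon.hyps(1,2)] circles_unbigon[of G a b] by auto
qed

section \<open>The bracket\<close>

definition cuts :: "(nat \<times> nat) list \<Rightarrow> fgraph \<Rightarrow> fgraph" where
  "cuts ps G = foldr (\<lambda>(x, y). cut x y) ps G"

definition ends :: "(nat \<times> nat) list \<Rightarrow> nat list" where
  "ends ps = concat (map (\<lambda>(x, y). [x, y]) ps)"

lemma cuts_simps [simp]: "cuts [] G = G" "cuts ((x, y) # ps) G = cut x y (cuts ps G)"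
  by (simp_all add: cuts_def)

lemma ends_simps [simp]: "ends [] = []" "ends ((x, y) # ps) = x # y # ends ps"
  "ends (ps @ qs) = ends ps @ ends qs"
  by (simp_all add: ends_def)

lemma tidy_cuts:
  assumes "tidy G" "distinct (ends ps)" "set (ends ps) \<subseteq> hedges G"
  shows "tidy (cuts ps G)" "hedges (cuts ps G) = hedges G - set (ends ps)"
  using assms by (induction ps) (auto intro!: tidy_cut)

lemma cuts_move_front:
  assumes "tidy G" "distinct (ends (ps @ (x, y) # qs))" "set (ends (ps @ (x, y) # qs)) \<subseteq> hedges G"
  shows "cuts (ps @ (x, y) # qs) G = cut x y (cuts (ps @ qs) G)"
  using assms(2,3)
proof (induction ps)
  case Nil
  then show ?case by simp
next
  case (Cons p ps)
  obtain z w where p: "p = (z, w)" by (cases p)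
  have t: "tidy (cuts (ps @ qs) G)" "hedges (cuts (ps @ qs) G) = hedges G - set (ends (ps @ qs))"
    using tidy_cuts[OF assms(1), of "ps @ qs"] Cons.prems p by auto
  have "cuts ((p # ps) @ (x, y) # qs) G = cut z w (cut x y (cuts (ps @ qs) G))"
    using Cons p by simp
  also have "\<dots> = cut x y (cut z w (cuts (ps @ qs) G))"
    using t Cons.prems p by (intro cut_commute) auto
  finally show ?case using p by simp
qed

text \<open>Gluings commute and are symmetric, so only the multiset of unordered pairs counts. This
  is the normal form behind the local identities: bring the pairs of a chain together, contract the
  chain, rearrange again.\<close>

lemma cuts_cong:
  assumes "tidy G" "distinct (ends ps)" "distinct (ends qs)"
    "set (ends ps) \<subseteq> hedges G" "set (ends qs) \<subseteq> hedges G"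
    "image_mset (\<lambda>(x, y). {x, y}) (mset ps) = image_mset (\<lambda>(x, y). {x, y}) (mset qs)"
  shows "cuts ps G = cuts qs G"
  using assms(2-6)
proof (induction ps arbitrary: qs)
  case Nil
  then show ?case by simp
next
  case (Cons p ps)
  obtain x y where p: "p = (x, y)" by (cases p)
  have "{x, y} \<in># image_mset (\<lambda>(x, y). {x, y}) (mset qs)"
    by (subst Cons.prems(5)[symmetric]) (simp add: p)
  then obtain z w where q: "(z, w) \<in> set qs" "{x, y} = {z, w}"
    unfolding set_image_mset set_mset_mset by (elim imageE) (metis case_prod_conv surj_pair)
  obtain us vs where qs: "qs = us @ (z, w) # vs" using split_list[OF q(1)] by blast
  have IH: "cuts ps G = cuts (us @ vs) G"
    using Cons.prems q(2) by (intro Cons.IH) (auto simp: qs p)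
  have t: "tidy (cuts ps G)" using tidy_cuts[OF assms(1), of ps] Cons.prems p by auto
  have "cuts qs G = cut z w (cuts ps G)"
    unfolding qs IH using Cons.prems by (intro cuts_move_front assms(1)) (auto simp: qs)
  also have "\<dots> = cut x y (cuts ps G)"
    using q(2) cut_sym[OF t] by (auto simp: doubleton_eq_iff)
  finally show ?case by (simp add: p)
qed

lemma cuts_chain:
  assumes "tidy G" "mate G a = c" "distinct [x, a, c, y]" "{x, a, c, y} \<subseteq> hedges G"
  shows "cuts [(x, a), (c, y)] G = cuts [(x, y)] (del a c G)"
  using assms cut_chain[of G a c x y] by simp

lemma cuts_chain2:
  assumes "tidy G" "mate G a = c" "mate G b = d" "distinct [x, a, c, b, d, y]"
    "{x, a, c, b, d, y} \<subseteq> hedges G"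
  shows "cuts [(x, a), (c, b), (d, y)] G = cuts [(x, y)] (del a c (del b d G))"
proof -
  have "cut c b (cut d y G) = cut c y (del b d G)" using assms by (intro cut_chain) auto
  moreover have "cut x a (cut c y (del b d G)) = cut x y (del a c (del b d G))"
    using assms by (intro cut_chain tidy_del) auto
  ultimately show ?thesis by simp
qed

lemma smooth_cuts:
  "smooth a b G = drop_vert (vert G a) (cuts [(a, b), (opp G a, opp G b)] G)"
  "unvert a b G = drop_vert (vert G a) (cuts [(a, opp G a), (b, opp G b)] G)"
  by (simp_all add: smooth_def unvert_def res_def)

lemma circles_cuts: "circles G \<le> circles (cuts ps G)"
  by (induction ps) auto

lemma del_commute: "distinct [a, c, b, d] \<Longrightarrow> del a c (del b d G) = del b d (del a c G)"
  by (intro fgraph_eqI) auto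

lemma del_sym: "del a c G = del c a G"
  by (intro fgraph_eqI) auto

lemma mate_cuts_edge:
  assumes "tidy G" "mate G a = c" "distinct ([a, c] @ ends ps)" "set (ends ps) \<subseteq> hedges G"
  shows "mate (cuts ps G) a = c"
  using assms(3,4)
proof (induction ps)
  case (Cons p ps)
  obtain x y where p: "p = (x, y)" by (cases p)
  have "tidy (cuts ps G)" using tidy_cuts[OF assms(1), of ps] Cons.prems p by auto
  moreover have "mate (cuts ps G) a = c" using Cons p by auto
  ultimately show ?case using Cons.prems p by (auto simp: mate_cut')
qed (use assms in auto)

lemma cuts_del:
  assumes "tidy G" "mate G a = c" "distinct ([a, c] @ ends ps)" "set (ends ps) \<subseteq> hedges G"
  shows "cuts ps (del a c G) = del a c (cuts ps G)"
  using assms(3,4)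
proof (induction ps)
  case (Cons p ps)
  obtain x y where p: "p = (x, y)" by (cases p)
  have t: "tidy (cuts ps G)" using tidy_cuts[OF assms(1), of ps] Cons.prems p by auto
  have "mate (cuts ps G) a = c" using mate_cuts_edge[OF assms(1,2)] Cons.prems p by auto
  then have "cut x y (del a c (cuts ps G)) = del a c (cut x y (cuts ps G))"
    using t Cons.prems p by (intro cut_del) auto
  then show ?case using Cons p by simp
qed simp

lemma cuts_chains:
  assumes "tidy G" "mate G a = c" "mate G b = d" "distinct [x, a, c, y, z, b, d, w]"
    "{x, a, c, y, z, b, d, w} \<subseteq> hedges G"
  shows "cuts [(x, a), (c, y), (z, b), (d, w)] G = cuts [(x, y), (z, w)] (del a c (del b d G))"
proof -
  have t: "tidy (del b d G)" using assms by (intro tidy_del) auto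
  let ?H = "cuts [(z, w)] (del b d G)"
  have H: "tidy ?H" "hedges ?H = hedges G - {b, d, z, w}"
    using tidy_cuts[OF t, of "[(z, w)]"] assms by auto
  have "mate ?H a = c" using t assms by (intro mate_cuts_edge) auto
  then have "cuts [(x, a), (c, y)] ?H = cuts [(x, y)] (del a c ?H)"
    using H assms by (intro cuts_chain) auto
  also have "del a c ?H = cuts [(z, w)] (del a c (del b d G))"
    using t assms by (intro cuts_del[symmetric]) auto
  finally show ?thesis using cuts_chain[OF assms(1,3), of z w] assms by auto
qed

text \<open>Compare how the outer half-edges \<open>?A\<close>, \<open>?B\<close> at one vertex and
  \<open>?C\<close>, \<open>?D\<close> at the other get connected. Gluing the bigon edges to each
  other at both vertices closes the boundary of the bigon to a circle. Either mixed state joins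
  \<open>?A\<close> to \<open>?B\<close> and \<open>?C\<close> to \<open>?D\<close>, the bigon edges
  lying inside one of these connections. The last state joins \<open>?A\<close> to \<open>?C\<close>
  and \<open>?B\<close> to \<open>?D\<close>, as the second move does.\<close>

lemma smooth_bigon:
  assumes "regular G" "bigon_at G a b"
  defines "c \<equiv> mate G a" and "d \<equiv> mate G b"
  shows "0 < circles (smooth c d (smooth a b G))"
    "smooth c d (smooth a (opp G b) G) = smooth c (opp G d) (smooth a b G)"
    "smooth c (opp G d) (smooth a (opp G b) G) = unbigon a b G"
proof -
  let ?A = "opp G a" and ?B = "opp G b" and ?C = "opp G c" and ?D = "opp G d"
  note b = bigon_atD[OF assms(2)]
  note t = regularD(1)[OF assms(1)]
  note d1 = frame_distinct[OF assms(1) b(1)]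
  note d2 = frame_distinct[OF assms(1) b(2), folded c_def d_def]
  have disj: "{a, b, ?A, ?B} \<inter> {c, d, ?C, ?D} = {}"
    using d1(5-8) d2(5-8) b(3) by (auto simp: c_def)
  have dist: "distinct ([a, b, ?A, ?B] @ [c, d, ?C, ?D])"
    unfolding distinct_append using d1(1) d2(1) disj by simp
  have sub: "set ([a, b, ?A, ?B] @ [c, d, ?C, ?D]) \<subseteq> hedges G"
    using d1(2) d2(2) by simp
  have m: "mate G a = c" "mate G b = d" "mate G c = a" "mate G d = b"
    using tidyD(1)[OF t] by (simp_all add: c_def d_def)
  have o: "opp G ?B = b" "opp G ?D = d" using d1 d2 by simp_all
  let ?V = "\<lambda>H. drop_vert (vert G c) (drop_vert (vert G a) H)"
  have "smooth c d (smooth a b G) = ?V (cuts [(c, d), (?C, ?D), (a, b), (?A, ?B)] G)"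
    by (simp add: smooth_cuts)
  also have "cuts [(c, d), (?C, ?D), (a, b), (?A, ?B)] G = cuts [(?C, ?D), (?A, ?B), (b, a), (c, d)] G"
    using dist sub by (intro cuts_cong t) (auto simp: insert_commute add_mset_commute)
  \<comment> \<open>Once the edge from \<open>a\<close> to \<open>c\<close> is contracted, the glued
    half-edges \<open>b\<close> and \<open>d\<close> are the two ends of the other bigon edge; this
    closes the circle.\<close>
  also have "\<dots> = cuts [(?C, ?D), (?A, ?B)] (cut b d (del a c G))"
    using cuts_chain[OF t m(1), of b d] dist sub by auto
  finally have "circles (cut b d (del a c G)) \<le> circles (smooth c d (smooth a b G))"
    using circles_cuts[of _ "[(?C, ?D), (?A, ?B)]"] by simp
  moreover have "mate (del a c G) b = d" using dist m by auto
  ultimately show "0 < circles (smooth c d (smooth a b G))" by simp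
  have "cuts [(c, d), (?C, ?D), (a, ?B), (?A, b)] G = cuts [(?C, ?D), (?B, a), (c, d), (b, ?A)] G"
    using dist sub by (intro cuts_cong t) (auto simp: insert_commute add_mset_commute)
  also have "\<dots> = cuts [(?C, ?D)] (cuts [(?B, a), (c, d), (b, ?A)] G)" by simp
  also have "\<dots> = cuts [(?C, ?D), (?B, ?A)] (del a c (del d b G))"
    using dist sub by (subst cuts_chain2[OF t m(1) m(4)]) auto
  also have "\<dots> = cuts [(?A, ?B), (?C, ?D)] (del a c (del d b G))"
    using dist sub m by (intro cuts_cong tidy_del t) (auto simp: insert_commute add_mset_commute)
  also have "del a c (del d b G) = del d b (del a c G)" using dist by (intro del_commute) auto
  also have "cuts [(?A, ?B), (?C, ?D)] (del d b (del a c G))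
      = cuts [(?A, ?B)] (cuts [(?C, d), (b, a), (c, ?D)] G)"
    using dist sub by (subst cuts_chain2[OF t m(4) m(1)]) auto
  also have "\<dots> = cuts [(?A, ?B), (?C, d), (b, a), (c, ?D)] G" by simp
  also have "\<dots> = cuts [(c, ?D), (?C, d), (a, b), (?A, ?B)] G"
    using dist sub by (intro cuts_cong t) (auto simp: insert_commute add_mset_commute)
  finally show "smooth c d (smooth a ?B G) = smooth c ?D (smooth a b G)"
    by (simp add: smooth_cuts o)
  \<comment> \<open>Here \<open>?B\<close> reaches \<open>?D\<close> along the edge from
    \<open>a\<close> to \<open>c\<close>, in the second move along the edge from \<open>b\<close> to
    \<open>d\<close>; for \<open>?A\<close> and \<open>?C\<close> it is the other way round. After
    contraction the difference disappears.\<close>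
  have "cuts [(c, ?D), (?C, d), (a, ?B), (?A, b)] G = cuts [(?B, a), (c, ?D), (?A, b), (d, ?C)] G"
    using dist sub by (intro cuts_cong t) (auto simp: insert_commute add_mset_commute)
  also have "\<dots> = cuts [(?B, ?D), (?A, ?C)] (del a c (del b d G))"
    using dist sub by (intro cuts_chains t m) auto
  also have "\<dots> = cuts [(?A, ?C), (?B, ?D)] (del a c (del b d G))"
    using dist sub m by (intro cuts_cong tidy_del t) (auto simp: insert_commute add_mset_commute)
  also have "\<dots> = cuts [(?A, a), (c, ?C), (?B, b), (d, ?D)] G"
    using dist sub by (intro cuts_chains[symmetric] t m) auto
  also have "\<dots> = cuts [(c, ?C), (d, ?D), (a, ?A), (b, ?B)] G"
    using dist sub by (intro cuts_cong t) (auto simp: insert_commute add_mset_commute)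
  finally show "smooth c ?D (smooth a ?B G) = unbigon a b G"
    unfolding unbigon_def c_def[symmetric] d_def[symmetric] by (simp add: smooth_cuts o)
qed

text \<open>Gluing the ends of the loop to each other gives a circle. In the other smoothing, as in
  the removal of the vertex, the loop lies between \<open>?A\<close> and \<open>?B\<close>; only its
  direction differs, and it contracts to the same gluing.\<close>

lemma smooth_loop:
  assumes "regular G" "frame G v a b" "mate G a = b"
  shows "0 < circles (smooth a b G)" "smooth a (opp G b) G = unvert a b G"
proof -
  let ?A = "opp G a" and ?B = "opp G b"
  note t = regularD(1)[OF assms(1)]
  note d = frame_distinct[OF assms(1,2)]
  have "smooth a b G = drop_vert (vert G a) (cuts [(?A, ?B), (a, b)] G)"
    unfolding smooth_cuts using d by (intro arg_cong[of _ _ "drop_vert _"] cuts_cong t) auto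
  moreover have "circles (cut a b G) \<le> circles (cuts [(?A, ?B), (a, b)] G)" by simp
  ultimately show "0 < circles (smooth a b G)" using assms(3) by simp
  have "cuts [(a, ?B), (?A, b)] G = cuts [(?B, a), (b, ?A)] G"
    using d by (intro cuts_cong t) (auto simp: insert_commute)
  also have "\<dots> = cuts [(?B, ?A)] (del a b G)" using d by (intro cuts_chain t assms) auto
  also have "\<dots> = cuts [(?A, ?B)] (del a b G)"
    using d by (intro cuts_cong tidy_del t assms) (auto simp: insert_commute)
  also have "\<dots> = cuts [(?A, a), (b, ?B)] G" using d by (intro cuts_chain[symmetric] t assms) auto
  also have "\<dots> = cuts [(a, ?A), (b, ?B)] G"
    using d by (intro cuts_cong t) (auto simp: insert_commute)
  finally show "smooth a ?B G = unvert a b G" using d by (simp add: smooth_cuts)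
qed

text \<open>Counting modulo 2 is exclusive disjunction, written as \<open>\<noteq>\<close> on booleans.\<close>

primrec bracket :: "fgraph \<Rightarrow> nat list \<Rightarrow> fgraph \<Rightarrow> bool" where
  "bracket K [] G = reduces_to K G"
| "bracket K (v # L) G = (let (a, b) = SOME (a, b). frame G v a b in
     bracket K L (smooth a b G) \<noteq> bracket K L (smooth a (opp G b) G))"

declare bracket.simps(2) [simp del]

text \<open>The arbitrary frame in the recursion is harmless: any other frame yields the same two
  smoothings, possibly exchanged, and exclusive disjunction is symmetric.\<close>

lemma bracket_Cons:
  assumes "regular G" "frame G v a b"
  shows "bracket K (v # L) G \<longleftrightarrow>
    bracket K L (smooth a b G) \<noteq> bracket K L (smooth a (opp G b) G)"
proof -
  obtain c d where cd: "(SOME (a, b). frame G v a b) = (c, d)" by (cases "SOME (a, b). frame G v a b")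
  have "(\<lambda>(a, b). frame G v a b) (SOME (a, b). frame G v a b)"
    by (rule someI[of "\<lambda>(a, b). frame G v a b" "(a, b)"]) (simp add: assms(2))
  then have "frame G v c d" by (simp add: cd)
  from smooth_pair_unique[OF assms this] show ?thesis by (elim disjE) (auto simp: bracket.simps(2) cd)
qed

lemma bracket_isomorphic:
  assumes "regular G" "regular G'" "isomorphism \<phi> \<psi> G G'" "distinct L" "set L \<subseteq> verts G"
  shows "bracket K (map \<phi> L) G' = bracket K L G"
  using assms
proof (induction L arbitrary: G G')
  case Nil
  then show ?case
    using reduces_to_isomorphic isomorphism_sym[OF Nil(3) regularD(2)[OF Nil(1)]] by auto
next
  case (Cons v L)
  then obtain a b where f: "frame G v a b" using frame_exists[of G v] by auto
  note fo = frame_sym(2)[OF Cons.prems(1) f]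
  note i = isomorphism_frame[OF Cons.prems(3,1) f Cons.prems(2)]
  note io = isomorphism_frame[OF Cons.prems(3,1) fo Cons.prems(2)]
  have o: "\<psi> (opp G b) = opp G' (\<psi> b)"
    using Cons.prems(3) f unfolding isomorphism_def frame_def by auto
  have va: "vert G a = v" using f unfolding frame_def by auto
  have "bracket K (map \<phi> L) (smooth (\<psi> a) (\<psi> b) G') = bracket K L (smooth a b G)"
    using Cons.prems va
    by (intro Cons.IH regular_smooth[OF _ f] regular_smooth[OF _ i(1)] i) auto
  moreover have "bracket K (map \<phi> L) (smooth (\<psi> a) (opp G' (\<psi> b)) G') = bracket K L (smooth a (opp G b) G)"
    using Cons.prems va io
    by (intro Cons.IH regular_smooth[OF _ fo] regular_smooth[OF _ io(1)[unfolded o]] io(2)[unfolded o]) auto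
  ultimately show ?case
    using bracket_Cons[OF Cons.prems(1) f] bracket_Cons[OF Cons.prems(2) i(1)] by simp
qed

text \<open>Smoothings at different vertices commute, so both sides are the same sum of four states.
  Exchanges of neighbours then give independence of the order of the whole list.\<close>

lemma bracket_swap:
  assumes "regular G" "u \<noteq> v" "u \<in> verts G" "v \<in> verts G"
  shows "bracket K (u # v # L) G = bracket K (v # u # L) G"
proof -
  obtain a b where f: "frame G u a b" using frame_exists[OF assms(1,3)] by blast
  obtain c d where g: "frame G v c d" using frame_exists[OF assms(1,4)] by blast
  note fo = frame_sym(2)[OF assms(1) f] and go = frame_sym(2)[OF assms(1) g]
  have gs: "frame (smooth a x G) v c d" if "frame G u a x" for x
    using frame_smooth(1)[OF assms(1) that g] assms(2) by simp
  have fs: "frame (smooth c x G) u a b" if "frame G v c x" for x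
    using frame_smooth(1)[OF assms(1) that f] assms(2) by simp
  note r = regular_smooth[OF assms(1)]
  note s = smooth_smooth(1)[OF assms(1) _ _ assms(2)]
  show ?thesis
    using bracket_Cons[OF assms(1) f] bracket_Cons[OF assms(1) g]
      bracket_Cons[OF r[OF f] gs[OF f]] bracket_Cons[OF r[OF fo] gs[OF fo]]
      bracket_Cons[OF r[OF g] fs[OF g]] bracket_Cons[OF r[OF go] fs[OF go]]
      s[OF f g] s[OF f go] s[OF fo g] s[OF fo go]
    by simp blast
qed

lemma bracket_Cons_cong:
  assumes "regular G" "v \<in> verts G"
    "\<And>H. regular H \<Longrightarrow> verts H = verts G - {v} \<Longrightarrow> bracket K L H = bracket K L' H"
  shows "bracket K (v # L) G = bracket K (v # L') G"
proof -
  obtain a b where f: "frame G v a b" using frame_exists[OF assms(1,2)] by blast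
  note fo = frame_sym(2)[OF assms(1) f]
  show ?thesis
    using bracket_Cons[OF assms(1) f] assms(3) regular_smooth[OF assms(1)] f fo
      frame_distinct(5)[OF assms(1) f] by simp
qed

lemma bracket_move_front:
  assumes "regular G" "distinct (us @ v # L)" "set (us @ v # L) \<subseteq> verts G"
  shows "bracket K (us @ v # L) G = bracket K (v # us @ L) G"
  using assms
proof (induction us arbitrary: G)
  case (Cons u us)
  have "bracket K (u # us @ v # L) G = bracket K (u # v # us @ L) G"
    using Cons by (intro bracket_Cons_cong Cons.IH) auto
  then show ?case using bracket_swap Cons.prems by auto
qed simp

lemma bracket_perm:
  assumes "regular G" "distinct L" "distinct L'" "set L = set L'" "set L \<subseteq> verts G"
  shows "bracket K L G = bracket K L' G"
  using assms
proof (induction L arbitrary: L' G)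
  case (Cons v L)
  obtain us vs where L': "L' = us @ v # vs" using Cons.prems(4) split_list[of v L'] by auto
  have "bracket K L' G = bracket K (v # us @ vs) G"
    unfolding L' using Cons.prems L' by (intro bracket_move_front) auto
  also have "\<dots> = bracket K (v # L) G"
    using Cons.prems L' by (intro bracket_Cons_cong Cons.IH[symmetric]) auto
  finally show ?case by simp
qed simp

text \<open>An odd count is nonzero, so some state reduces to \<open>K\<close>; the smoothings
  leading to it only lose vertices and only gain circles. The first bound is the desired inequality,
  the second discards graphs containing a circle.\<close>

lemma bracketD:
  assumes "bracket K L G" "regular G" "distinct L" "set L \<subseteq> verts G"
  shows "card (verts K) \<le> card (verts G)" "circles G \<le> circles K"
proof -
  have "card (verts K) \<le> card (verts G) \<and> circles G \<le> circles K"
    using assms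
  proof (induction L arbitrary: G)
    case Nil
    then show ?case using reduces_toD[of K G] by simp
  next
    case (Cons v L)
    then obtain a b where f: "frame G v a b" using frame_exists[of G v] by auto
    note fo = frame_sym(2)[OF Cons.prems(2) f]
    obtain x where x: "frame G v a x" "bracket K L (smooth a x G)"
      using bracket_Cons[OF Cons.prems(2) f] Cons.prems(1) f fo by blast
    have va: "vert G a = v" using f unfolding frame_def by auto
    have "distinct L" "set L \<subseteq> verts (smooth a x G)" using Cons.prems va by auto
    note IH = Cons.IH[OF x(2) regular_smooth[OF Cons.prems(2) x(1)] this]
    have "card (verts (smooth a x G)) \<le> card (verts G)"
      using regularD(3)[OF Cons.prems(2)] by (auto intro!: card_mono)
    then show ?case using IH smooth_simps(5)[of G a x] by linarith
  qed
  then show "card (verts K) \<le> card (verts G)" "circles G \<le> circles K" by auto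
qed

section \<open>First and second moves in terms of the bracket\<close>

lemma bracket_loop:
  assumes "regular G" "frame G v a b" "mate G a = b" "circles K = 0" "distinct (v # L)"
    "set (v # L) \<subseteq> verts G"
  shows "bracket K (v # L) G = bracket K L (unvert a b G)"
proof -
  note s = smooth_loop[OF assms(1-3)]
  have "vert G a = v" using assms(2) unfolding frame_def by auto
  then have "\<not> bracket K L (smooth a b G)"
    using bracketD(2)[OF _ regular_smooth[OF assms(1,2)], of K L] assms s(1) by auto
  then show ?thesis using bracket_Cons[OF assms(1,2)] s(2) by simp
qed

text \<open>The bigon persists in every state, because its edges avoid the smoothed vertices. By
  confluence its removal does not affect whether a state reduces to \<open>K\<close>.\<close>

lemma bracket_bigon_away:
  assumes "regular K" "\<And>x y. \<not> bigon_at K x y" "regular G" "bigon_at G a b" "distinct L"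
    "set L \<subseteq> verts G - {vert G a, vert G (mate G a)}"
  shows "bracket K L (unbigon a b G) = bracket K L G"
  using assms(3-6)
proof (induction L arbitrary: G)
  case Nil
  then show ?case using reduces_to_unbigon_iff[OF assms(1,2)] by simp
next
  case (Cons v L)
  then obtain x y where f: "frame G v x y" using frame_exists[of G v] by auto
  note fo = frame_sym(2)[OF Cons.prems(1) f]
  have n: "v \<noteq> vert G a" "v \<noteq> vert G (mate G a)" using Cons.prems by auto
  have va: "vert G x = v" using f unfolding frame_def by auto
  note r = regular_unbigon[OF Cons.prems(1,2)]
  note b = bigon_at_smooth[OF Cons.prems(1,2) f n] and bo = bigon_at_smooth[OF Cons.prems(1,2) fo n]
  note bv = bigon_atD[OF Cons.prems(2)]
  have m: "mate (smooth x z G) a = mate G a" if "frame G v x z" for z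
    using mate_smooth_other(1)[OF Cons.prems(1) that bv(6)] n by metis
  have "bracket K L (unbigon a b (smooth x y G)) = bracket K L (smooth x y G)"
    using Cons.prems va m[OF f] by (intro Cons.IH b regular_smooth[OF _ f]) auto
  moreover have "bracket K L (unbigon a b (smooth x (opp G y) G)) = bracket K L (smooth x (opp G y) G)"
    using Cons.prems va m[OF fo] by (intro Cons.IH bo regular_smooth[OF _ fo]) auto
  ultimately show ?case
    using bracket_Cons[OF Cons.prems(1) f] bracket_Cons[OF r b(5)] b(2) bo(2) by simp
qed

text \<open>The two equal mixed states cancel modulo 2. Counted as integers they would not, which is
  why the bracket is a boolean.\<close>

lemma bracket_bigon_smoothed:
  assumes "regular G" "bigon_at G a b" "circles K = 0" "distinct (vert G a # vert G (mate G a) # L)"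
    "set L \<subseteq> verts G"
  shows "bracket K (vert G a # vert G (mate G a) # L) G = bracket K L (unbigon a b G)"
proof -
  let ?c = "mate G a" and ?d = "mate G b"
  note b = bigon_atD[OF assms(2)]
  note fo = frame_sym(2)[OF assms(1) b(1)]
  note s = smooth_bigon[OF assms(1,2)]
  have f: "frame (smooth a x G) (vert G ?c) ?c ?d" if "frame G (vert G a) a x" for x
    using frame_smooth(1)[OF assms(1) that b(2)] b(3) by blast
  note r = regular_smooth[OF assms(1)]
  have "\<not> bracket K L (smooth ?c ?d (smooth a b G))"
    using bracketD(2)[OF _ regular_smooth[OF r[OF b(1)] f[OF b(1)]], of K L] s(1) assms by auto
  then show ?thesis
    using bracket_Cons[OF assms(1) b(1)] bracket_Cons[OF r[OF b(1)] f[OF b(1)]]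
      bracket_Cons[OF r[OF fo] f[OF fo]] s(2,3) by simp blast
qed

text \<open>That \<open>L\<close> contains both vertices of the bigon or neither is all that is used
  of parity. For a second move this is the parity axiom; for a bigon arising from a triangle it
  follows from the number of odd vertices being even.\<close>

lemma bracket_bigon:
  assumes K: "regular K" "\<And>x y. \<not> bigon_at K x y" "circles K = 0"
    and "regular G" "bigon_at G a b" "distinct L" "set L \<subseteq> verts G"
    "vert G a \<in> set L \<longleftrightarrow> vert G (mate G a) \<in> set L"
    and L': "distinct L'" "set L' = set L - {vert G a, vert G (mate G a)}"
  shows "bracket K L G = bracket K L' (unbigon a b G)"
proof (cases "vert G a \<in> set L")
  case True
  let ?M = "vert G a # vert G (mate G a) # L'"
  have "distinct ?M" "set ?M = set L" using True assms bigon_atD(3)[OF assms(5)] by auto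
  then have "bracket K L G = bracket K ?M G" using assms by (intro bracket_perm) auto
  also have "\<dots> = bracket K L' (unbigon a b G)"
    using assms \<open>distinct ?M\<close> by (intro bracket_bigon_smoothed) auto
  finally show ?thesis .
next
  case False
  then have "bracket K L G = bracket K L' G" using assms by (intro bracket_perm) auto
  also have "\<dots> = bracket K L' (unbigon a b G)"
    using assms False by (intro bracket_bigon_away[OF K(1,2), symmetric]) auto
  finally show ?thesis .
qed

section \<open>The third move\<close>

lemma cuts_ren:
  assumes "\<And>x. p (p x) = x"
  shows "cuts (map (map_prod p p) ps) (ren p G) = ren p (cuts ps G)"
  by (induction ps) (auto simp: cut_ren[OF assms])

lemma ren_del:
  assumes "\<And>x. p (p x) = x"
  shows "ren p (del x y G) = del (p x) (p y) (ren p G)"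
proof -
  have i: "p x = p y \<longleftrightarrow> x = y" for x y using assms by metis
  have j: "x = p y \<longleftrightarrow> p x = y" for x y using assms by metis
  have "p ` (hedges G - {x, y}) = p ` hedges G - {p x, p y}" by (auto simp: i)
  then show ?thesis by (intro fgraph_eqI) (auto simp: assms i j)
qed

text \<open>The three vertices of a triangle are crossings of strands: \<open>w\<close> is where the half-edges \<open>a\<close>
  and \<open>c'\<close> meet, and the triangle edges are \<open>aa'\<close>, \<open>bb'\<close>, \<open>cc'\<close>.\<close>

locale framed_triangle =
  fixes G :: fgraph and w u v a a' b b' c c' :: nat
  assumes regular: "regular G"
    and frames: "frame G w a c'" "frame G u b a'" "frame G v c b'"
    and mates: "mate G a = a'" "mate G b = b'" "mate G c = c'"
    and verts: "distinct [w, u, v]"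
begin

abbreviation "A \<equiv> opp G a"
abbreviation "A' \<equiv> opp G a'"
abbreviation "B \<equiv> opp G b"
abbreviation "B' \<equiv> opp G b'"
abbreviation "C \<equiv> opp G c"
abbreviation "C' \<equiv> opp G c'"

lemma tidy: "tidy G"
  by (rule regularD(1)[OF regular])

lemmas frame_facts = frame_distinct[OF regular frames(1)] frame_distinct[OF regular frames(2)]
  frame_distinct[OF regular frames(3)]

lemma distinct_ends: "distinct [a, c', A, C', b, a', B, A', c, b', C, B']"
proof -
  have disj: "X \<inter> Y = {}" if "\<forall>x\<in>X. vert G x = p" "\<forall>y\<in>Y. vert G y = q" "p \<noteq> q" for X Y p q
    using that by auto
  have "\<forall>x\<in>{a, c', A, C'}. vert G x = w" "\<forall>x\<in>{b, a', B, A'}. vert G x = u"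
    "\<forall>x\<in>{c, b', C, B'}. vert G x = v"
    using frame_facts by simp_all
  moreover have "w \<noteq> u" "w \<noteq> v" "u \<noteq> v" using verts by auto
  ultimately have "{a, c', A, C'} \<inter> {b, a', B, A'} = {}" "{a, c', A, C'} \<inter> {c, b', C, B'} = {}"
    "{b, a', B, A'} \<inter> {c, b', C, B'} = {}"
    using disj by metis+
  then have "distinct ([a, c', A, C'] @ [b, a', B, A'] @ [c, b', C, B'])"
    unfolding distinct_append using frame_facts(1) frame_facts(10) frame_facts(19) by auto
  then show ?thesis by simp
qed

lemma distinct_ends_rev: "distinct [B', C, b', c, A', B, a', b, C', A, c', a]"
proof -
  have "distinct (rev [a, c', A, C', b, a', B, A', c, b', C, B'])"
    unfolding distinct_rev by (rule distinct_ends)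
  then show ?thesis by simp
qed

lemmas ends_neq = distinct_ends[simplified] distinct_ends_rev[simplified]

lemma ends_subset: "{a, c', A, C', b, a', B, A', c, b', C, B'} \<subseteq> hedges G"
  using frame_facts(2) frame_facts(11) frame_facts(20) by simp

lemma mates': "mate G a' = a" "mate G b' = b" "mate G c' = c"
  using tidy_swap[OF tidy] mates by auto

lemma opps: "opp G A = a" "opp G A' = a'" "opp G B = b" "opp G B' = b'" "opp G C = c" "opp G C' = c'"
  using frame_facts by auto

text \<open>The common outcome, before and after the move, of smoothing \<open>w\<close> towards the
  triangle and removing the resulting bigon: the triangle edges are gone, and the outer half-edges
  are joined as \<open>A\<close> to \<open>C'\<close>, \<open>A'\<close> to \<open>C\<close> and
  \<open>B\<close> to \<open>B'\<close>.\<close>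

definition "core = drop_vert v (drop_vert u (drop_vert w
  (cuts [(A, C'), (A', C), (B, B')] (del b b' (del a' a (del c' c G))))))"

text \<open>Gluing \<open>a\<close> to \<open>c'\<close> merges two triangle edges into one edge
  between \<open>u\<close> and \<open>v\<close>, which bounds a bigon with the third triangle
  edge.\<close>

lemma corner_bigon:
  "bigon_at (smooth a c' G) a' b" "vert G (mate (smooth a c' G) a') = v"
  "unbigon a' b (smooth a c' G) = core"
proof -
  let ?H = "cut A C' G"
  have H: "tidy ?H"
    using ends_subset by (intro tidy_cut tidy) (simp_all add: ends_neq)
  have mH: "mate ?H a' = a" "mate ?H c' = c" "mate ?H b = b'"
    by (simp_all add: mate_cut'[OF tidy] mates mates' ends_neq)
  have S: "smooth a c' G = drop_vert w (cut a c' ?H)"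
    using frame_facts(5) by (simp add: smooth_cuts)
  have m: "mate (smooth a c' G) a' = c" "mate (smooth a c' G) b = b'"
    unfolding S by (simp_all add: mate_cut'[OF H] mH ends_neq)
  have f: "frame (smooth a c' G) u b a'" "frame (smooth a c' G) v c b'"
    using frame_smooth(1)[OF regular frames(1)] frames(2,3) verts by auto
  note r = regular_smooth[OF regular frames(1)]
  have "frame (smooth a c' G) u a' b" using frame_sym(1)[OF r f(1)] .
  then show "bigon_at (smooth a c' G) a' b"
    using f(2) frame_facts verts unfolding bigon_at_def m by auto
  show "vert G (mate (smooth a c' G) a') = v" using m frame_facts by simp
  let ?X = "del a' a (del c' c G)"
  have X: "tidy ?X" "mate ?X b = b'"
    using distinct_ends mates mates' by (auto intro!: tidy_del tidy)
  have "unbigon a' b (smooth a c' G) = drop_vert v (drop_vert u (drop_vert w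
      (cuts [(c, C), (b', B'), (a', A'), (b, B), (a, c'), (A, C')] G)))"
    unfolding unbigon_def m using frame_facts by (simp add: smooth_cuts)
  also have "cuts [(c, C), (b', B'), (a', A'), (b, B), (a, c'), (A, C')] G
      = cuts [(A, C'), (B, b), (b', B'), (A', a'), (a, c'), (c, C)] G"
    using distinct_ends ends_subset
    by (intro cuts_cong tidy) (auto simp: insert_commute add_mset_commute)
  also have "\<dots> = cuts [(A, C'), (B, b), (b', B')] (cuts [(A', a'), (a, c'), (c, C)] G)" by simp
  also have "\<dots> = cuts [(A, C'), (B, b), (b', B')] (cuts [(A', C)] ?X)"
    using distinct_ends ends_subset by (subst cuts_chain2[OF tidy mates'(1,3)]) auto
  also have "\<dots> = cuts [(A, C'), (B, b), (b', B'), (A', C)] ?X" by simp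
  also have "\<dots> = cuts [(A, C'), (A', C), (B, b), (b', B')] ?X"
    using distinct_ends ends_subset
    by (intro cuts_cong X) (auto simp: insert_commute add_mset_commute)
  also have "\<dots> = cuts [(A, C'), (A', C)] (cuts [(B, b), (b', B')] ?X)" by simp
  also have "\<dots> = cuts [(A, C'), (A', C), (B, B')] (del b b' ?X)"
    using distinct_ends ends_subset by (subst cuts_chain[OF X]) auto
  finally show "unbigon a' b (smooth a c' G) = core" unfolding core_def .
qed

text \<open>Gluing \<open>a\<close> to \<open>C'\<close> and \<open>c'\<close> to \<open>A\<close>
  turns two triangle edges into mere extensions of the edges at \<open>C'\<close> and
  \<open>A\<close>: \<open>a'\<close> takes the place of \<open>C'\<close>, and \<open>c\<close>
  that of \<open>A\<close>.\<close>

lemma far_smoothing: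
  "smooth a C' G = drop_vert w (ren (transpose c A) (ren (transpose a' C') (del a a' (del c' c G))))"
proof -
  have "smooth a C' G = drop_vert w (cuts [(a, C'), (A, c')] G)"
    using frame_facts opps by (simp add: smooth_cuts)
  also have "cuts [(a, C'), (A, c')] G = cuts [(a, C'), (c', A)] G"
    using distinct_ends ends_subset by (intro cuts_cong tidy) (auto simp: insert_commute)
  also have "\<dots> = ren (transpose c A) (ren (transpose a' C') (del a a' (del c' c G)))"
    unfolding cuts_simps
    by (rule cut_slide_twice[OF tidy mates(1) mates'(3)]) (use distinct_ends ends_subset in auto)
  finally show ?thesis .
qed

text \<open>The exchange of places made by the third move, written out on all twelve half-edges:
  each triangle half-edge is paired with the outer half-edge at the other end of its triangle
  edge.\<close>

definition swap :: "nat \<Rightarrow> nat" where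
  "swap = id(a := A', A' := a, a' := A, A := a', b := B', B' := b, b' := B, B := b',
     c := C', C' := c, c' := C, C := c')"

lemma swap_simps:
  "swap a = A'" "swap A' = a" "swap a' = A" "swap A = a'" "swap b = B'" "swap B' = b"
  "swap b' = B" "swap B = b'" "swap c = C'" "swap C' = c" "swap c' = C" "swap C = c'"
  by (simp_all add: swap_def ends_neq)

lemma swap_other: "h \<notin> {a, c', A, C', b, a', B, A', c, b', C, B'} \<Longrightarrow> swap h = h"
  by (simp add: swap_def)

lemma swap_swap: "swap (swap h) = h"
proof (cases "h \<in> {a, c', A, C', b, a', B, A', c, b', C, B'}")
  case True
  then show ?thesis using swap_simps by auto
next
  case False
  from swap_other[OF this] show ?thesis by simp
qed

text \<open>Although \<open>swap\<close> carries half-edges to other vertices, it respects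
  opposites, so the strands remain strands. This is why the third move keeps the number of unicursal
  components.\<close>

lemma opp_swap:
  assumes "h \<in> hedges G"
  shows "opp G (swap h) = swap (opp G h)"
proof (cases "h \<in> {a, c', A, C', b, a', B, A', c, b', C, B'}")
  case True
  have "\<forall>h\<in>{a, c', A, C', b, a', B, A', c, b', C, B'}. opp G (swap h) = swap (opp G h)"
    by (simp add: swap_simps opps)
  then show ?thesis using True by (rule bspec)
next
  case False
  have "opp G h \<notin> {a, c', A, C', b, a', B, A', c, b', C, B'}"
  proof
    assume "opp G h \<in> {a, c', A, C', b, a', B, A', c, b', C, B'}"
    then have "opp G (opp G h) \<in> {a, c', A, C', b, a', B, A', c, b', C, B'}"
      using opps by auto
    then show False using False regularD(7)[OF regular assms] by simp
  qed
  from swap_other[OF this] swap_other[OF False] show ?thesis by simp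
qed

section \<open>The triangle after the third move\<close>

definition "moved = ren swap G"

lemma swap_hedges: "swap ` hedges G = hedges G"
proof -
  have "swap h \<in> hedges G" if "h \<in> hedges G" for h
  proof (cases "h \<in> {a, c', A, C', b, a', B, A', c, b', C, B'}")
    case True
    then show ?thesis using swap_simps ends_subset by auto
  next
    case False
    from swap_other[OF this] that show ?thesis by simp
  qed
  then show ?thesis by (metis image_subset_iff subsetI subset_antisym swap_swap imageI)
qed

lemma moved_simps [simp]:
  "verts moved = verts G" "hedges moved = hedges G" "vert moved = vert G" "opp moved = opp G"
  "circles moved = circles G"
  by (simp_all add: moved_def swap_hedges)

lemma tidy_moved: "tidy moved"
  unfolding moved_def by (intro tidy_ren tidy swap_swap)

lemma regular_moved: "regular moved"
proof -
  have "framed4 moved"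
    using regularD(2)[OF regular] tidyD(1,2)[OF tidy_moved] unfolding framed4_def by simp
  then show ?thesis using tidy_moved by (simp add: regular_def)
qed

text \<open>After the move the triangle edges are \<open>AA'\<close>, \<open>BB'\<close>,
  \<open>CC'\<close>: at each vertex the triangle lies on the opposite side. All facts about the
  triangle thus hold again with every half-edge replaced by its opposite.\<close>

lemma moved_triangle: "framed_triangle moved w u v A A' B B' C C'"
proof
  show "regular moved" by (rule regular_moved)
  show "frame moved w A C'" "frame moved u B A'" "frame moved v C B'"
    using frame_sym(4)[OF regular frames(1)] frame_sym(4)[OF regular frames(2)]
      frame_sym(4)[OF regular frames(3)] by (simp_all add: frame_def)
  show "mate moved A = A'" "mate moved B = B'" "mate moved C = C'"
    using mates mates' swap_simps by (simp_all add: moved_def)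
  show "distinct [w, u, v]" by (rule verts)
qed

text \<open>\<open>swap\<close> carries the graph without triangle edges before the move to the one
  after it, and sends the pairs to be glued before to the pairs to be glued after.\<close>

lemma core_moved: "framed_triangle.core moved w u v A A' B B' C C' = core"
proof -
  interpret M: framed_triangle moved w u v A A' B B' C C' by (rule moved_triangle)
  let ?K = "del b b' (del a' a (del c' c G))"
  let ?ps = "[(A, C'), (A', C), (B, B')]"
  have K: "tidy ?K" "hedges ?K = hedges G - {a, a', b, b', c, c'}"
    using distinct_ends mates mates' by (auto intro!: tidy_del tidy)
  have e: "distinct (ends ?ps)" "set (ends ?ps) \<subseteq> hedges ?K"
    using distinct_ends ends_subset by auto
  have R: "del B B' (del A' A (del C' C moved)) = ren swap ?K"
    unfolding moved_def by (simp add: ren_del swap_swap swap_simps del_sym)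
  have t: "tidy (ren swap ?K)" by (intro tidy_ren K swap_swap)
  have h: "hedges (ren swap ?K) = hedges G - {A, A', B, B', C, C'}"
    unfolding R[symmetric] by auto
  have "cuts [(a, c'), (a', c), (b, b')] (ren swap ?K) = cuts (map (map_prod swap swap) ?ps) (ren swap ?K)"
    using distinct_ends ends_subset
    by (intro cuts_cong t; (subst h)?) (auto simp: swap_simps insert_commute add_mset_commute)
  also have "\<dots> = ren swap (cuts ?ps ?K)" by (rule cuts_ren[OF swap_swap])
  \<comment> \<open>All twelve half-edges moved by \<open>swap\<close> have been removed by
    now.\<close>
  also have "\<dots> = cuts ?ps ?K"
    using tidy_cuts[OF K(1) e] K(2) by (intro ren_ident swap_swap) (auto intro!: swap_other)
  finally show ?thesis
    unfolding M.core_def core_def R by (simp add: opps)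
qed

text \<open>After this smoothing two arcs cross the strand through \<open>b\<close>. The arc between
  the outer ends of \<open>C\<close> and \<open>A\<close> crosses it at \<open>v\<close> before the
  move and at \<open>u\<close> after it, and conversely for the other arc. Hence the isomorphism
  exchanges \<open>u\<close> and \<open>v\<close>, although the move itself keeps the labels of the
  vertices.\<close>

lemma far_smoothing_moved:
  "\<exists>\<psi>. isomorphism (transpose u v) \<psi> (smooth a C' G) (smooth A c' moved)"
proof -
  interpret M: framed_triangle moved w u v A A' B B' C C' by (rule moved_triangle)
  let ?K = "del a a' (del c' c G)"
  let ?p = "transpose c A" and ?q = "transpose a' C'" and ?p' = "transpose C a" and ?q' = "transpose A' c'"
  have K: "tidy ?K" using distinct_ends mates mates' by (auto intro!: tidy_del tidy)
  have R: "del A A' (del C' C moved) = ren swap ?K"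
    unfolding moved_def by (simp add: ren_del swap_swap swap_simps del_sym)
  define \<psi> where "\<psi> = ?p' \<circ> (?q' \<circ> (swap \<circ> (?q \<circ> ?p)))"
  have "mate_iso (?q \<circ> ?p) (ren ?p (ren ?q ?K)) ?K"
    by (rule mate_iso_trans[OF mate_iso_ren(2) mate_iso_ren(2)]) (simp_all add: K tidy_ren)
  then have "mate_iso (swap \<circ> (?q \<circ> ?p)) (ren ?p (ren ?q ?K)) (ren swap ?K)"
    by (rule mate_iso_trans[OF _ mate_iso_ren(1)]) (simp_all add: K swap_swap)
  then have "mate_iso (?q' \<circ> (swap \<circ> (?q \<circ> ?p))) (ren ?p (ren ?q ?K)) (ren ?q' (ren swap ?K))"
    by (rule mate_iso_trans[OF _ mate_iso_ren(1)]) (simp_all add: K swap_swap tidy_ren)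
  then have "mate_iso \<psi> (ren ?p (ren ?q ?K)) (ren ?p' (ren ?q' (ren swap ?K)))"
    unfolding \<psi>_def
    by (rule mate_iso_trans[OF _ mate_iso_ren(1)]) (simp_all add: K swap_swap tidy_ren)
  then have mi: "mate_iso \<psi> (smooth a C' G) (smooth A c' moved)"
    using M.far_smoothing unfolding far_smoothing by (simp add: opps R)
  have ps: "\<psi> a' = c" "\<psi> c = a'" "\<psi> A' = C" "\<psi> C = A'" "\<psi> b = B'" "\<psi> B' = b" "\<psi> b' = B" "\<psi> B = b'"
    by (simp_all add: \<psi>_def transpose_def swap_simps ends_neq)
  have po: "\<psi> h = h" if "h \<notin> {a, c', A, C', b, a', B, A', c, b', C, B'}" for h
    using that swap_other[OF that] by (simp add: \<psi>_def transpose_def)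
  have "vert G (\<psi> h) = transpose u v (vert G h) \<and> opp G (\<psi> h) = \<psi> (opp G h)"
    if h: "h \<in> hedges G" "h \<notin> {a, c', A, C'}" for h
  proof (cases "h \<in> {b, a', B, A', c, b', C, B'}")
    case True
    have "\<forall>h\<in>{b, a', B, A', c, b', C, B'}. vert G (\<psi> h) = transpose u v (vert G h) \<and>
        opp G (\<psi> h) = \<psi> (opp G h)"
      by (simp add: ps opps frame_facts(14-17) frame_facts(23-26))
    with True show ?thesis by blast
  next
    case False
    note hd = frame_hedges[OF regular frames(1)] frame_hedges[OF regular frames(2)]
      frame_hedges[OF regular frames(3)]
    have v: "vert G h \<noteq> w" "vert G h \<noteq> u" "vert G h \<noteq> v" using h False hd by auto
    have "opp G h \<in> hedges G" "vert G (opp G h) = vert G h"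
      using regularD(5,8)[OF regular h(1)] by auto
    then have "opp G h \<notin> {a, c', A, C'}" "opp G h \<notin> {b, a', B, A'}" "opp G h \<notin> {c, b', C, B'}"
      using v unfolding hd[symmetric] by simp_all
    then show ?thesis using po[of h] po[of "opp G h"] h False v by (simp add: transpose_def)
  qed
  moreover have "bij_betw (transpose u v) (verts G - {w}) (verts G - {w})"
    using frame_facts(9) frame_facts(18) frame_facts(27) verts
    by (intro bij_betw_byWitness[where f' = "transpose u v"]) (auto simp: transpose_def)
  ultimately have "isomorphism (transpose u v) \<psi> (smooth a C' G) (smooth A c' moved)"
    using mi frame_facts opps by (intro isomorphismI) auto
  then show ?thesis by blast
qed

text \<open>The condition on \<open>u\<close> and \<open>v\<close> is used twice: it permits
  removing the bigon that the near smoothing creates, and it makes the list invariant under the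
  exchange of \<open>u\<close> and \<open>v\<close> in the far smoothing.\<close>

lemma bracket_moved:
  assumes K: "regular K" "\<And>x y. \<not> bigon_at K x y" "circles K = 0"
    and L: "distinct (w # L)" "set L \<subseteq> verts G" "u \<in> set L \<longleftrightarrow> v \<in> set L"
  shows "bracket K (w # L) moved = bracket K (w # L) G"
proof -
  interpret M: framed_triangle moved w u v A A' B B' C C' by (rule moved_triangle)
  note f = frame_sym(2)[OF regular frames(1)] and fM = frame_sym(2)[OF M.regular M.frames(1)]
  define L' where "L' = filter (\<lambda>x. x \<notin> {u, v}) L"
  have L': "distinct L'" "set L' = set L - {u, v}" using L by (auto simp: L'_def)
  have "bracket K L (smooth a c' G) = bracket K L' core"
    unfolding corner_bigon(3)[symmetric] using L L' frame_facts corner_bigon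
    by (intro bracket_bigon[OF K] regular_smooth[OF regular frames(1)]) auto
  moreover have "bracket K L (smooth A C' moved) = bracket K L' core"
    unfolding core_moved[symmetric] M.corner_bigon(3)[symmetric]
    using L L' frame_facts M.corner_bigon
    by (intro bracket_bigon[OF K] regular_smooth[OF M.regular M.frames(1)]) auto
  moreover have "bracket K L (smooth A c' moved) = bracket K L (smooth a C' G)"
  proof -
    obtain \<psi> where i: "isomorphism (transpose u v) \<psi> (smooth a C' G) (smooth A c' moved)"
      using far_smoothing_moved by blast
    have r: "regular (smooth a C' G)" "regular (smooth A c' moved)"
      using regular_smooth[OF regular f] regular_smooth[OF M.regular fM] by (simp_all add: opps)
    have s: "set (map (transpose u v) L) = set L" "distinct (map (transpose u v) L)"
      using L by (auto simp: transpose_def distinct_map inj_on_def image_iff split: if_splits)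
    have va: "vert G a = w" "vert G A = w" using frame_facts by auto
    have "bracket K (map (transpose u v) L) (smooth A c' moved) = bracket K L (smooth a C' G)"
      by (rule bracket_isomorphic[OF r i]) (use L va in auto)
    moreover have "bracket K (map (transpose u v) L) (smooth A c' moved) = bracket K L (smooth A c' moved)"
      using L va s by (intro bracket_perm r) auto
    ultimately show ?thesis by simp
  qed
  ultimately show ?thesis
    using bracket_Cons[OF regular frames(1)] bracket_Cons[OF M.regular M.frames(1)] by (simp add: opps)
qed

end

section \<open>Splices as iterated cuts\<close>

text \<open>One step of a chain as in \<open>joined\<close>, but with an arbitrary set
  \<open>Y\<close> of half-edges still to be glued, so that the pairs can be treated one after the
  other.\<close>

definition step_rel :: "fgraph \<Rightarrow> nat set \<Rightarrow> (nat \<Rightarrow> nat) \<Rightarrow> (nat \<times> nat) set" where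
  "step_rel G Y j = {(x, y). (x \<in> hedges G \<and> y = mate G x) \<or> (x \<in> Y \<and> y = j x)}"

definition closed_chains :: "fgraph \<Rightarrow> nat set \<Rightarrow> (nat \<Rightarrow> nat) \<Rightarrow> nat set set" where
  "closed_chains G Y j = {C \<in> hedges G // (step_rel G Y j)\<^sup>*. C \<subseteq> Y}"

definition pairing :: "fgraph \<Rightarrow> nat set \<Rightarrow> (nat \<Rightarrow> nat) \<Rightarrow> bool" where
  "pairing G Y j \<longleftrightarrow> Y \<subseteq> hedges G \<and> (\<forall>h\<in>Y. j h \<in> Y \<and> j h \<noteq> h \<and> j (j h) = h)"

lemma pairing_cut:
  assumes "pairing G Y j" "h \<in> Y"
  shows "pairing (cut h (j h) G) (Y - {h, j h}) j"
  using assms unfolding pairing_def by (auto; metis)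

lemma step_rel_facts:
  assumes "tidy G" "pairing G Y j" "(x, y) \<in> step_rel G Y j"
  shows "x \<in> hedges G" "y \<in> hedges G" "(y, x) \<in> step_rel G Y j"
proof -
  show "x \<in> hedges G" using assms(2,3) unfolding step_rel_def pairing_def by auto
  consider "x \<in> hedges G" "y = mate G x" | "x \<in> Y" "y = j x"
    using assms(3) unfolding step_rel_def by auto
  then have "y \<in> hedges G \<and> (y, x) \<in> step_rel G Y j"
  proof cases
    case 1
    then show ?thesis using tidyD(1,2)[OF assms(1)] unfolding step_rel_def by auto
  next
    case 2
    then show ?thesis using assms(2) unfolding step_rel_def pairing_def by auto
  qed
  then show "y \<in> hedges G" "(y, x) \<in> step_rel G Y j" by auto
qed

lemma step_rel_rtrancl:
  assumes "tidy G" "pairing G Y j" "(x, y) \<in> (step_rel G Y j)\<^sup>*"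
  shows "x \<in> hedges G \<longleftrightarrow> y \<in> hedges G" "(y, x) \<in> (step_rel G Y j)\<^sup>*"
proof -
  show "x \<in> hedges G \<longleftrightarrow> y \<in> hedges G"
    using assms(3) by (induction) (use step_rel_facts[OF assms(1,2)] in blast)+
  have "sym (step_rel G Y j)" using step_rel_facts(3)[OF assms(1,2)] by (auto intro: symI)
  then show "(y, x) \<in> (step_rel G Y j)\<^sup>*" using assms(3) sym_rtrancl symD by metis
qed

lemma step_rel_class:
  assumes "tidy G" "pairing G Y j" "(x, y) \<in> (step_rel G Y j)\<^sup>*"
  shows "(step_rel G Y j)\<^sup>* `` {x} = (step_rel G Y j)\<^sup>* `` {y}"
  using step_rel_rtrancl(2)[OF assms(1,2)] assms(3) by (auto intro: rtrancl_trans)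

text \<open>One glued pair \<open>h\<close>, \<open>k\<close> is cut out. \<open>R\<close> and
  \<open>R'\<close> generate the chains before and after, and \<open>D'\<close> consists of the
  remaining half-edges.\<close>

locale cut_pair =
  fixes G :: fgraph and Y :: "nat set" and j :: "nat \<Rightarrow> nat" and h k :: nat
  assumes tidy: "tidy G" and pairing: "pairing G Y j" and h: "h \<in> Y" and k: "k = j h"
begin

abbreviation (input) "R \<equiv> step_rel G Y j"
abbreviation (input) "R' \<equiv> step_rel (cut h k G) (Y - {h, k}) j"
abbreviation (input) "D' \<equiv> hedges G - {h, k}"

lemma hk: "h \<noteq> k" "h \<in> hedges G" "k \<in> hedges G" "k \<in> Y" "j k = h" "j h = k"
  using pairing h k unfolding pairing_def by auto

lemma tidy': "tidy (cut h k G)" and pairing': "pairing (cut h k G) (Y - {h, k}) j"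
  using tidy_cut[OF tidy hk(1-3)] pairing_cut[OF pairing h] k by auto

lemma j_other: "x \<in> Y \<Longrightarrow> x \<notin> {h, k} \<Longrightarrow> j x \<in> Y - {h, k}"
  using pairing hk unfolding pairing_def by (metis DiffI insert_iff empty_iff)

lemma mate_hk: "mate G h \<noteq> h" "mate G k \<noteq> k" "mate G h \<in> hedges G" "mate G k \<in> hedges G"
proof -
  show n: "mate G h \<noteq> h" "mate G k \<noteq> k" using hk(2,3) tidyD(2)[OF tidy] by blast+
  have "mate G (mate G h) \<noteq> mate G h" "mate G (mate G k) \<noteq> mate G k"
    using n unfolding tidyD(1)[OF tidy] by simp_all
  then show "mate G h \<in> hedges G" "mate G k \<in> hedges G" using tidyD(2)[OF tidy] by blast+
qed

lemma mate_hk_open: "mate G h \<noteq> k \<Longrightarrow> mate G k \<noteq> h"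
  using tidy_swap[OF tidy, of k h] by blast

text \<open>The only new edge, from \<open>mate G h\<close> to \<open>mate G k\<close>, replaces a
  path through \<open>h\<close> and \<open>k\<close>.\<close>

lemma chain_cut_subset: "(x, y) \<in> R'\<^sup>* \<Longrightarrow> (x, y) \<in> R\<^sup>*"
proof (induction rule: rtrancl_induct)
  case (step y z)
  have "(y, z) \<in> R\<^sup>*"
  proof (cases "y \<in> Y - {h, k} \<and> z = j y")
    case True
    then show ?thesis unfolding step_rel_def by auto
  next
    case False
    then have y: "y \<in> hedges G" "y \<notin> {h, k}" "z = mate (cut h k G) y"
      using step(2) unfolding step_rel_def by auto
    have m: "(x, mate G x) \<in> R" if "x \<in> hedges G" for x
      using that unfolding step_rel_def by auto
    have jj: "(h, k) \<in> R" "(k, h) \<in> R" using h hk unfolding step_rel_def by auto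
    consider "mate G y = h" "z = mate G k" | "mate G y = k" "z = mate G h" | "z = mate G y"
      using y(2,3) by (auto simp: mate_cut'[OF tidy] split: if_splits)
    then show ?thesis
    proof cases
      case 1
      then show ?thesis using m[OF y(1)] jj(1) m[OF hk(3)]
        by (meson rtrancl.simps)
    next
      case 2
      then show ?thesis using m[OF y(1)] jj(2) m[OF hk(2)]
        by (meson rtrancl.simps)
    next
      case 3
      then show ?thesis using m[OF y(1)] by blast
    qed
  qed
  then show ?case using step by (meson rtrancl_trans)
qed simp

text \<open>\<open>f\<close> contracts \<open>h\<close> and \<open>k\<close> to
  \<open>mate G h\<close>, a member of their chain that survives the cut. Under it every old step
  becomes trivial or a new step.\<close>

lemma chain_cut_open:
  assumes ne: "mate G h \<noteq> k"
  defines "f \<equiv> \<lambda>x. if x \<in> {h, k} then mate G h else x"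
  shows "(x, y) \<in> R\<^sup>* \<Longrightarrow> (f x, f y) \<in> R'\<^sup>*"
proof (induction rule: rtrancl_induct)
  case (step y z)
  have mh: "mate G h \<notin> {h, k}" "mate G k \<notin> {h, k}" "mate G h \<noteq> mate G k"
    "mate G h \<in> hedges G" "mate G k \<in> hedges G"
    using ne mate_hk mate_hk_open[OF ne] hk(1) tidyD(3)[OF tidy] by simp_all
  have m': "(x, mate (cut h k G) x) \<in> R'" if "x \<in> D'" for x
    using that unfolding step_rel_def by auto
  consider "y \<in> Y" "z = j y" | "y \<in> hedges G" "z = mate G y"
    using step(2) unfolding step_rel_def by auto
  then have "(f y, f z) \<in> R'\<^sup>*"
  proof cases
    case 1
    show ?thesis
    proof (cases "y \<in> {h, k}")
      case True
      then have "z \<in> {h, k}" using 1 hk by auto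
      then show ?thesis using True by (auto simp: f_def)
    next
      case False
      have "z \<in> Y - {h, k}" unfolding 1(2) by (rule j_other[OF 1(1) False])
      moreover have "(y, z) \<in> R'" using 1 False unfolding step_rel_def by auto
      ultimately show ?thesis using False by (auto simp: f_def)
    qed
  next
    case 2
    consider "y = h" | "y = k" | "z = h" | "z = k" | "y \<notin> {h, k}" "z \<notin> {h, k}" by blast
    then show ?thesis
    proof cases
      case 1
      then show ?thesis using 2 mh by (auto simp: f_def)
    next
      case c: 2
      have "(mate G h, mate G k) \<in> R'"
        using m'[of "mate G h"] mh by (simp add: mate_cut)
      then show ?thesis using 2 c mh by (auto simp: f_def)
    next
      case 3
      then have "y = mate G h" using 2 tidyD(1)[OF tidy] by metis
      then show ?thesis using 3 mh by (auto simp: f_def)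
    next
      case 4
      then have y: "y = mate G k" using 2 tidyD(1)[OF tidy] by metis
      have "(mate G k, mate G h) \<in> R'"
        using m'[of "mate G k"] mh by (simp add: mate_cut)
      then show ?thesis using 4 y mh by (auto simp: f_def)
    next
      case 5
      have "mate (cut h k G) y = z" using 5 2 by (auto simp: mate_cut'[OF tidy])
      then have "(y, z) \<in> R'" using m'[of y] 5 2 by auto
      then show ?thesis using 5 by (auto simp: f_def)
    qed
  qed
  then show ?case using step by (meson rtrancl_trans)
qed simp

text \<open>Here \<open>h\<close> and \<open>k\<close> form a whole chain by themselves, so no chain
  starting elsewhere can enter it.\<close>

lemma chain_cut_closed:
  assumes e: "mate G h = k"
  shows "(x, y) \<in> R\<^sup>* \<Longrightarrow> x \<in> D' \<Longrightarrow> y \<in> D' \<and> (x, y) \<in> R'\<^sup>*"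
proof (induction rule: rtrancl_induct)
  case (step y z)
  then have y: "y \<in> D'" "(x, y) \<in> R'\<^sup>*" by auto
  have mk: "mate G k = h" using tidy_swap[OF tidy e] .
  consider "y \<in> Y" "z = j y" | "z = mate G y"
    using step(2) unfolding step_rel_def by auto
  then have "z \<in> D' \<and> (y, z) \<in> R'"
  proof cases
    case 1
    have "z \<in> Y - {h, k}" unfolding 1(2) using y by (intro j_other[OF 1(1)]) auto
    then show ?thesis using 1 y pairing unfolding step_rel_def pairing_def by auto
  next
    case 2
    have n: "mate G y \<noteq> h" "mate G y \<noteq> k"
      using y(1) tidy_swap[OF tidy, of y h] tidy_swap[OF tidy, of y k] e mk by auto
    have "mate (cut h k G) y = z" using 2 y n by (auto simp: mate_cut'[OF tidy])
    moreover have "z \<in> hedges G" using step_rel_facts(2)[OF tidy pairing step(2)] .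
    ultimately show ?thesis using 2 y n unfolding step_rel_def by auto
  qed
  then show ?case using y by (meson rtrancl.simps)
qed simp

lemma chain_cut_iff:
  assumes "x \<in> D'" "y \<in> D'"
  shows "(x, y) \<in> R'\<^sup>* \<longleftrightarrow> (x, y) \<in> R\<^sup>*"
proof
  assume xy: "(x, y) \<in> R\<^sup>*"
  show "(x, y) \<in> R'\<^sup>*"
  proof (cases "mate G h = k")
    case True
    then show ?thesis using chain_cut_closed xy assms by blast
  next
    case False
    from chain_cut_open[OF this xy] show ?thesis using assms by auto
  qed
qed (rule chain_cut_subset)

lemma class_cut: "x \<in> D' \<Longrightarrow> R'\<^sup>* `` {x} = R\<^sup>* `` {x} \<inter> D'"
proof -
  assume x: "x \<in> D'"
  have "y \<in> D'" if "(x, y) \<in> R'\<^sup>*" for y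
    using step_rel_rtrancl(1)[OF tidy' pairing' that] x unfolding cut_simps by blast
  then show "R'\<^sup>* `` {x} = R\<^sup>* `` {x} \<inter> D'" using chain_cut_iff[OF x] by blast
qed

text \<open>This matches the circle counter of \<open>cut\<close>. If \<open>h\<close> and
  \<open>k\<close> bound one edge, exactly the chain \<open>{h, k}\<close> disappears. Otherwise
  their chain stays nonempty without them, and chains before and after correspond by intersection
  with \<open>D'\<close>.\<close>

lemma card_closed_chains:
  assumes "finite (hedges G)"
  shows "card (closed_chains G Y j)
    = card (closed_chains (cut h k G) (Y - {h, k}) j) + (if mate G h = k then 1 else 0)"
proof (cases "mate G h = k")
  case True
  have mk: "mate G k = h" using tidy_swap[OF tidy True] .
  have hkR: "(h, k) \<in> R" using h hk unfolding step_rel_def by auto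
  have "R\<^sup>* `` {h} = {h, k}"
  proof -
    have "y \<in> {h, k}" if "(h, y) \<in> R\<^sup>*" for y
      using chain_cut_closed[OF True step_rel_rtrancl(2)[OF tidy pairing that]]
        step_rel_rtrancl(1)[OF tidy pairing that] hk by blast
    then show ?thesis using hkR by auto
  qed
  moreover have "R\<^sup>* `` {k} = R\<^sup>* `` {h}"
    using step_rel_class[OF tidy pairing r_into_rtrancl[OF hkR]] by simp
  moreover have "R\<^sup>* `` {x} = R'\<^sup>* `` {x}" if "x \<in> D'" for x
    using class_cut[OF that] chain_cut_closed[OF True _ that] by auto
  moreover have "hedges G // R\<^sup>* = (\<lambda>x. R\<^sup>* `` {x}) ` (insert h (insert k D'))"
    using hk by (auto simp: quotient_def)
  ultimately have q: "hedges G // R\<^sup>* = insert {h, k} (hedges (cut h k G) // R'\<^sup>*)"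
    by (auto simp: quotient_def image_iff)
  have sub: "C \<subseteq> D'" if "C \<in> hedges (cut h k G) // R'\<^sup>*" for C
    using that class_cut by (auto simp: quotient_def)
  then have "closed_chains G Y j = insert {h, k} (closed_chains (cut h k G) (Y - {h, k}) j)"
    unfolding closed_chains_def q using h hk by auto
  moreover have "{h, k} \<notin> closed_chains (cut h k G) (Y - {h, k}) j"
    unfolding closed_chains_def by auto
  moreover have "finite (closed_chains (cut h k G) (Y - {h, k}) j)"
    using assms unfolding closed_chains_def by (auto simp: quotient_def)
  ultimately show ?thesis using True by simp
next
  case False
  let ?F = "\<lambda>C. C \<inter> D'"
  have mh: "mate G h \<in> D'" using False mate_hk by simp
  have hm: "(h, mate G h) \<in> R" "(h, k) \<in> R" using hk h unfolding step_rel_def by auto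
  \<comment> \<open>Each chain has a representative other than \<open>h\<close> and
    \<open>k\<close>, as \<open>mate G h\<close> can stand in for both; so it is determined by its
    part in \<open>D'\<close>.\<close>
  have rep: "\<exists>x\<in>D'. C = R\<^sup>* `` {x}" if C: "C \<in> hedges G // R\<^sup>*" for C
  proof -
    obtain x where x: "x \<in> hedges G" "C = R\<^sup>* `` {x}" using C by (auto simp: quotient_def)
    have "R\<^sup>* `` {h} = R\<^sup>* `` {mate G h}" "R\<^sup>* `` {h} = R\<^sup>* `` {k}"
      using step_rel_class[OF tidy pairing] hm by blast+
    then show ?thesis using x mh by (cases "x \<in> {h, k}") auto
  qed
  have "inj_on ?F (closed_chains G Y j)"
  proof (rule inj_onI)
    fix C1 C2 assume C: "C1 \<in> closed_chains G Y j" "C2 \<in> closed_chains G Y j" "C1 \<inter> D' = C2 \<inter> D'"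
    have q: "C1 \<in> hedges G // R\<^sup>*" "C2 \<in> hedges G // R\<^sup>*"
      using C unfolding closed_chains_def by simp_all
    obtain x where x: "x \<in> D'" "C1 = R\<^sup>* `` {x}" using rep[OF q(1)] by (elim bexE)
    obtain y where y: "y \<in> D'" "C2 = R\<^sup>* `` {y}" using rep[OF q(2)] by (elim bexE)
    have "x \<in> C1" using x by simp
    then have "x \<in> C1 \<inter> D'" using x(1) by (rule IntI)
    then have "(y, x) \<in> R\<^sup>*" unfolding C(3) y(2) by simp
    from step_rel_class[OF tidy pairing this] show "C1 = C2" unfolding x(2) y(2) by (rule sym)
  qed
  moreover have "?F ` closed_chains G Y j = closed_chains (cut h k G) (Y - {h, k}) j"
  proof -
    have sub: "R\<^sup>* `` {x} \<subseteq> hedges G" if "x \<in> hedges G" for x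
      using step_rel_rtrancl(1)[OF tidy pairing] that by auto
    have "C \<inter> D' \<in> closed_chains (cut h k G) (Y - {h, k}) j" if C: "C \<in> closed_chains G Y j" for C
    proof -
      have "C \<in> hedges G // R\<^sup>*" using C unfolding closed_chains_def by simp
      from rep[OF this] obtain x where x: "x \<in> D'" "C = R\<^sup>* `` {x}" by (elim bexE)
      then have "C \<inter> D' = R'\<^sup>* `` {x}" using class_cut by auto
      then have "C \<inter> D' \<in> hedges (cut h k G) // R'\<^sup>*" using x by (auto simp: quotient_def)
      then show ?thesis using C unfolding closed_chains_def by auto
    qed
    moreover have "C' \<in> ?F ` closed_chains G Y j"
      if C': "C' \<in> closed_chains (cut h k G) (Y - {h, k}) j" for C'
    proof -
      obtain x where x: "x \<in> D'" "C' = R'\<^sup>* `` {x}"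
        using C' by (auto simp: closed_chains_def quotient_def)
      then have e: "C' = R\<^sup>* `` {x} \<inter> D'" using class_cut by auto
      moreover have "R\<^sup>* `` {x} \<subseteq> Y"
        using sub[of x] x C' h hk unfolding e closed_chains_def by auto
      moreover have "R\<^sup>* `` {x} \<in> hedges G // R\<^sup>*" using x by (auto simp: quotient_def)
      ultimately show ?thesis unfolding closed_chains_def by auto
    qed
    ultimately show ?thesis by blast
  qed
  ultimately show ?thesis using False card_image by fastforce
qed

end

text \<open>The edges and circles of \<open>splice\<close>, with the vertices kept and
  \<open>mate\<close> made the identity off the surviving half-edges, so that results can be
  compared with cuts as records.\<close>

definition glue :: "fgraph \<Rightarrow> nat set \<Rightarrow> (nat \<Rightarrow> nat) \<Rightarrow> fgraph" where
  "glue G Y j = G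
     \<lparr>hedges := hedges G - Y,
      mate := (\<lambda>x. if x \<in> hedges G - Y
        then THE y. y \<in> hedges G - Y \<and> y \<noteq> x \<and> (x, y) \<in> (step_rel G Y j)\<^sup>* else x),
      circles := circles G + card (closed_chains G Y j)\<rparr>"

lemma mate_glue: "mate (glue G Y j) x = (if x \<in> hedges G - Y
    then THE y. y \<in> hedges G - Y \<and> y \<noteq> x \<and> (x, y) \<in> (step_rel G Y j)\<^sup>* else x)"
  by (simp add: glue_def)

text \<open>Cutting out one pair preserves the chains between survivors, and a chain consisting of
  that pair alone is counted as a circle by \<open>cut\<close> instead. Repeated, this turns a
  splice into a sequence of cuts.\<close>

lemma glue_cut:
  assumes "tidy G" "finite (hedges G)" "pairing G Y j" "h \<in> Y"
  shows "glue G Y j = glue (cut h (j h) G) (Y - {h, j h}) j"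
proof (rule fgraph_eqI)
  let ?k = "j h"
  have s: "hedges (cut h ?k G) - (Y - {h, ?k}) = hedges G - Y"
    using assms unfolding pairing_def by auto
  then show "hedges (glue G Y j) = hedges (glue (cut h (j h) G) (Y - {h, j h}) j)"
    by (simp add: glue_def)
  have "(x, y) \<in> (step_rel (cut h ?k G) (Y - {h, ?k}) j)\<^sup>* \<longleftrightarrow> (x, y) \<in> (step_rel G Y j)\<^sup>*"
    if "x \<in> hedges G - Y" "y \<in> hedges G - Y" for x y
    using that assms(3,4) by (intro cut_pair.chain_cut_iff[OF cut_pair.intro[OF assms(1,3,4) refl]]) (auto simp: pairing_def)
  then have "(y \<in> hedges G - Y \<and> y \<noteq> x \<and> (x, y) \<in> (step_rel G Y j)\<^sup>*) \<longleftrightarrow>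
      (y \<in> hedges G - Y \<and> y \<noteq> x \<and> (x, y) \<in> (step_rel (cut h ?k G) (Y - {h, ?k}) j)\<^sup>*)"
    if "x \<in> hedges G - Y" for x y
    using that by blast
  then show "mate (glue G Y j) x = mate (glue (cut h (j h) G) (Y - {h, j h}) j) x" for x
    unfolding mate_glue s by (cases "x \<in> hedges G - Y") auto
  show "circles (glue G Y j) = circles (glue (cut h (j h) G) (Y - {h, j h}) j)"
    using cut_pair.card_closed_chains[OF cut_pair.intro[OF assms(1,3,4) refl] assms(2)] by (simp add: glue_def)
qed (simp_all add: glue_def)

text \<open>With nothing left to glue, a chain is just the two ends of an edge, so the definite
  description returns the mate.\<close>

lemma glue_empty:
  assumes "tidy G"
  shows "glue G {} j = G"
proof (rule fgraph_eqI)
  have p: "pairing G {} j" by (simp add: pairing_def)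
  have e: "y = x \<or> y = mate G x" if "(x, y) \<in> (step_rel G {} j)\<^sup>*" for x y
    using that by (induction) (auto simp: step_rel_def tidyD(1)[OF assms])
  have "(THE y. y \<in> hedges G \<and> y \<noteq> x \<and> (x, y) \<in> (step_rel G {} j)\<^sup>*) = mate G x"
    if "x \<in> hedges G" for x
  proof (rule the_equality)
    have "(x, mate G x) \<in> step_rel G {} j" using that by (simp add: step_rel_def)
    then show "mate G x \<in> hedges G \<and> mate G x \<noteq> x \<and> (x, mate G x) \<in> (step_rel G {} j)\<^sup>*"
      using that tidyD(1,2)[OF assms] by auto
  qed (use e in blast)
  then show "mate (glue G {} j) x = mate G x" for x
    using tidyD(2)[OF assms, of x] by (auto simp: glue_def)
  have "closed_chains G {} j = {}" unfolding closed_chains_def by (auto simp: quotient_def)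
  then show "circles (glue G {} j) = circles G" by (simp add: glue_def)
qed (simp_all add: glue_def)

section \<open>Moves and tidied graphs\<close>

definition tidied :: "fgraph \<Rightarrow> fgraph" where
  "tidied G = G\<lparr>mate := (\<lambda>h. if h \<in> hedges G then mate G h else h)\<rparr>"

lemma tidied_simps [simp]:
  "verts (tidied G) = verts G" "hedges (tidied G) = hedges G" "vert (tidied G) = vert G"
  "opp (tidied G) = opp G" "circles (tidied G) = circles G"
  "mate (tidied G) h = (if h \<in> hedges G then mate G h else h)"
  by (simp_all add: tidied_def)

lemma framed4D:
  assumes "framed4 G"
  shows "h \<in> hedges G \<Longrightarrow> vert G h \<in> verts G"
    and "h \<in> hedges G \<Longrightarrow> opp G h \<in> hedges G"
    and "h \<in> hedges G \<Longrightarrow> opp G h \<noteq> h"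
    and "h \<in> hedges G \<Longrightarrow> opp G (opp G h) = h"
    and "h \<in> hedges G \<Longrightarrow> vert G (opp G h) = vert G h"
    and "h \<in> hedges G \<Longrightarrow> mate G h \<in> hedges G"
    and "h \<in> hedges G \<Longrightarrow> mate G h \<noteq> h"
    and "h \<in> hedges G \<Longrightarrow> mate G (mate G h) = h"
  using assms unfolding framed4_def by auto

lemma regular_tidied_iff: "regular (tidied G) \<longleftrightarrow> framed4 G"
proof
  assume "framed4 G"
  note f = framed4D(6-8)[OF this]
  have "framed4 (tidied G)" using \<open>framed4 G\<close> unfolding framed4_def by simp
  moreover have "tidy (tidied G)" using f by (auto simp: tidy_def)
  ultimately show "regular (tidied G)" by (simp add: regular_def)
next
  assume "regular (tidied G)"
  then have f: "framed4 (tidied G)" by (simp add: regular_def)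
  have "mate G h \<in> hedges G \<and> mate G h \<noteq> h \<and> mate G (mate G h) = h" if "h \<in> hedges G" for h
    using framed4D(6-8)[OF f, of h] that by simp
  then show "framed4 G" using f unfolding framed4_def by simp
qed

lemma finite_hedges:
  assumes "framed4 G"
  shows "finite (hedges G)"
proof -
  have "hedges G \<subseteq> (\<Union>v\<in>verts G. {h \<in> hedges G. vert G h = v})"
    using framed4D(1)[OF assms] by auto
  moreover have "finite {h \<in> hedges G. vert G h = v}" if "v \<in> verts G" for v
    using assms that unfolding framed4_def by (metis card.infinite zero_neq_numeral)
  moreover have "finite (verts G)" using assms unfolding framed4_def by blast
  ultimately show ?thesis by (meson finite_UN_I finite_subset)
qed

lemma tidied_splice:
  assumes "framed4 G"
  shows "tidied (splice G X j) = (glue (tidied G) (hedges_at G X) j)\<lparr>verts := verts G - X\<rparr>"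
proof -
  have e: "(step_rel (tidied G) (hedges_at G X) j)\<^sup>* = joined G X j"
    unfolding joined_def step_rel_def by (rule arg_cong[of _ _ rtrancl]) auto
  show ?thesis
    by (rule fgraph_eqI) (auto simp: splice_def glue_def closed_chains_def e)
qed

lemma glue_res:
  assumes "tidy G" "finite (hedges G)" "pairing G Y j" "{a, c} \<subseteq> Y" "j a = b" "j c = d"
    "distinct [a, b, c, d]"
  shows "glue G Y j = glue (cut a b (cut c d G)) (Y - {a, b, c, d}) j"
proof -
  have c: "c \<in> Y" "a \<in> Y - {c, j c}" using assms by auto
  have h: "c \<in> hedges G" "d \<in> hedges G" using assms(3,4,6) unfolding pairing_def by auto
  have "glue G Y j = glue (cut c d G) (Y - {c, d}) j"
    using glue_cut[OF assms(1-3) c(1)] assms(6) by simp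
  also have "\<dots> = glue (cut a b (cut c d G)) (Y - {c, d} - {a, b}) j"
    using glue_cut[of "cut c d G" "Y - {c, d}" j a] pairing_cut[OF assms(3) c(1)] c(2) assms h
    by (auto simp: tidy_cut)
  also have "Y - {c, d} - {a, b} = Y - {a, b, c, d}" by auto
  finally show ?thesis .
qed

lemma pairing_opp:
  assumes "framed4 G"
  shows "pairing (tidied G) (hedges_at G X) (opp G)" "pairing (tidied G) (hedges G) (opp G)"
  using framed4D(2-5)[OF assms] unfolding pairing_def hedges_at_def by auto

lemma tidied_remove_vert:
  assumes "framed4 G" "frame (tidied G) v a b"
  shows "tidied (remove_verts G {v}) = unvert a b (tidied G)"
proof -
  have r: "regular (tidied G)" using assms(1) regular_tidied_iff by blast
  note d = frame_distinct[OF r assms(2), simplified]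
  have Y: "hedges_at G {v} = {a, b, opp G a, opp G b}"
    using frame_hedges[OF r assms(2)] by (simp add: hedges_at_def)
  have "glue (tidied G) (hedges_at G {v}) (opp G)
      = glue (cut a (opp G a) (cut b (opp G b) (tidied G))) (hedges_at G {v} - {a, opp G a, b, opp G b}) (opp G)"
    using d finite_hedges[OF assms(1)]
    by (intro glue_res regularD(1)[OF r] pairing_opp assms(1)) (auto simp: Y)
  also have "\<dots> = cut a (opp G a) (cut b (opp G b) (tidied G))"
  proof -
    have "hedges_at G {v} - {a, opp G a, b, opp G b} = {}" by (auto simp: Y)
    moreover have "tidy (cut a (opp G a) (cut b (opp G b) (tidied G)))"
      using d regularD(1)[OF r] by (auto intro!: tidy_cut)
    ultimately show ?thesis by (simp only: glue_empty)
  qed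
  finally show ?thesis
    using d unfolding remove_verts_def tidied_splice[OF assms(1)]
    by (simp add: unvert_def res_def drop_vert_def)
qed

lemma tidied_remove_bigon:
  assumes "framed4 G" "bigon_at (tidied G) a b"
  shows "tidied (remove_verts G {vert G a, vert G (mate G a)}) = unbigon a b (tidied G)"
proof -
  have r: "regular (tidied G)" using assms(1) regular_tidied_iff by blast
  define c where "c = mate (tidied G) a"
  define d where "d = mate (tidied G) b"
  let ?G = "tidied G"
  let ?A = "opp G a" and ?B = "opp G b" and ?C = "opp G c" and ?D = "opp G d"
  let ?X = "{vert G a, vert G (mate G a)}"
  note b = bigon_atD[OF assms(2), folded c_def d_def]
  have vc: "vert G c = vert G (mate G a)" using b(6) by (simp add: c_def)
  note d1 = frame_distinct[OF r b(1)]
  note d2 = frame_distinct[OF r b(2)]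
  have disj: "{a, b, ?A, ?B} \<inter> {c, d, ?C, ?D} = {}"
    using d1(5-8) d2(5-8) b(3) unfolding tidied_simps(3,4) by auto
  have dist: "distinct ([a, b, ?A, ?B] @ [c, d, ?C, ?D])"
    unfolding distinct_append using d1(1) d2(1) disj unfolding tidied_simps(4) by simp
  have sub: "set ([a, b, ?A, ?B] @ [c, d, ?C, ?D]) \<subseteq> hedges G"
    using d1(2) d2(2) unfolding tidied_simps(2,4) by simp
  have "hedges_at G ?X = {h \<in> hedges G. vert G h = vert G a} \<union> {h \<in> hedges G. vert G h = vert G c}"
    unfolding hedges_at_def vc by auto
  also have "{h \<in> hedges G. vert G h = vert G a} = {a, b, ?A, ?B}"
    using frame_hedges[OF r b(1)] by simp
  also have "{h \<in> hedges G. vert G h = vert G c} = {c, d, ?C, ?D}"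
    using frame_hedges[OF r b(2)] by simp
  finally have Y: "hedges_at G ?X = {a, b, ?A, ?B} \<union> {c, d, ?C, ?D}" .
  let ?H = "cut a ?A (cut b ?B ?G)"
  have H: "tidy ?H" "hedges ?H = hedges G - {a, b, ?A, ?B}"
    using dist sub regularD(1)[OF r] by (auto intro!: tidy_cut)
  have mem: "{c, d, ?C, ?D} \<subseteq> hedges ?H"
    unfolding H(2) using dist sub by auto
  have "glue ?G (hedges_at G ?X) (opp G) = glue ?H (hedges_at G ?X - {a, ?A, b, ?B}) (opp G)"
    using dist finite_hedges[OF assms(1)]
    by (intro glue_res regularD(1)[OF r] pairing_opp assms(1)) (auto simp: Y)
  also have "hedges_at G ?X - {a, ?A, b, ?B} = {c, d, ?C, ?D}"
    unfolding Y using disj by blast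
  also have "glue ?H {c, d, ?C, ?D} (opp G)
      = glue (cut c ?C (cut d ?D ?H)) ({c, d, ?C, ?D} - {c, ?C, d, ?D}) (opp G)"
  proof (rule glue_res[OF H(1)])
    show "pairing ?H {c, d, ?C, ?D} (opp G)"
      using mem d2(1-4) unfolding pairing_def tidied_simps by auto
    show "finite (hedges ?H)" using finite_hedges[OF assms(1)] by simp
  qed (use d2(1) in auto)
  also have "{c, d, ?C, ?D} - {c, ?C, d, ?D} = {}" by blast
  also have "glue (cut c ?C (cut d ?D ?H)) {} (opp G) = cut c ?C (cut d ?D ?H)"
  proof (intro glue_empty tidy_cut[of _ c] tidy_cut[OF H(1)])
    show "c \<in> hedges (cut d ?D ?H)" "?C \<in> hedges (cut d ?D ?H)"
      using mem d2(1) unfolding cut_simps(2)[of d] tidied_simps by auto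
  qed (use mem d2(1) in auto)
  finally have g: "glue ?G (hedges_at G ?X) (opp G) = cut c ?C (cut d ?D ?H)" .
  show ?thesis
    unfolding remove_verts_def tidied_splice[OF assms(1)] g unbigon_def unvert_def res_def
      c_def[symmetric] d_def[symmetric]
    by (intro fgraph_eqI) (auto simp: vc)
qed

section \<open>The number of unicursal components and its invariance\<close>

definition through :: "fgraph \<Rightarrow> nat" where
  "through G = circles G + card (closed_chains G (hedges G) (opp G))"

lemma unicursal_components_tidied:
  assumes "framed4 G"
  shows "unicursal_components G = through (tidied G)"
proof -
  have r: "tidy (tidied G)" using regular_tidied_iff assms regularD(1) by blast
  have e: "(step_rel (tidied G) (hedges G) (opp G))\<^sup>*
      = {(x, y). x \<in> hedges G \<and> (y = mate G x \<or> y = opp G x)}\<^sup>*"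
    unfolding step_rel_def by (rule arg_cong[of _ _ rtrancl]) auto
  have "C \<subseteq> hedges G" if "C \<in> hedges G // (step_rel (tidied G) (hedges G) (opp G))\<^sup>*" for C
    using that step_rel_rtrancl(1)[OF r pairing_opp(2)[OF assms]] by (auto simp: quotient_def)
  then show ?thesis
    unfolding unicursal_components_def through_def closed_chains_def by (auto simp: e intro!: arg_cong[of _ _ card])
qed

text \<open>Unicursal components are the circles that gluing all half-edges along \<open>opp\<close>
  would produce. Doing one of these gluings in advance changes nothing: a closed chain lost in this
  way reappears as a circle.\<close>

lemma through_cut:
  assumes "tidy G" "finite (hedges G)" "pairing G (hedges G) (opp G)" "h \<in> hedges G"
  shows "through (cut h (opp G h) G) = through G"
  using cut_pair.card_closed_chains[OF cut_pair.intro[OF assms(1,3,4) refl] assms(2)] by (simp add: through_def)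

lemma through_unvert:
  assumes "regular G" "frame G v a b"
  shows "through (unvert a b G) = through G"
proof -
  note d = frame_distinct[OF assms]
  have fin: "finite (hedges G)" using finite_hedges regularD(2)[OF assms(1)] .
  have p: "pairing G (hedges G) (opp G)" using regularD(5-7)[OF assms(1)] by (simp add: pairing_def)
  let ?H = "cut b (opp G b) G"
  have H: "tidy ?H" "pairing ?H (hedges ?H) (opp ?H)"
    using d regularD(1)[OF assms(1)] pairing_cut[OF p, of b] by (auto intro!: tidy_cut)
  have "through (unvert a b G) = through (cut a (opp ?H a) ?H)"
    by (simp add: unvert_def res_def through_def closed_chains_def step_rel_def)
  also have "\<dots> = through ?H" using d fin by (intro through_cut H) auto
  also have "\<dots> = through G" using d fin p by (intro through_cut regularD(1)[OF assms(1)]) auto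
  finally show ?thesis .
qed

text \<open>Strands are determined by \<open>mate\<close> and \<open>opp\<close>, so compatibility
  with these suffices. In this form the lemma also covers \<open>swap\<close>, which moves
  half-edges between vertices.\<close>

lemma through_mate_iso:
  assumes "mate_iso \<psi> G G'" "\<And>h. h \<in> hedges G \<Longrightarrow> opp G h \<in> hedges G \<and> opp G' (\<psi> h) = \<psi> (opp G h)"
  shows "through G' = through G"
proof -
  let ?R = "step_rel G (hedges G) (opp G)" and ?R' = "step_rel G' (hedges G') (opp G')"
  have b: "inj_on \<psi> (hedges G)" "\<psi> ` hedges G = hedges G'" and c: "circles G' = circles G"
    and m: "\<And>h. h \<in> hedges G \<Longrightarrow> mate G h \<in> hedges G \<and> mate G' (\<psi> h) = \<psi> (mate G h)"
    using assms(1) unfolding mate_iso_def bij_betw_def by auto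
  have sub: "y \<in> hedges G" if "(x, y) \<in> ?R\<^sup>*" "x \<in> hedges G" for x y
    using that(1) by (induction) (use that m assms(2) in \<open>auto simp: step_rel_def\<close>)
  have 1: "(\<psi> x, \<psi> y) \<in> ?R'\<^sup>*" if "(x, y) \<in> ?R\<^sup>*" "x \<in> hedges G" for x y
    using that(1)
  proof (induction)
    case (step y z)
    have "y \<in> hedges G" using sub step(1) that(2) by blast
    then have "(\<psi> y, \<psi> z) \<in> ?R'" using step(2) b(2) m assms(2) unfolding step_rel_def by auto
    then show ?case using step(3) by (rule rtrancl_into_rtrancl[rotated])
  qed simp
  have 2: "\<exists>y. y' = \<psi> y \<and> (x, y) \<in> ?R\<^sup>*" if "(\<psi> x, y') \<in> ?R'\<^sup>*" "x \<in> hedges G" for x y'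
    using that(1)
  proof (induction)
    case (step y' z')
    then obtain y where y: "y' = \<psi> y" "(x, y) \<in> ?R\<^sup>*" by blast
    have "y \<in> hedges G" using sub y(2) that(2) by blast
    then obtain z where "z' = \<psi> z" "(y, z) \<in> ?R"
      using step(2) m assms(2) unfolding y(1) step_rel_def by auto
    then show ?case using rtrancl_into_rtrancl[OF y(2)] by blast
  qed blast
  have cl: "?R'\<^sup>* `` {\<psi> x} = \<psi> ` (?R\<^sup>* `` {x})" if "x \<in> hedges G" for x
    using 1[OF _ that] 2[OF _ that] by blast
  have q: "closed_chains H (hedges H) (opp H) = hedges H // (step_rel H (hedges H) (opp H))\<^sup>*"
    if "\<And>x y. (x, y) \<in> (step_rel H (hedges H) (opp H))\<^sup>* \<Longrightarrow> x \<in> hedges H \<Longrightarrow> y \<in> hedges H" for H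
    unfolding closed_chains_def using that by (auto simp: quotient_def)
  have sub': "y \<in> hedges G'" if "(x, y) \<in> ?R'\<^sup>*" "x \<in> hedges G'" for x y
  proof -
    note xy = that
    obtain z where z: "z \<in> hedges G" "x = \<psi> z" using xy(2) b(2) by blast
    then show ?thesis using 2[of z y] xy(1) sub b(2) by blast
  qed
  have "hedges G' // ?R'\<^sup>* = (\<lambda>x. ?R'\<^sup>* `` {x}) ` \<psi> ` hedges G"
    unfolding b(2) by (auto simp: quotient_def)
  also have "\<dots> = (\<lambda>x. \<psi> ` (?R\<^sup>* `` {x})) ` hedges G"
    unfolding image_image using cl by (rule image_cong[OF refl])
  also have "\<dots> = (`) \<psi> ` (hedges G // ?R\<^sup>*)"
    by (auto simp: quotient_def)
  finally have "hedges G' // ?R'\<^sup>* = (`) \<psi> ` (hedges G // ?R\<^sup>*)" .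
  moreover have "inj_on ((`) \<psi>) (hedges G // ?R\<^sup>*)"
  proof (rule inj_on_subset[OF inj_on_image_Pow[OF b(1)]])
    show "hedges G // ?R\<^sup>* \<subseteq> Pow (hedges G)" using sub by (auto simp: quotient_def)
  qed
  moreover have "closed_chains G (hedges G) (opp G) = hedges G // ?R\<^sup>*"
    using sub by (rule q)
  moreover have "closed_chains G' (hedges G') (opp G') = hedges G' // ?R'\<^sup>*"
    using sub' by (rule q)
  ultimately show ?thesis
    unfolding through_def c by (simp add: card_image)
qed

lemma unicursal_through: "framed4 G \<Longrightarrow> unicursal G \<longleftrightarrow> through (tidied G) = 1"
  by (simp add: unicursal_def unicursal_components_tidied)

lemma isomorphism_tidied:
  "framed4 G \<Longrightarrow> isomorphism \<phi> \<psi> G G' \<Longrightarrow> isomorphism \<phi> \<psi> (tidied G) (tidied G')"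
  unfolding isomorphism_def by (auto dest: bij_betwE)

lemma isomorphism_unicursal:
  assumes "isomorphism \<phi> \<psi> G G'" "framed4 G" "framed4 G'"
  shows "unicursal G' \<longleftrightarrow> unicursal G"
proof -
  note i = isomorphism_tidied[OF assms(2,1)]
  have "mate_iso \<psi> (tidied G) (tidied G')"
    using i framed4D(6)[OF assms(2)] unfolding isomorphism_def mate_iso_def by auto
  then have "through (tidied G') = through (tidied G)"
    using i framed4D(2)[OF assms(2)] unfolding isomorphism_def by (intro through_mate_iso) auto
  then show ?thesis using assms by (simp add: unicursal_through)
qed

section \<open>Loops, bigons and triangles in tidied graphs\<close>

lemma loop_at_frame:
  assumes "framed4 G" "loop_at G v"
  shows "\<exists>a. frame (tidied G) v a (mate G a) \<and> a \<in> hedges G"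
proof -
  obtain a where "a \<in> hedges G" "vert G a = v" "vert G (mate G a) = v" "mate G a \<noteq> opp G a"
    using assms(2) unfolding loop_at_def by blast
  then show ?thesis using framed4D(6,7)[OF assms(1)] unfolding frame_def
    by (intro exI[of _ a]) (simp, metis)
qed

lemma bigon_bigon_at:
  assumes "framed4 G" "bigon G u v"
  shows "\<exists>a b. bigon_at (tidied G) a b \<and> vert G a = u \<and> vert G (mate G a) = v \<and> a \<in> hedges G"
proof -
  obtain a b where ab: "u \<noteq> v" "a \<in> hedges G" "b \<in> hedges G" "a \<noteq> b" "vert G a = u" "vert G b = u"
    "vert G (mate G a) = v" "vert G (mate G b) = v" "b \<noteq> opp G a" "mate G b \<noteq> opp G (mate G a)"
    using assms(2) unfolding bigon_def by blast
  have "mate G a \<in> hedges G" "mate G b \<in> hedges G" "mate G a \<noteq> mate G b"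
    using framed4D(6,8)[OF assms(1)] ab by metis+
  then have "bigon_at (tidied G) a b" using ab unfolding bigon_at_def frame_def by auto
  then show ?thesis using ab by blast
qed

lemma bigon_at_bigon:
  assumes "framed4 G" "bigon_at (tidied G) a b"
  shows "\<exists>u v. bigon G u v"
  using bigon_atD[OF assms(2)] assms(2)
  unfolding bigon_def bigon_at_def frame_def by (intro exI[of _ "vert G a"] exI[of _ "vert G (mate G a)"]) auto

lemma triangle_framed_triangle:
  assumes "framed4 G" "triangle G a b c"
  shows "framed_triangle (tidied G) (vert G a) (vert G b) (vert G c)
    a (mate G a) b (mate G b) c (mate G c)"
proof
  have t: "a \<in> hedges G" "b \<in> hedges G" "c \<in> hedges G" "vert G a \<noteq> vert G b" "vert G a \<noteq> vert G c"
    "vert G b \<noteq> vert G c" "vert G (mate G a) = vert G b" "vert G (mate G b) = vert G c"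
    "vert G (mate G c) = vert G a" "b \<noteq> opp G (mate G a)" "c \<noteq> opp G (mate G b)" "a \<noteq> opp G (mate G c)"
    using assms(2) unfolding triangle_def by auto
  note f = framed4D[OF assms(1)]
  have m: "mate G a \<in> hedges G" "mate G b \<in> hedges G" "mate G c \<in> hedges G" using f(6) t by blast+
  have "mate G c \<noteq> opp G a" "mate G a \<noteq> opp G b" "mate G b \<noteq> opp G c"
    using f(4) m t(1-3,10-12) by metis+
  moreover have "a \<noteq> mate G c" "b \<noteq> mate G a" "c \<noteq> mate G b"
    using f(8)[OF t(1)] f(8)[OF t(2)] f(8)[OF t(3)] t(4-9) by metis+
  ultimately show "frame (tidied G) (vert G a) a (mate G c)" "frame (tidied G) (vert G b) b (mate G a)"
    "frame (tidied G) (vert G c) c (mate G b)"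
    using t m unfolding frame_def by auto
  show "regular (tidied G)" using assms(1) regular_tidied_iff by blast
  show "distinct [vert G a, vert G b, vert G c]" using t by auto
qed (use assms(2) in \<open>auto simp: triangle_def\<close>)

text \<open>On \<open>hedges G\<close> the case distinction of \<open>third_swap\<close> gives
  \<open>swap\<close>: a triangle half-edge goes to the outer one at the other end of its edge, and
  an outer one comes back. Off \<open>hedges G\<close> the two may differ, hence the comparison of
  tidied graphs.\<close>

lemma tidied_third_move:
  assumes "framed4 G" "triangle G a b c"
  shows "tidied (third_move G a b c) = framed_triangle.moved (tidied G)
    a (mate G a) b (mate G b) c (mate G c)"
proof -
  interpret T: framed_triangle "tidied G" "vert G a" "vert G b" "vert G c"
    a "mate G a" b "mate G b" c "mate G c"
    by (rule triangle_framed_triangle[OF assms])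
  let ?T = "{a, mate G a, b, mate G b, c, mate G c}"
  note o = T.opps[unfolded tidied_simps]
  note n = T.ends_neq[unfolded tidied_simps]
  have T: "a \<in> hedges G" "b \<in> hedges G" "c \<in> hedges G" using assms(2) by (auto simp: triangle_def)
  note mm = framed4D(8)[OF assms(1) T(1)] framed4D(8)[OF assms(1) T(2)] framed4D(8)[OF assms(1) T(3)]
  have s: "third_swap G a b c h = T.swap h" if h: "h \<in> hedges G" for h
  proof -
    consider "h \<in> ?T" | "opp G h \<in> ?T" "h \<notin> ?T" | "h \<notin> ?T" "opp G h \<notin> ?T" by blast
    then show ?thesis
    proof cases
      case 1
      then have "third_swap G a b c h = opp G (mate G h)" by (simp add: third_swap_def)
      moreover have "\<forall>h\<in>?T. opp G (mate G h) = T.swap h"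
        by (simp add: T.swap_simps mm)
      then have "opp G (mate G h) = T.swap h" using 1 by (rule bspec)
      ultimately show ?thesis by (rule trans)
    next
      case 2
      then have "third_swap G a b c h = mate G (opp G h)" by (simp add: third_swap_def)
      moreover have "\<forall>h\<in>?T. T.swap (opp G h) = mate G h"
        using T.swap_simps[unfolded tidied_simps] by (simp add: mm)
      moreover have "h = opp G (opp G h)" using framed4D(4)[OF assms(1) h] by simp
      ultimately show ?thesis using 2(1) by metis
    next
      case 3
      then have "third_swap G a b c h = h" by (simp add: third_swap_def)
      moreover have "h \<notin> opp G ` ?T" using 3(2) framed4D(4)[OF assms(1) h] o by auto
      then have "T.swap h = h" using 3(1) by (intro T.swap_other) auto
      ultimately show ?thesis by simp
    qed
  qed
  have "T.swap h \<in> hedges G" if "h \<in> hedges G" for h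
    using T.swap_hedges that by auto
  then have "third_swap G a b c (mate G (third_swap G a b c h)) = mate T.moved h"
    if "h \<in> hedges G" for h
    using s that framed4D(6)[OF assms(1)] by (simp add: T.moved_def)
  moreover have "mate T.moved h = h" if "h \<notin> hedges G" for h
    using tidyD(2)[OF T.tidy_moved, of h] that by simp
  ultimately show ?thesis
    by (intro fgraph_eqI) (auto simp: third_move_def)
qed

section \<open>The parity bracket is invariant\<close>

lemma is_parityD:
  assumes "is_parity P" "unicursal G"
  shows "unicursal G' \<Longrightarrow> isomorphism \<phi> \<psi> G G' \<Longrightarrow> w \<in> verts G \<Longrightarrow> P G' (\<phi> w) = P G w"
    and "loop_at G v \<Longrightarrow> \<not> P G v \<and> (\<forall>w\<in>verts G - {v}. P (remove_verts G {v}) w = P G w)"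
    and "bigon G u v \<Longrightarrow>
      P G u = P G v \<and> (\<forall>w\<in>verts G - {u, v}. P (remove_verts G {u, v}) w = P G w)"
    and "triangle G a b c \<Longrightarrow> even (card {w \<in> {vert G a, vert G b, vert G c}. P G w}) \<and>
      (\<forall>w\<in>verts G. P (third_move G a b c) w = P G w)"
proof -
  note p = assms(1)[unfolded is_parity_def]
  show "unicursal G' \<Longrightarrow> isomorphism \<phi> \<psi> G G' \<Longrightarrow> w \<in> verts G \<Longrightarrow> P G' (\<phi> w) = P G w"
    using p[THEN conjunct1, rule_format, of G G' \<phi> \<psi> w] assms(2) by simp
  show "loop_at G v \<Longrightarrow> \<not> P G v \<and> (\<forall>w\<in>verts G - {v}. P (remove_verts G {v}) w = P G w)"
    using p[THEN conjunct2, THEN conjunct1, THEN spec, THEN spec, of G v] assms(2) by simp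
  show "bigon G u v \<Longrightarrow>
      P G u = P G v \<and> (\<forall>w\<in>verts G - {u, v}. P (remove_verts G {u, v}) w = P G w)"
    using p[THEN conjunct2, THEN conjunct2, THEN conjunct1, THEN spec, THEN spec, THEN spec, of G u v]
      assms(2) by simp
  show "triangle G a b c \<Longrightarrow> even (card {w \<in> {vert G a, vert G b, vert G c}. P G w}) \<and>
      (\<forall>w\<in>verts G. P (third_move G a b c) w = P G w)"
    using p[THEN conjunct2, THEN conjunct2, THEN conjunct2, THEN spec, THEN spec, THEN spec,
        THEN spec, of G a b c] assms(2) by simp
qed

definition even_verts :: "(fgraph \<Rightarrow> nat \<Rightarrow> bool) \<Rightarrow> fgraph \<Rightarrow> nat set" where
  "even_verts P G = {v \<in> verts G. \<not> P G v}"

text \<open>The parity axioms speak about unicursal graphs only, so the bracket is declared false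
  elsewhere; moves preserve unicursality. The sorted list is just some enumeration of the even
  vertices.\<close>

definition parity_bracket :: "(fgraph \<Rightarrow> nat \<Rightarrow> bool) \<Rightarrow> fgraph \<Rightarrow> fgraph \<Rightarrow> bool" where
  "parity_bracket P K G \<longleftrightarrow>
     unicursal G \<and> bracket K (sorted_list_of_set (even_verts P G)) (tidied G)"

lemma framed4_finite_verts: "framed4 G \<Longrightarrow> finite (verts G)"
  unfolding framed4_def by blast

lemma parity_bracket_iff:
  assumes "framed4 G" "distinct L" "set L = even_verts P G"
  shows "parity_bracket P K G \<longleftrightarrow> unicursal G \<and> bracket K L (tidied G)"
proof -
  have "finite (even_verts P G)" "even_verts P G \<subseteq> verts G"
    using framed4_finite_verts[OF assms(1)] by (auto simp: even_verts_def)
  then have "bracket K (sorted_list_of_set (even_verts P G)) (tidied G) = bracket K L (tidied G)"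
    using assms regular_tidied_iff by (intro bracket_perm) auto
  then show ?thesis by (simp add: parity_bracket_def)
qed

lemma even_verts_list:
  assumes "framed4 G"
  obtains L where "distinct L" "set L = even_verts P G"
proof
  have "finite (even_verts P G)"
    using framed4_finite_verts[OF assms] by (simp add: even_verts_def)
  then show "distinct (sorted_list_of_set (even_verts P G))"
    "set (sorted_list_of_set (even_verts P G)) = even_verts P G" by auto
qed

lemma parity_bracket_isomorphic:
  assumes "is_parity P" "isomorphic G G'"
  shows "parity_bracket P K G' \<longleftrightarrow> parity_bracket P K G"
proof -
  obtain \<phi> \<psi> where i: "isomorphism \<phi> \<psi> G G'" and f: "framed4 G" "framed4 G'"
    using assms(2) unfolding isomorphic_def by blast
  note u = isomorphism_unicursal[OF i f]
  have b: "inj_on \<phi> (verts G)" "\<phi> ` verts G = verts G'"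
    using i unfolding isomorphism_def bij_betw_def by auto
  obtain L where L: "distinct L" "set L = even_verts P G" using even_verts_list[OF f(1)] .
  have sub: "set L \<subseteq> verts G" using L by (auto simp: even_verts_def)
  show ?thesis
  proof (cases "unicursal G")
    case True
    have "\<forall>w\<in>verts G. P G' (\<phi> w) = P G w"
      using is_parityD(1)[OF assms(1) True _ i] u True by simp
    then have "even_verts P G' = \<phi> ` even_verts P G"
      unfolding even_verts_def b(2)[symmetric] by auto
    then have "distinct (map \<phi> L)" "set (map \<phi> L) = even_verts P G'"
      using L sub inj_on_subset[OF b(1) sub] by (auto simp: distinct_map)
    moreover have "bracket K (map \<phi> L) (tidied G') = bracket K L (tidied G)"
      using L sub f regular_tidied_iff isomorphism_tidied[OF f(1) i]
      by (intro bracket_isomorphic) auto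
    ultimately show ?thesis
      using parity_bracket_iff[OF f(1) L] parity_bracket_iff[OF f(2)] u by simp
  next
    case False
    then show ?thesis using u by (simp add: parity_bracket_def)
  qed
qed

text \<open>Reductions remove only bigons, so a loop is handled at a smoothed vertex. The parity
  axiom for first moves guarantees this by making the vertex of the loop even.\<close>

lemma parity_bracket_loop:
  assumes "is_parity P" "framed4 G" "loop_at G v" "circles K = 0"
  shows "framed4 (remove_verts G {v})"
    "parity_bracket P K (remove_verts G {v}) \<longleftrightarrow> parity_bracket P K G"
proof -
  let ?G' = "remove_verts G {v}"
  obtain a where a: "frame (tidied G) v a (mate G a)" "a \<in> hedges G"
    using loop_at_frame[OF assms(2,3)] by blast
  have r: "regular (tidied G)" using assms(2) regular_tidied_iff by blast
  note t = tidied_remove_vert[OF assms(2) a(1)]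
  show f: "framed4 ?G'"
    using regular_unvert[OF r a(1)] unfolding t[symmetric] regular_tidied_iff .
  have u: "unicursal ?G' \<longleftrightarrow> unicursal G"
    using through_unvert[OF r a(1)] by (simp add: unicursal_through f assms(2) t)
  show "parity_bracket P K ?G' \<longleftrightarrow> parity_bracket P K G"
  proof (cases "unicursal G")
    case True
    have v: "verts ?G' = verts G - {v}" by (simp add: remove_verts_def splice_def)
    have vG: "v \<in> verts G" using frame_distinct(9)[OF r a(1)] by simp
    have p: "\<not> P G v" "\<forall>w\<in>verts G - {v}. P ?G' w = P G w"
      using is_parityD(2)[OF assms(1) True assms(3)] by simp_all
    have e: "even_verts P G = insert v (even_verts P ?G')" "v \<notin> even_verts P ?G'"
      using p v vG by (auto simp: even_verts_def)
    obtain L where L: "distinct L" "set L = even_verts P ?G'" using even_verts_list[OF f] .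
    have vL: "distinct (v # L)" "set (v # L) = even_verts P G" using L e by auto
    have "bracket K (v # L) (tidied G) = bracket K L (unvert a (mate G a) (tidied G))"
      using vL a(2) assms(4) by (intro bracket_loop[OF r a(1)]) (auto simp: even_verts_def)
    then show ?thesis
      using parity_bracket_iff[OF assms(2) vL] parity_bracket_iff[OF f L] u t by simp
  next
    case False
    then show ?thesis using u by (simp add: parity_bracket_def)
  qed
qed

lemma parity_bracket_bigon:
  assumes "is_parity P" "framed4 G" "bigon G u v"
    and K: "regular K" "\<And>x y. \<not> bigon_at K x y" "circles K = 0"
  shows "framed4 (remove_verts G {u, v})"
    "parity_bracket P K (remove_verts G {u, v}) \<longleftrightarrow> parity_bracket P K G"
proof -
  let ?G' = "remove_verts G {u, v}"
  obtain a b where a: "bigon_at (tidied G) a b" "vert G a = u" "vert G (mate G a) = v" "a \<in> hedges G"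
    using bigon_bigon_at[OF assms(2,3)] by blast
  have r: "regular (tidied G)" using assms(2) regular_tidied_iff by blast
  have t: "tidied ?G' = unbigon a b (tidied G)"
    using tidied_remove_bigon[OF assms(2) a(1)] a by simp
  show f: "framed4 ?G'"
    using regular_unbigon[OF r a(1)] unfolding t[symmetric] regular_tidied_iff .
  have "through (unbigon a b (tidied G)) = through (tidied G)"
    unfolding unbigon_def
    using through_unvert[OF regular_unvert[OF r bigon_atD(1)[OF a(1)]] frame_unvert_bigon[OF r a(1)]]
      through_unvert[OF r bigon_atD(1)[OF a(1)]] by simp
  then have u: "unicursal ?G' \<longleftrightarrow> unicursal G"
    by (simp add: unicursal_through f assms(2) t)
  show "parity_bracket P K ?G' \<longleftrightarrow> parity_bracket P K G"
  proof (cases "unicursal G")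
    case True
    have v: "verts ?G' = verts G - {u, v}" by (simp add: remove_verts_def splice_def)
    have p: "P G u = P G v" "\<forall>w\<in>verts G - {u, v}. P ?G' w = P G w"
      using is_parityD(3)[OF assms(1) True assms(3)] by simp_all
    have uv: "u \<in> verts G" "v \<in> verts G"
      using framed4D(1,6)[OF assms(2)] a by auto
    obtain L where L: "distinct L" "set L = even_verts P G" using even_verts_list[OF assms(2)] .
    obtain L' where L': "distinct L'" "set L' = even_verts P ?G'" using even_verts_list[OF f] .
    have "bracket K L (tidied G) = bracket K L' (unbigon a b (tidied G))"
    proof (rule bracket_bigon[OF K r a(1) L(1) _ _ L'(1)])
      show "set L \<subseteq> verts (tidied G)" using L by (auto simp: even_verts_def)
      show "vert (tidied G) a \<in> set L \<longleftrightarrow> vert (tidied G) (mate (tidied G) a) \<in> set L"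
        using a L p(1) uv by (simp add: even_verts_def)
      show "set L' = set L - {vert (tidied G) a, vert (tidied G) (mate (tidied G) a)}"
        using a L L' p(2) v by (auto simp: even_verts_def)
    qed
    then show ?thesis
      using parity_bracket_iff[OF assms(2) L] parity_bracket_iff[OF f L'] u t by simp
  next
    case False
    then show ?thesis using u by (simp add: parity_bracket_def)
  qed
qed

lemma triangle_rotate:
  assumes "triangle G a b c"
  shows "triangle G b c a" "third_move G b c a = third_move G a b c"
proof -
  show "triangle G b c a" using assms unfolding triangle_def by auto
  have "third_swap G b c a = third_swap G a b c"
    unfolding third_swap_def by (simp add: insert_commute)
  then show "third_move G b c a = third_move G a b c" by (simp add: third_move_def)
qed

lemma third_move_unicursal:
  assumes "framed4 G" "triangle G a b c"
  shows "framed4 (third_move G a b c)" "unicursal (third_move G a b c) \<longleftrightarrow> unicursal G"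
proof -
  interpret T: framed_triangle "tidied G" "vert G a" "vert G b" "vert G c"
    a "mate G a" b "mate G b" c "mate G c"
    by (rule triangle_framed_triangle[OF assms])
  note t = tidied_third_move[OF assms]
  show f: "framed4 (third_move G a b c)"
    using T.regular_moved unfolding t[symmetric] regular_tidied_iff .
  have "through T.moved = through (tidied G)"
  proof (rule through_mate_iso)
    show "mate_iso T.swap (tidied G) T.moved"
      unfolding T.moved_def by (rule mate_iso_ren(1)[OF T.tidy T.swap_swap])
    show "opp (tidied G) h \<in> hedges (tidied G) \<and> opp T.moved (T.swap h) = T.swap (opp (tidied G) h)"
      if h: "h \<in> hedges (tidied G)" for h
      using T.opp_swap[OF h] regularD(5)[OF T.regular h] by simp
  qed
  then show "unicursal (third_move G a b c) \<longleftrightarrow> unicursal G"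
    by (simp add: unicursal_through f assms(1) t)
qed

text \<open>With \<open>vert G a\<close> even, an even number of odd vertices forces the other two
  to have equal parity. They are then both smoothed or both kept, as the comparison of brackets for
  the third move demands.\<close>

lemma parity_bracket_triangle_even:
  assumes "is_parity P" "framed4 G" "triangle G a b c" "\<not> P G (vert G a)"
    and K: "regular K" "\<And>x y. \<not> bigon_at K x y" "circles K = 0"
  shows "parity_bracket P K (third_move G a b c) \<longleftrightarrow> parity_bracket P K G"
proof (cases "unicursal G")
  case True
  interpret T: framed_triangle "tidied G" "vert G a" "vert G b" "vert G c"
    a "mate G a" b "mate G b" c "mate G c"
    by (rule triangle_framed_triangle[OF assms(2,3)])
  let ?G' = "third_move G a b c"
  note m = third_move_unicursal[OF assms(2,3)]
  have p: "even (card {w \<in> {vert G a, vert G b, vert G c}. P G w})" "\<forall>w\<in>verts G. P ?G' w = P G w"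
    using is_parityD(4)[OF assms(1) True assms(3)] by simp_all
  have n: "vert G b \<noteq> vert G c" using T.verts by simp
  have bc: "P G (vert G b) \<longleftrightarrow> P G (vert G c)"
  proof (rule ccontr)
    assume ne: "P G (vert G b) \<noteq> P G (vert G c)"
    then have "{w \<in> {vert G a, vert G b, vert G c}. P G w}
        = {if P G (vert G b) then vert G b else vert G c}"
      using assms(4) by auto
    then show False using p(1) by simp
  qed
  have vs: "vert G a \<in> verts G" "vert G b \<in> verts G" "vert G c \<in> verts G"
    using T.frame_facts(9) T.frame_facts(18) T.frame_facts(27) by simp_all
  have e: "even_verts P ?G' = even_verts P G"
    using p(2) by (auto simp: even_verts_def third_move_def)
  obtain L0 where L0: "distinct L0" "set L0 = even_verts P G" using even_verts_list[OF assms(2)] .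
  define L where "L = removeAll (vert G a) L0"
  have L: "distinct (vert G a # L)" "set (vert G a # L) = even_verts P G"
    using L0 assms(4) vs by (auto simp: L_def distinct_removeAll even_verts_def)
  have "bracket K (vert G a # L) T.moved = bracket K (vert G a # L) (tidied G)"
  proof (rule T.bracket_moved[OF K L(1)])
    show "set L \<subseteq> verts (tidied G)" using L by (auto simp: even_verts_def)
    show "vert G b \<in> set L \<longleftrightarrow> vert G c \<in> set L"
      using bc vs T.verts L0 by (auto simp: L_def even_verts_def)
  qed
  then show ?thesis
    using parity_bracket_iff[OF assms(2) L] parity_bracket_iff[OF m(1) L(1)] L(2) e m(2)
      tidied_third_move[OF assms(2,3)] by simp
next
  case False
  then show ?thesis using third_move_unicursal[OF assms(2,3)] by (simp add: parity_bracket_def)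
qed

text \<open>Three is odd, so the vertices cannot all be odd. Some vertex is even, and by the cyclic
  symmetry of the triangle it may be taken as the first.\<close>

lemma parity_bracket_triangle:
  assumes "is_parity P" "framed4 G" "triangle G a b c"
    and K: "regular K" "\<And>x y. \<not> bigon_at K x y" "circles K = 0"
  shows "parity_bracket P K (third_move G a b c) \<longleftrightarrow> parity_bracket P K G"
proof (cases "unicursal G")
  case True
  have d: "distinct [vert G a, vert G b, vert G c]" using assms(3) by (simp add: triangle_def)
  have p: "even (card {w \<in> {vert G a, vert G b, vert G c}. P G w})"
    using is_parityD(4)[OF assms(1) True assms(3)] by simp
  have "\<not> (P G (vert G a) \<and> P G (vert G b) \<and> P G (vert G c))"
  proof
    assume "P G (vert G a) \<and> P G (vert G b) \<and> P G (vert G c)"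
    then have "{w \<in> {vert G a, vert G b, vert G c}. P G w} = {vert G a, vert G b, vert G c}" by auto
    then show False using p d by simp
  qed
  then consider "\<not> P G (vert G a)" | "\<not> P G (vert G b)" | "\<not> P G (vert G c)" by blast
  then show ?thesis
  proof cases
    case 1
    then show ?thesis by (rule parity_bracket_triangle_even[OF assms(1-3) _ K])
  next
    case 2
    note r = triangle_rotate[OF assms(3)]
    show ?thesis using parity_bracket_triangle_even[OF assms(1,2) r(1) 2 K] r(2) by simp
  next
    case 3
    note r = triangle_rotate[OF assms(3)]
    note s = triangle_rotate[OF r(1)]
    show ?thesis using parity_bracket_triangle_even[OF assms(1,2) s(1) 3 K] r(2) s(2) by simp
  qed
next
  case False
  then show ?thesis using third_move_unicursal[OF assms(2,3)] by (simp add: parity_bracket_def)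
qed

lemma parity_bracket_move:
  assumes "is_parity P" "isomorphic G G' \<or> move G G'"
    and K: "regular K" "\<And>x y. \<not> bigon_at K x y" "circles K = 0"
  shows "parity_bracket P K G' \<longleftrightarrow> parity_bracket P K G"
  using assms(2)
proof
  assume "isomorphic G G'"
  then show ?thesis by (rule parity_bracket_isomorphic[OF assms(1)])
next
  assume "move G G'"
  then show ?thesis
  proof cases
    case (first v)
    then show ?thesis using parity_bracket_loop(2)[OF assms(1) _ _ K(3)] by blast
  next
    case (second u v)
    then show ?thesis using parity_bracket_bigon(2)[OF assms(1) _ _ K] by blast
  next
    case (third a b c)
    then show ?thesis using parity_bracket_triangle[OF assms(1) _ _ K] by blast
  qed
qed

lemma parity_bracket_free_link:
  assumes "is_parity P" "G' \<in> free_link G" "parity_bracket P K G"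
    and K: "regular K" "\<And>x y. \<not> bigon_at K x y" "circles K = 0"
  shows "parity_bracket P K G'"
proof -
  have "equivclp (\<lambda>H H'. isomorphic H H' \<or> move H H') G G'"
    using assms(2) unfolding free_link_def by simp
  then show ?thesis
  proof (induction rule: equivclp_induct)
    case base
    show ?case by (rule assms(3))
  next
    case (step y z)
    then show ?case using parity_bracket_move[OF assms(1) _ K] by blast
  qed
qed

lemma card_verts_free_link:
  assumes "is_parity P" "irreducibly_odd P G" "G' \<in> free_link G"
  shows "card (verts G) \<le> card (verts G')"
proof (cases "verts G = {}")
  \<comment> \<open>The case without vertices is split off since the unicursal component of such a
    graph is itself a circle, so that a circle would no longer be an obstruction. There the
    inequality is trivial.\<close>
  case False
  have u: "unicursal G" "framed4 G" using assms(2) by (simp_all add: irreducibly_odd_def unicursal_def)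
  let ?K = "tidied G"
  have K: "regular ?K" using u(2) regular_tidied_iff by blast
  have nb: "\<not> bigon_at ?K x y" for x y
    using assms(2) bigon_at_bigon[OF u(2)] unfolding irreducibly_odd_def by blast
  \<comment> \<open>A vertex provides a half-edge, and the strand through it is the one unicursal
    component; none is left for a circle.\<close>
  have c: "circles ?K = 0"
  proof -
    obtain v where "v \<in> verts G" using False by blast
    then obtain h where h: "h \<in> hedges G" using frame_exists[OF K, of v] unfolding frame_def by auto
    let ?Q = "hedges G // {(x, y). x \<in> hedges G \<and> (y = mate G x \<or> y = opp G x)}\<^sup>*"
    have "finite ?Q" using finite_hedges[OF u(2)] by (auto simp: quotient_def)
    moreover have "?Q \<noteq> {}" using h by (auto simp: quotient_def)
    ultimately have "card ?Q \<noteq> 0" by simp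
    then show ?thesis using u(1) by (simp add: unicursal_def unicursal_components_def)
  qed
  have "isomorphism id id ?K ?K" unfolding isomorphism_def by simp
  then have "reduces_to ?K ?K" by (rule reduces_to.isomorphic[OF K])
  \<comment> \<open>All vertices being odd, nothing is smoothed and the only state of
    \<open>G\<close> is \<open>G\<close> itself.\<close>
  moreover have "even_verts P G = {}" using assms(2) by (auto simp: irreducibly_odd_def even_verts_def)
  ultimately have "parity_bracket P ?K G" using u(1) by (simp add: parity_bracket_def)
  then have "parity_bracket P ?K G'"
    by (rule parity_bracket_free_link[OF assms(1,3) _ K nb c])
  moreover have f: "framed4 G'" using assms(3) by (simp add: free_link_def)
  obtain L where L: "distinct L" "set L = even_verts P G'" using even_verts_list[OF f] .
  ultimately have "bracket ?K L (tidied G')" using parity_bracket_iff[OF f L] by simp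
  then have "card (verts ?K) \<le> card (verts (tidied G'))"
    by (rule bracketD(1)) (use L f regular_tidied_iff in \<open>auto simp: even_verts_def\<close>)
  then show ?thesis by simp
qed simp

section \<open>Smoothings with a prescribed number of vertices\<close>

lemma smooth_at_exists:
  assumes "framed4 G" "v \<in> verts G"
  shows "\<exists>G'. smooth_at G v G' \<and> framed4 G' \<and> verts G' = verts G - {v}"
proof -
  have r: "regular (tidied G)" using assms(1) regular_tidied_iff by blast
  obtain a b where f: "frame (tidied G) v a b" using frame_exists[OF r, of v] assms(2) by auto
  let ?A = "opp G a" and ?B = "opp G b"
  let ?j = "id(a := b, b := a, ?A := ?B, ?B := ?A)"
  let ?G' = "splice G {v} ?j"
  note d = frame_distinct[OF r f, unfolded tidied_simps]
  have Y: "hedges_at G {v} = {a, b, ?A, ?B}"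
    using frame_hedges[OF r f] by (simp add: hedges_at_def)
  have j: "?j a = b" "?j b = a" "?j ?A = ?B" "?j ?B = ?A" using d(1) by auto
  have p: "pairing (tidied G) {a, b, ?A, ?B} ?j"
    unfolding pairing_def using d(1,2) j by auto
  have "glue (tidied G) {a, b, ?A, ?B} ?j
      = glue (cut a b (cut ?A ?B (tidied G))) ({a, b, ?A, ?B} - {a, b, ?A, ?B}) ?j"
    using d(1) finite_hedges[OF assms(1)] j
    by (intro glue_res regularD(1)[OF r] p) auto
  also have "{a, b, ?A, ?B} - {a, b, ?A, ?B} = {}" by blast
  also have "glue (cut a b (cut ?A ?B (tidied G))) {} ?j = cut a b (cut ?A ?B (tidied G))"
    using d(1,2) regularD(1)[OF r] by (intro glue_empty tidy_cut) auto
  finally have g: "glue (tidied G) {a, b, ?A, ?B} ?j = cut a b (cut ?A ?B (tidied G))" .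
  have "tidied ?G' = smooth a b (tidied G)"
    unfolding tidied_splice[OF assms(1)] Y g using d(5)
    by (intro fgraph_eqI) (auto simp: smooth_def res_def)
  then have "framed4 ?G'" using regular_smooth[OF r f] regular_tidied_iff by metis
  moreover have "smooth_at G v ?G'"
    unfolding smooth_at_def using f unfolding frame_def by auto
  moreover have "verts ?G' = verts G - {v}" by (simp add: splice_def)
  ultimately show ?thesis by blast
qed

lemma smoothing_exists:
  assumes "framed4 G" "n \<le> card (verts G)"
  shows "\<exists>G'. is_smoothing G G' \<and> card (verts G') = n"
  using assms
proof (induction "card (verts G) - n" arbitrary: G)
  case 0
  then show ?case unfolding is_smoothing_def by (intro exI[of _ G]) auto
next
  case (Suc k)
  have "verts G \<noteq> {}" using Suc.hyps(2) by auto
  then obtain v where v: "v \<in> verts G" by blast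
  obtain H where H: "smooth_at G v H" "framed4 H" "verts H = verts G - {v}"
    using smooth_at_exists[OF Suc.prems(1) v] by blast
  have "card (verts H) = card (verts G) - 1" using H(3) v by simp
  then have "k = card (verts H) - n" "n \<le> card (verts H)" using Suc.hyps(2) by simp_all
  then obtain G' where "is_smoothing H G'" "card (verts G') = n"
    using Suc.hyps(1) H(2) by blast
  moreover have "is_smoothing G G'"
    using \<open>is_smoothing H G'\<close> unfolding is_smoothing_def
    by (rule converse_rtranclp_into_rtranclp[rotated]) (use H(1) v in blast)
  ultimately show ?case by blast
qed

theorem corollary1:
  fixes P :: "fgraph \<Rightarrow> nat \<Rightarrow> bool" and \<Gamma> :: fgraph
  assumes "is_parity P"
    and "irreducibly_odd P \<Gamma>"
  shows "(\<forall>\<Gamma>'\<in>free_link \<Gamma>. \<exists>\<Gamma>s. is_smoothing \<Gamma>' \<Gamma>s \<and> card (verts \<Gamma>s) = card (verts \<Gamma>)) \<and>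
         is_arg_min (\<lambda>G. card (verts G)) (\<lambda>G. G \<in> free_link \<Gamma>) \<Gamma>"
proof -
  note le = card_verts_free_link[OF assms]
  have "framed4 \<Gamma>" using assms(2) by (simp add: irreducibly_odd_def unicursal_def)
  then have "\<Gamma> \<in> free_link \<Gamma>" by (simp add: free_link_def)
  moreover have "\<exists>\<Gamma>s. is_smoothing \<Gamma>' \<Gamma>s \<and> card (verts \<Gamma>s) = card (verts \<Gamma>)"
    if "\<Gamma>' \<in> free_link \<Gamma>" for \<Gamma>'
    using smoothing_exists[OF _ le[OF that]] that by (simp add: free_link_def)
  ultimately show ?thesis
    using le unfolding is_arg_min_def by (auto simp: not_less)
qed

end
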